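(* Let $\mathcal{S}$ contain the integer ring $(\mathbb{Z},+,\cdot)$, and let $\mathbf{W}$ contain a unary weight symbol $\mathtt{one}$ of type $\mathbb{Z}$ with $\mathtt{one}^{\mathcal{A}}(a)=1$ for all $a\in A$ in every considered $(\sigma,\mathbf{W})$-structure $\mathcal{A}$. Then every $\mathrm{FOW}_1[\mathbb{P}](\sigma,\mathcal{S},\mathbf{W})$-formula $\varphi(\bar{x})$ is equivalent (on all such structures) to a Boolean combination of $\mathrm{FOW}_1[\mathbb{P}](\sigma,\mathcal{S},\mathbf{W})$-formulas $\psi(\bar{x})$ that are local around their free variables $\bar{x}$, of local aggregation sentences in $\mathrm{FOW}_1[\mathbb{P}](\sigma,\mathcal{S},\mathbf{W})$, and of statements of the form "$g\ge1$" for ground cl-terms $g$ of type $\mathbb{Z}$. Moreover, there is an algorithm which transforms an input formula $\varphi(\bar{x})$ into such an equivalent formula $\varphi'(\bar{x})$ and outputs the radius of each ground cl-term in $\varphi'$ as well as a number $r$ such that every local formula in $\varphi'$ is $r$-local.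
   Context: Weighted structures. A signature $\sigma$ is a finite set of relation symbols with arities in $\mathbb{N}$. Let $\mathcal{S}$ be a collection of rings and/or abelian groups. Let $\mathbf{W}$ be a finite set of weight symbols $\mathtt{w}$ with arity $\ge1$ and type $\mathrm{type}(\mathtt{w})\in\mathcal{S}$. A $(\sigma,\mathbf{W})$-structure $\mathcal{A}$: finite non-empty universe $A$, relations $R^{\mathcal{A}}$, functions $\mathtt{w}^{\mathcal{A}}:A^{\mathrm{ar}(\mathtt{w})}\to\mathrm{type}(\mathtt{w})$ such that $\mathtt{w}^{\mathcal{A}}(a_1,\ldots,a_k)\ne0$ implies $k=1$, or $a_1=\cdots=a_k$, or some tuple of some $R^{\mathcal{A}}$ contains all $a_i$. Gaifman graph: vertices $A$, edges between distinct elements co-occurring in some relation tuple; $\mathrm{dist}^{\mathcal{A}}$ its distance; $\mathcal{N}_r^{\mathcal{A}}(\bar{a})$ the induced substructure on the elements at distance $\le r$ from some entry of $\bar{a}$. $\mathrm{dist}(x,y)\le r$ / $>r$ denote first-order formulas expressing distance at most / more than $r$. An $\mathcal{S}$-predicate collection: countably many predicate names $P\in\mathbb{P}$ with arity $m\ge1$, type $(S_1,\ldots,S_m)\in\mathcal{S}^m$, semantics $[\![P]\!]\subseteq S_1\times\cdots\times S_m$. A $\mathbf{W}$-product of type $S$: for a group $S$ that is not a ring, an element of $S$ or $\mathtt{w}(y_1,\ldots,y_k)$ ($\mathrm{type}(\mathtt{w})=S$, pairwise distinct variables); for a ring $S$, a product $t_1\cdots t_\ell$ ($\ell\ge1$)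 of such factors; $\mathrm{vars}(p)$ its variables. The logic $\mathrm{FOW}_1[\mathbb{P}](\sigma,\mathcal{S},\mathbf{W})$: formulas built from $x_1=x_2$, $R(\bar{x})$, $(s=\mathtt{w}(\bar{x}))$ (true iff $s=\mathtt{w}^{\mathcal{A}}$ of the assigned elements), $\neg$, $\vee$, $\exists y$, $(s=\sum\mathtt{w}(y_1,\ldots,y_k).\varphi)$ for $\mathtt{w}$ of finite type $S$, $s\in S$, pairwise distinct $y_i$ (true iff $s$ equals the $S$-sum of $\mathtt{w}^{\mathcal{A}}(\bar{a})$ over all $\bar{a}$ satisfying $\varphi$ as values of $\bar{y}$, empty sum $0$), and $P(t_1,\ldots,t_m)$ for terms of the matching types having together at most one free variable (true iff their values lie in $[\![P]\!]$); these terms are built from elements $s\in S\in\mathcal{S}$, $\mathtt{w}(\bar{x})$ and $+,-$ (and $\cdot$ in rings). $\mathcal{S}$-terms $\sum p.\varphi$ ($\varphi$ a formula, $p$ a $\mathbf{W}$-product of type $S$) denote the $S$-sum over all assignments to $\mathrm{vars}(p)$ (others fixed) satisfying $\varphi$ of the value of $p$; $\mathrm{free}(\sum p.\varphi)=\mathrm{free}(\varphi)\setminus\mathrm{vars}(p)$. A ground term has no free variables. A formula $\psi(\bar{y})$ is $r$-local around its free variables $\bar{y}$ if $\mathcal{A}\models\psi[\bar{a}]$ iff $\mathcal{N}_r^{\mathcal{A}}(\bar{a})\models\psi[\bar{a}]$ for all $\mathcal{A},\bar{a}$; local if $r$-local for some $r$. A local aggregation sentence in $\mathrm{FOW}_1[\mathbb{P}](\sigma,\mathcal{S},\mathbf{W})$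 is a sentence $(s=\sum\mathtt{w}(\bar{y}).\lambda(\bar{y}))$ with $\mathtt{w}\in\mathbf{W}$ (of finite type), $s\in\mathrm{type}(\mathtt{w})$, $\bar{y}$ a tuple of $\mathrm{ar}(\mathtt{w})$ pairwise distinct variables, and $\lambda(\bar{y})$ an $r$-local $\mathrm{FOW}_1[\mathbb{P}](\sigma,\mathcal{S},\mathbf{W})$-formula for some $r$. cl-terms. $\mathcal{G}_k$ is the set of undirected graphs with vertex set $[k]$. For $G\in\mathcal{G}_k$, $r\in\mathbb{N}$, pairwise distinct $\bar{y}=(y_1,\ldots,y_k)$: $\delta^\sigma_{G,r}(\bar{y}):=\bigwedge_{\{i,j\}\in E(G)}\mathrm{dist}(y_i,y_j)\le r\wedge\bigwedge_{\{i,j\}\notin E(G),i\ne j}\mathrm{dist}(y_i,y_j)>r$. A basic cl-term of radius $r$ and width $k$ is $\sum p.(\psi(y_1,\ldots,y_k)\wedge\delta^\sigma_{G,2r+1}(y_1,\ldots,y_k))$ with $\mathrm{vars}(p)\subseteq\{y_1,\ldots,y_k\}$, $\psi$ an $\mathrm{FOW}_1[\mathbb{P}](\sigma,\mathcal{S},\mathbf{W})$-formula $r$-local around $\bar{y}$, and $G\in\mathcal{G}_k$ connected. A cl-term (of radius $\le r$) is built from basic cl-terms (of radius $\le r$) using elements $s\in S\in\mathcal{S}$, terms $\mathtt{w}(\bar{x})$, and $+,-$ (and $\cdot$ for ring type) on terms of equal type. The statement "$g\ge1$" for a ground term $g$ of type $\mathbb{Z}$ holds in $\mathcal{A}$ iff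 $g^{\mathcal{A}}\ge1$. *)

theory Defs
  imports "HOL-Algebra.IntRing" "HOL-Library.Extended_Nat" "HOL-Library.FuncSet"
    "HOL-Library.Infinite_Typeclass"
begin

section \<open>Vocabularies and weighted structures\<close>

text \<open>
  A vocabulary bundles the collection of rings and abelian groups (the family \<open>alg\<close>, indexed by the
  type \<open>'s\<close>; the members with \<open>is_ring\<close> are rings, of the others only the additive part is used),
  the relation symbols, the weight symbols and the predicate collection.  Symbols and predicate names
  are natural numbers.
\<close>

record ('s, 'v) vocab =
  alg :: "'s \<Rightarrow> 'v ring"
  is_ring :: "'s \<Rightarrow> bool"
  rel_syms :: "nat set"
  rel_ar :: "nat \<Rightarrow> nat"
  wt_syms :: "nat set"
  wt_ar :: "nat \<Rightarrow> nat"
  wt_type :: "nat \<Rightarrow> 's"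
  pred_syms :: "nat set"
  pred_type :: "nat \<Rightarrow> 's list"
  pred_sem :: "nat \<Rightarrow> 'v list set"

definition vocabulary :: "('s, 'v) vocab \<Rightarrow> bool" where
  "vocabulary V \<longleftrightarrow>
     (\<forall>S. if is_ring V S then ring (alg V S) else abelian_group (alg V S)) \<and>
     finite (rel_syms V) \<and>
     finite (wt_syms V) \<and> (\<forall>w\<in>wt_syms V. wt_ar V w \<ge> 1) \<and>
     (\<forall>P\<in>pred_syms V. pred_type V P \<noteq> [] \<and>
        pred_sem V P \<subseteq> {vs. list_all2 (\<lambda>v S. v \<in> carrier (alg V S)) vs (pred_type V P)})"

record ('a, 'v) wstruct =
  univ :: "'a set"
  rel :: "nat \<Rightarrow> 'a list set"
  wt :: "nat \<Rightarrow> 'a list \<Rightarrow> 'v"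

definition tuples :: "nat \<Rightarrow> 'a set \<Rightarrow> 'a list set" where
  "tuples k X = {as. length as = k \<and> set as \<subseteq> X}"

definition is_structure :: "('s, 'v) vocab \<Rightarrow> ('a, 'v) wstruct \<Rightarrow> bool" where
  "is_structure V A \<longleftrightarrow>
     finite (univ A) \<and> univ A \<noteq> {} \<and>
     (\<forall>R\<in>rel_syms V. rel A R \<subseteq> tuples (rel_ar V R) (univ A)) \<and>
     (\<forall>w\<in>wt_syms V. \<forall>as\<in>tuples (wt_ar V w) (univ A).
        wt A w as \<in> carrier (alg V (wt_type V w)) \<and>
        (wt A w as \<noteq> \<zero>\<^bsub>alg V (wt_type V w)\<^esub> \<longrightarrow>
           wt_ar V w = 1 \<or> (\<forall>a\<in>set as. \<forall>b\<in>set as. a = b) \<or>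
           (\<exists>R\<in>rel_syms V. \<exists>t\<in>rel A R. set as \<subseteq> set t)))"

definition gaifman :: "('s, 'v) vocab \<Rightarrow> ('a, 'v) wstruct \<Rightarrow> ('a \<times> 'a) set" where
  "gaifman V A = {(a, b). a \<in> univ A \<and> b \<in> univ A \<and> a \<noteq> b \<and>
     (\<exists>R\<in>rel_syms V. \<exists>t\<in>rel A R. a \<in> set t \<and> b \<in> set t)}"

definition gdist :: "('s, 'v) vocab \<Rightarrow> ('a, 'v) wstruct \<Rightarrow> 'a \<Rightarrow> 'a \<Rightarrow> enat" where
  "gdist V A a b = (INF n\<in>{n. (a, b) \<in> gaifman V A ^^ n}. enat n)"

text \<open>
  The induced substructure need not satisfy the support condition on weights of \<open>is_structure\<close>:
  the relation tuple witnessing it may leave the subset.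
\<close>

definition induced :: "('a, 'v) wstruct \<Rightarrow> 'a set \<Rightarrow> ('a, 'v) wstruct" where
  "induced A X = \<lparr>univ = X, rel = (\<lambda>R. {t \<in> rel A R. set t \<subseteq> X}), wt = wt A\<rparr>"

definition nbh :: "('s, 'v) vocab \<Rightarrow> nat \<Rightarrow> ('a, 'v) wstruct \<Rightarrow> 'a set \<Rightarrow> ('a, 'v) wstruct" where
  "nbh V r A X = induced A {b \<in> univ A. \<exists>a\<in>X. gdist V A a b \<le> enat r}"

section \<open>The logic FOW1\<close>

datatype ('s, 'v) trm =
    TElem 's 'v
  | TWt nat "nat list"
  | TAdd "('s, 'v) trm" "('s, 'v) trm"
  | TSub "('s, 'v) trm" "('s, 'v) trm"
  | TMul "('s, 'v) trm" "('s, 'v) trm"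

text \<open>
  \<open>WEq s w xs\<close> is \<open>(s = w(xs))\<close>; \<open>WSum s w ys \<phi>\<close> is \<open>(s = \<Sum> w(ys). \<phi>)\<close>.
\<close>

datatype ('s, 'v) fm =
    Eq nat nat
  | Rel nat "nat list"
  | WEq 'v nat "nat list"
  | Neg "('s, 'v) fm"
  | Or "('s, 'v) fm" "('s, 'v) fm"
  | Ex nat "('s, 'v) fm"
  | WSum 'v nat "nat list" "('s, 'v) fm"
  | Pred nat "('s, 'v) trm list"

primrec trm_type :: "('s, 'v) vocab \<Rightarrow> ('s, 'v) trm \<Rightarrow> 's \<Rightarrow> bool" where
  "trm_type V (TElem S' s) S \<longleftrightarrow> S' = S \<and> s \<in> carrier (alg V S)"
| "trm_type V (TWt w xs) S \<longleftrightarrow> w \<in> wt_syms V \<and> wt_type V w = S \<and> length xs = wt_ar V w"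
| "trm_type V (TAdd t u) S \<longleftrightarrow> trm_type V t S \<and> trm_type V u S"
| "trm_type V (TSub t u) S \<longleftrightarrow> trm_type V t S \<and> trm_type V u S"
| "trm_type V (TMul t u) S \<longleftrightarrow> is_ring V S \<and> trm_type V t S \<and> trm_type V u S"

primrec trm_vars :: "('s, 'v) trm \<Rightarrow> nat set" where
  "trm_vars (TElem S s) = {}"
| "trm_vars (TWt w xs) = set xs"
| "trm_vars (TAdd t u) = trm_vars t \<union> trm_vars u"
| "trm_vars (TSub t u) = trm_vars t \<union> trm_vars u"
| "trm_vars (TMul t u) = trm_vars t \<union> trm_vars u"

primrec fow1 :: "('s, 'v) vocab \<Rightarrow> ('s, 'v) fm \<Rightarrow> bool" where
  "fow1 V (Eq x y) \<longleftrightarrow> True"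
| "fow1 V (Rel R xs) \<longleftrightarrow> R \<in> rel_syms V \<and> length xs = rel_ar V R"
| "fow1 V (WEq s w xs) \<longleftrightarrow>
     w \<in> wt_syms V \<and> s \<in> carrier (alg V (wt_type V w)) \<and> length xs = wt_ar V w"
| "fow1 V (Neg \<phi>) \<longleftrightarrow> fow1 V \<phi>"
| "fow1 V (Or \<phi> \<psi>) \<longleftrightarrow> fow1 V \<phi> \<and> fow1 V \<psi>"
| "fow1 V (Ex y \<phi>) \<longleftrightarrow> fow1 V \<phi>"
| "fow1 V (WSum s w ys \<phi>) \<longleftrightarrow>
     w \<in> wt_syms V \<and> finite (carrier (alg V (wt_type V w))) \<and>
     s \<in> carrier (alg V (wt_type V w)) \<and> length ys = wt_ar V w \<and> distinct ys \<and> fow1 V \<phi>"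
| "fow1 V (Pred P ts) \<longleftrightarrow>
     P \<in> pred_syms V \<and> list_all2 (trm_type V) ts (pred_type V P) \<and>
     card (\<Union>t\<in>set ts. trm_vars t) \<le> 1"

primrec free :: "('s, 'v) fm \<Rightarrow> nat set" where
  "free (Eq x y) = {x, y}"
| "free (Rel R xs) = set xs"
| "free (WEq s w xs) = set xs"
| "free (Neg \<phi>) = free \<phi>"
| "free (Or \<phi> \<psi>) = free \<phi> \<union> free \<psi>"
| "free (Ex y \<phi>) = free \<phi> - {y}"
| "free (WSum s w ys \<phi>) = free \<phi> - set ys"
| "free (Pred P ts) = (\<Union>t\<in>set ts. trm_vars t)"

primrec trm_val :: "('s, 'v) vocab \<Rightarrow> ('a, 'v) wstruct \<Rightarrow> (nat \<Rightarrow> 'a) \<Rightarrow> 's \<Rightarrow> ('s, 'v) trm \<Rightarrow> 'v" where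
  "trm_val V A \<beta> S (TElem S' s) = s"
| "trm_val V A \<beta> S (TWt w xs) = wt A w (map \<beta> xs)"
| "trm_val V A \<beta> S (TAdd t u) = trm_val V A \<beta> S t \<oplus>\<^bsub>alg V S\<^esub> trm_val V A \<beta> S u"
| "trm_val V A \<beta> S (TSub t u) = trm_val V A \<beta> S t \<ominus>\<^bsub>alg V S\<^esub> trm_val V A \<beta> S u"
| "trm_val V A \<beta> S (TMul t u) = trm_val V A \<beta> S t \<otimes>\<^bsub>alg V S\<^esub> trm_val V A \<beta> S u"

definition upd :: "(nat \<Rightarrow> 'a) \<Rightarrow> nat list \<Rightarrow> 'a list \<Rightarrow> nat \<Rightarrow> 'a" where
  "upd \<beta> ys as x = (case map_of (zip ys as) x of None \<Rightarrow> \<beta> x | Some a \<Rightarrow> a)"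

primrec sat :: "('s, 'v) vocab \<Rightarrow> ('a, 'v) wstruct \<Rightarrow> (nat \<Rightarrow> 'a) \<Rightarrow> ('s, 'v) fm \<Rightarrow> bool" where
  "sat V A \<beta> (Eq x y) \<longleftrightarrow> \<beta> x = \<beta> y"
| "sat V A \<beta> (Rel R xs) \<longleftrightarrow> map \<beta> xs \<in> rel A R"
| "sat V A \<beta> (WEq s w xs) \<longleftrightarrow> s = wt A w (map \<beta> xs)"
| "sat V A \<beta> (Neg \<phi>) \<longleftrightarrow> \<not> sat V A \<beta> \<phi>"
| "sat V A \<beta> (Or \<phi> \<psi>) \<longleftrightarrow> sat V A \<beta> \<phi> \<or> sat V A \<beta> \<psi>"
| "sat V A \<beta> (Ex y \<phi>) \<longleftrightarrow> (\<exists>a\<in>univ A. sat V A (\<beta>(y := a)) \<phi>)"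
| "sat V A \<beta> (WSum s w ys \<phi>) \<longleftrightarrow>
     s = finsum (alg V (wt_type V w)) (wt A w)
           {as \<in> tuples (length ys) (univ A). sat V A (upd \<beta> ys as) \<phi>}"
| "sat V A \<beta> (Pred P ts) \<longleftrightarrow>
     map2 (\<lambda>S t. trm_val V A \<beta> S t) (pred_type V P) ts \<in> pred_sem V P"

text \<open>
  Locality is relative to a class \<open>K\<close> of considered structures.  The set \<open>Y\<close> of variables has to be
  nonempty, since the neighbourhood of an empty tuple has no element, but universes are nonempty.
\<close>

definition local_around ::
  "('s, 'v) vocab \<Rightarrow> ('a, 'v) wstruct set \<Rightarrow> nat \<Rightarrow> ('s, 'v) fm \<Rightarrow> nat set \<Rightarrow> bool" where
  "local_around V K r \<psi> Y \<longleftrightarrow> Y \<noteq> {} \<and> free \<psi> \<subseteq> Y \<and>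
     (\<forall>A\<in>K. \<forall>\<beta>. \<beta> ` Y \<subseteq> univ A \<longrightarrow> sat V A \<beta> \<psi> = sat V (nbh V r A (\<beta> ` Y)) \<beta> \<psi>)"

section \<open>Distance formulas\<close>

definition Top :: "('s, 'v) fm" where
  "Top = Ex 0 (Eq 0 0)"

definition And :: "('s, 'v) fm \<Rightarrow> ('s, 'v) fm \<Rightarrow> ('s, 'v) fm" where
  "And \<phi> \<psi> = Neg (Or (Neg \<phi>) (Neg \<psi>))"

definition Conj :: "('s, 'v) fm list \<Rightarrow> ('s, 'v) fm" where
  "Conj \<phi>s = foldr And \<phi>s Top"

definition Disj :: "('s, 'v) fm list \<Rightarrow> ('s, 'v) fm" where
  "Disj \<phi>s = foldr Or \<phi>s (Neg Top)"

definition cooccur_fm :: "('s, 'v) vocab \<Rightarrow> nat \<Rightarrow> nat \<Rightarrow> ('s, 'v) fm" where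
  "cooccur_fm V x y = Disj (map (\<lambda>R.
     let zs = [Suc (x + y) ..< Suc (x + y) + rel_ar V R] in
     foldr Ex zs (And (Rel R zs) (And (Disj (map (Eq x) zs)) (Disj (map (Eq y) zs)))))
     (sorted_list_of_set (rel_syms V)))"

fun dist_le_fm :: "('s, 'v) vocab \<Rightarrow> nat \<Rightarrow> nat \<Rightarrow> nat \<Rightarrow> ('s, 'v) fm" where
  "dist_le_fm V 0 x y = Eq x y"
| "dist_le_fm V (Suc r) x y = (let z = Suc (x + y) in
     Ex z (And (dist_le_fm V r x z) (Or (Eq z y) (cooccur_fm V z y))))"

section \<open>cl-terms\<close>

text \<open>Undirected graphs on the vertex set \<open>{0..<k}\<close>, given by their sets of edges.\<close>

definition graphs :: "nat \<Rightarrow> nat set set set" where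
  "graphs k = {E. \<forall>e\<in>E. e \<subseteq> {..<k} \<and> card e = 2}"

definition connected_graph :: "nat \<Rightarrow> nat set set \<Rightarrow> bool" where
  "connected_graph k E \<longleftrightarrow> k \<ge> 1 \<and> (\<forall>i<k. \<forall>j<k. (i, j) \<in> {(a, b). {a, b} \<in> E}\<^sup>*)"

definition delta :: "('s, 'v) vocab \<Rightarrow> nat set set \<Rightarrow> nat \<Rightarrow> nat list \<Rightarrow> ('s, 'v) fm" where
  "delta V E r ys = Conj
     [if {i, j} \<in> E then dist_le_fm V r (ys ! i) (ys ! j) else Neg (dist_le_fm V r (ys ! i) (ys ! j)).
        j \<leftarrow> [0..<length ys], i \<leftarrow> [0..<j]]"

datatype 'v factor = FElem 'v | FWt nat "nat list"

primrec factor_type :: "('s, 'v) vocab \<Rightarrow> 's \<Rightarrow> 'v factor \<Rightarrow> bool" where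
  "factor_type V S (FElem s) \<longleftrightarrow> s \<in> carrier (alg V S)"
| "factor_type V S (FWt w ys) \<longleftrightarrow>
     w \<in> wt_syms V \<and> wt_type V w = S \<and> length ys = wt_ar V w \<and> distinct ys"

text \<open>A \<open>W\<close>-product is the list of its factors; it is a single factor if the type is not a ring.\<close>

definition is_product :: "('s, 'v) vocab \<Rightarrow> 's \<Rightarrow> 'v factor list \<Rightarrow> bool" where
  "is_product V S p \<longleftrightarrow> p \<noteq> [] \<and> (\<forall>f\<in>set p. factor_type V S f) \<and> (\<not> is_ring V S \<longrightarrow> length p = 1)"

primrec factor_vars :: "'v factor \<Rightarrow> nat set" where
  "factor_vars (FElem s) = {}"
| "factor_vars (FWt w ys) = set ys"

definition product_vars :: "'v factor list \<Rightarrow> nat set" where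
  "product_vars p = (\<Union>f\<in>set p. factor_vars f)"

primrec factor_val :: "('a, 'v) wstruct \<Rightarrow> (nat \<Rightarrow> 'a) \<Rightarrow> 'v factor \<Rightarrow> 'v" where
  "factor_val A \<beta> (FElem s) = s"
| "factor_val A \<beta> (FWt w ys) = wt A w (map \<beta> ys)"

fun product_val ::
  "('s, 'v) vocab \<Rightarrow> ('a, 'v) wstruct \<Rightarrow> (nat \<Rightarrow> 'a) \<Rightarrow> 's \<Rightarrow> 'v factor list \<Rightarrow> 'v" where
  "product_val V A \<beta> S [] = undefined"
| "product_val V A \<beta> S [f] = factor_val A \<beta> f"
| "product_val V A \<beta> S (f # g # fs) =
     factor_val A \<beta> f \<otimes>\<^bsub>alg V S\<^esub> product_val V A \<beta> S (g # fs)"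

text \<open>\<open>CSum S p \<chi>\<close> is the term \<open>\<Sum> p. \<chi>\<close> with \<open>p\<close> of type \<open>S\<close>.\<close>

datatype ('s, 'v) cl =
    CElem 's 'v
  | CWt nat "nat list"
  | CSum 's "'v factor list" "('s, 'v) fm"
  | CAdd "('s, 'v) cl" "('s, 'v) cl"
  | CSub "('s, 'v) cl" "('s, 'v) cl"
  | CMul "('s, 'v) cl" "('s, 'v) cl"

primrec cl_free :: "('s, 'v) cl \<Rightarrow> nat set" where
  "cl_free (CElem S s) = {}"
| "cl_free (CWt w xs) = set xs"
| "cl_free (CSum S p \<chi>) = free \<chi> - product_vars p"
| "cl_free (CAdd t u) = cl_free t \<union> cl_free u"
| "cl_free (CSub t u) = cl_free t \<union> cl_free u"
| "cl_free (CMul t u) = cl_free t \<union> cl_free u"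

primrec cl_val :: "('s, 'v) vocab \<Rightarrow> ('a, 'v) wstruct \<Rightarrow> (nat \<Rightarrow> 'a) \<Rightarrow> 's \<Rightarrow> ('s, 'v) cl \<Rightarrow> 'v" where
  "cl_val V A \<beta> S (CElem S' s) = s"
| "cl_val V A \<beta> S (CWt w xs) = wt A w (map \<beta> xs)"
| "cl_val V A \<beta> S (CSum S' p \<chi>) =
     finsum (alg V S) (\<lambda>f. product_val V A (override_on \<beta> f (product_vars p)) S p)
       {f \<in> product_vars p \<rightarrow>\<^sub>E univ A. sat V A (override_on \<beta> f (product_vars p)) \<chi>}"
| "cl_val V A \<beta> S (CAdd t u) = cl_val V A \<beta> S t \<oplus>\<^bsub>alg V S\<^esub> cl_val V A \<beta> S u"
| "cl_val V A \<beta> S (CSub t u) = cl_val V A \<beta> S t \<ominus>\<^bsub>alg V S\<^esub> cl_val V A \<beta> S u"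
| "cl_val V A \<beta> S (CMul t u) = cl_val V A \<beta> S t \<otimes>\<^bsub>alg V S\<^esub> cl_val V A \<beta> S u"

definition basic_cl ::
  "('s, 'v) vocab \<Rightarrow> ('a, 'v) wstruct set \<Rightarrow> nat \<Rightarrow> nat \<Rightarrow> 's \<Rightarrow> 'v factor list \<Rightarrow> ('s, 'v) fm \<Rightarrow> bool" where
  "basic_cl V K r k S p \<chi> \<longleftrightarrow>
     (\<exists>ys \<psi> E. length ys = k \<and> distinct ys \<and> E \<in> graphs k \<and> connected_graph k E \<and>
        is_product V S p \<and> product_vars p \<subseteq> set ys \<and>
        fow1 V \<psi> \<and> local_around V K r \<psi> (set ys) \<and>
        \<chi> = And \<psi> (delta V E (2 * r + 1) ys))"

primrec cl_term ::
  "('s, 'v) vocab \<Rightarrow> ('a, 'v) wstruct set \<Rightarrow> nat \<Rightarrow> ('s, 'v) cl \<Rightarrow> 's \<Rightarrow> bool" where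
  "cl_term V K r (CElem S' s) S \<longleftrightarrow> S' = S \<and> s \<in> carrier (alg V S)"
| "cl_term V K r (CWt w xs) S \<longleftrightarrow> w \<in> wt_syms V \<and> wt_type V w = S \<and> length xs = wt_ar V w"
| "cl_term V K r (CSum S' p \<chi>) S \<longleftrightarrow> S' = S \<and> (\<exists>r'\<le>r. \<exists>k. basic_cl V K r' k S p \<chi>)"
| "cl_term V K r (CAdd t u) S \<longleftrightarrow> cl_term V K r t S \<and> cl_term V K r u S"
| "cl_term V K r (CSub t u) S \<longleftrightarrow> cl_term V K r t S \<and> cl_term V K r u S"
| "cl_term V K r (CMul t u) S \<longleftrightarrow> is_ring V S \<and> cl_term V K r t S \<and> cl_term V K r u S"

section \<open>Boolean combinations\<close>

datatype ('s, 'v) bc =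
    Local "('s, 'v) fm"
  | Agg "('s, 'v) fm"
  | Ge1 "('s, 'v) cl"
  | BNeg "('s, 'v) bc"
  | BOr "('s, 'v) bc" "('s, 'v) bc"

text \<open>
  \<open>Z\<close> is the index of the ring of integers in the family \<open>alg\<close> and \<open>\<iota>\<close> identifies \<open>int\<close> with it.
\<close>

primrec bc_sat ::
  "('s, 'v) vocab \<Rightarrow> 's \<Rightarrow> (int \<Rightarrow> 'v) \<Rightarrow> ('a, 'v) wstruct \<Rightarrow> (nat \<Rightarrow> 'a) \<Rightarrow> ('s, 'v) bc \<Rightarrow> bool" where
  "bc_sat V Z \<iota> A \<beta> (Local \<psi>) \<longleftrightarrow> sat V A \<beta> \<psi>"
| "bc_sat V Z \<iota> A \<beta> (Agg \<chi>) \<longleftrightarrow> sat V A \<beta> \<chi>"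
| "bc_sat V Z \<iota> A \<beta> (Ge1 g) \<longleftrightarrow> (\<exists>n\<ge>1. cl_val V A \<beta> Z g = \<iota> n)"
| "bc_sat V Z \<iota> A \<beta> (BNeg \<Phi>) \<longleftrightarrow> \<not> bc_sat V Z \<iota> A \<beta> \<Phi>"
| "bc_sat V Z \<iota> A \<beta> (BOr \<Phi> \<Psi>) \<longleftrightarrow> bc_sat V Z \<iota> A \<beta> \<Phi> \<or> bc_sat V Z \<iota> A \<beta> \<Psi>"

text \<open>A local aggregation sentence whose formula \<open>\<lambda>\<close> is \<open>r\<close>-local.\<close>

definition local_agg_sentence ::
  "('s, 'v) vocab \<Rightarrow> ('a, 'v) wstruct set \<Rightarrow> nat \<Rightarrow> ('s, 'v) fm \<Rightarrow> bool" where
  "local_agg_sentence V K r \<chi> \<longleftrightarrow>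
     fow1 V \<chi> \<and> free \<chi> = {} \<and>
     (\<exists>s w ys l. \<chi> = WSum s w ys l \<and> local_around V K r l (set ys))"

primrec local_leaves :: "('s, 'v) bc \<Rightarrow> ('s, 'v) fm set" where
  "local_leaves (Local \<psi>) = {\<psi>}"
| "local_leaves (Agg \<chi>) = {}"
| "local_leaves (Ge1 g) = {}"
| "local_leaves (BNeg \<Phi>) = local_leaves \<Phi>"
| "local_leaves (BOr \<Phi> \<Psi>) = local_leaves \<Phi> \<union> local_leaves \<Psi>"

primrec agg_leaves :: "('s, 'v) bc \<Rightarrow> ('s, 'v) fm set" where
  "agg_leaves (Local \<psi>) = {}"
| "agg_leaves (Agg \<chi>) = {\<chi>}"
| "agg_leaves (Ge1 g) = {}"
| "agg_leaves (BNeg \<Phi>) = agg_leaves \<Phi>"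
| "agg_leaves (BOr \<Phi> \<Psi>) = agg_leaves \<Phi> \<union> agg_leaves \<Psi>"

text \<open>The cl-terms of a Boolean combination, listed from left to right.\<close>

primrec cl_leaves :: "('s, 'v) bc \<Rightarrow> ('s, 'v) cl list" where
  "cl_leaves (Local \<psi>) = []"
| "cl_leaves (Agg \<chi>) = []"
| "cl_leaves (Ge1 g) = [g]"
| "cl_leaves (BNeg \<Phi>) = cl_leaves \<Phi>"
| "cl_leaves (BOr \<Phi> \<Psi>) = cl_leaves \<Phi> @ cl_leaves \<Psi>"

definition normal_form ::
  "('s, 'v) vocab \<Rightarrow> ('a, 'v) wstruct set \<Rightarrow> 's \<Rightarrow> nat set \<Rightarrow> ('s, 'v) bc \<Rightarrow> bool" where
  "normal_form V K Z X \<Phi> \<longleftrightarrow>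
     (\<forall>\<psi>\<in>local_leaves \<Phi>. fow1 V \<psi> \<and> free \<psi> \<subseteq> X \<and> (\<exists>r. local_around V K r \<psi> (free \<psi>))) \<and>
     (\<forall>\<chi>\<in>agg_leaves \<Phi>. \<exists>r. local_agg_sentence V K r \<chi>) \<and>
     (\<forall>g\<in>set (cl_leaves \<Phi>). cl_free g = {} \<and> (\<exists>r. cl_term V K r g Z))"

definition equivalent_on ::
  "('s, 'v) vocab \<Rightarrow> ('a, 'v) wstruct set \<Rightarrow> 's \<Rightarrow> (int \<Rightarrow> 'v) \<Rightarrow> ('s, 'v) fm \<Rightarrow> ('s, 'v) bc \<Rightarrow> bool" where
  "equivalent_on V K Z \<iota> \<phi> \<Phi> \<longleftrightarrow>
     (\<forall>A\<in>K. \<forall>\<beta>. \<beta> ` free \<phi> \<subseteq> univ A \<longrightarrow> sat V A \<beta> \<phi> = bc_sat V Z \<iota> A \<beta> \<Phi>)"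

text \<open>
  The considered structures.  If \<open>'a\<close> is infinite, every structure is isomorphic to one with
  elements in \<open>'a\<close>, since universes are finite.
\<close>

definition structures_with_one ::
  "('s, 'v) vocab \<Rightarrow> (int \<Rightarrow> 'v) \<Rightarrow> nat \<Rightarrow> ('a, 'v) wstruct set" where
  "structures_with_one V \<iota> w1 = {A. is_structure V A \<and> (\<forall>a\<in>univ A. wt A w1 [a] = \<iota> 1)}"

section \<open>Algorithms\<close>

text \<open>
  Formulas may contain elements of arbitrary (possibly uncountable) rings and groups, so they are not
  words over a finite alphabet.  Algorithms work on binary trees with atoms; the atoms, used for the
  elements and their types, are opaque: they can only be copied, compared, and produced from the finitely
  many constants fixed in the algorithm.  \<open>computable\<close> is Kleene's definition of the total
  recursive functions, with primitive recursion on trees instead of numbers (minimization is only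
  applied when a zero exists for every argument).
\<close>

datatype 'c tree = Leaf | Atom 'c | Node "'c tree" "'c tree"

primrec left :: "'c tree \<Rightarrow> 'c tree" where
  "left Leaf = Leaf" | "left (Atom c) = Leaf" | "left (Node a b) = a"

primrec right :: "'c tree \<Rightarrow> 'c tree" where
  "right Leaf = Leaf" | "right (Atom c) = Leaf" | "right (Node a b) = b"

primrec tree_rec ::
  "('c tree \<Rightarrow> 'c tree) \<Rightarrow> ('c tree \<Rightarrow> 'c tree) \<Rightarrow> ('c tree \<Rightarrow> 'c tree) \<Rightarrow> 'c tree \<Rightarrow> 'c tree \<Rightarrow> 'c tree"
where
  "tree_rec f g h p Leaf = f p"
| "tree_rec f g h p (Atom c) = g (Node p (Atom c))"
| "tree_rec f g h p (Node a b) =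
     h (Node (Node p (Node a b)) (Node (tree_rec f g h p a) (tree_rec f g h p b)))"

primrec enc_nat :: "nat \<Rightarrow> 'c tree" where
  "enc_nat 0 = Leaf"
| "enc_nat (Suc n) = Node Leaf (enc_nat n)"

inductive computable :: "('c tree \<Rightarrow> 'c tree) \<Rightarrow> bool" where
  ident: "computable (\<lambda>x. x)"
| const: "computable (\<lambda>x. d)"
| left: "computable left"
| right: "computable right"
| node: "computable f \<Longrightarrow> computable g \<Longrightarrow> computable (\<lambda>x. Node (f x) (g x))"
| comp: "computable f \<Longrightarrow> computable g \<Longrightarrow> computable (\<lambda>x. f (g x))"
| if_eq: "computable f \<Longrightarrow> computable g \<Longrightarrow> computable h \<Longrightarrow> computable k \<Longrightarrow>
    computable (\<lambda>x. if f x = g x then h x else k x)"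
| prim_rec: "computable f \<Longrightarrow> computable g \<Longrightarrow> computable h \<Longrightarrow>
    computable (\<lambda>x. tree_rec f g h (left x) (right x))"
| minimize: "computable f \<Longrightarrow> (\<And>x. \<exists>n. f (Node x (enc_nat n)) = Leaf) \<Longrightarrow>
    computable (\<lambda>x. enc_nat (LEAST n. f (Node x (enc_nat n)) = Leaf))"

fun enc_list :: "('x \<Rightarrow> 'c tree) \<Rightarrow> 'x list \<Rightarrow> 'c tree" where
  "enc_list e [] = Leaf"
| "enc_list e (x # xs) = Node (e x) (enc_list e xs)"

abbreviation enc_nats :: "nat list \<Rightarrow> 'c tree" where
  "enc_nats \<equiv> enc_list enc_nat"

abbreviation enc_elem :: "'v \<Rightarrow> ('s + 'v) tree" where
  "enc_elem s \<equiv> Atom (Inr s)"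

abbreviation enc_type :: "'s \<Rightarrow> ('s + 'v) tree" where
  "enc_type S \<equiv> Atom (Inl S)"

abbreviation tag :: "nat \<Rightarrow> 'c tree list \<Rightarrow> 'c tree" where
  "tag n ts \<equiv> Node (enc_nat n) (enc_list (\<lambda>t. t) ts)"

primrec enc_trm :: "('s, 'v) trm \<Rightarrow> ('s + 'v) tree" where
  "enc_trm (TElem S s) = tag 0 [enc_type S, enc_elem s]"
| "enc_trm (TWt w xs) = tag 1 [enc_nat w, enc_nats xs]"
| "enc_trm (TAdd t u) = tag 2 [enc_trm t, enc_trm u]"
| "enc_trm (TSub t u) = tag 3 [enc_trm t, enc_trm u]"
| "enc_trm (TMul t u) = tag 4 [enc_trm t, enc_trm u]"

primrec enc_fm :: "('s, 'v) fm \<Rightarrow> ('s + 'v) tree" where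
  "enc_fm (Eq x y) = tag 0 [enc_nat x, enc_nat y]"
| "enc_fm (Rel R xs) = tag 1 [enc_nat R, enc_nats xs]"
| "enc_fm (WEq s w xs) = tag 2 [enc_elem s, enc_nat w, enc_nats xs]"
| "enc_fm (Neg \<phi>) = tag 3 [enc_fm \<phi>]"
| "enc_fm (Or \<phi> \<psi>) = tag 4 [enc_fm \<phi>, enc_fm \<psi>]"
| "enc_fm (Ex y \<phi>) = tag 5 [enc_nat y, enc_fm \<phi>]"
| "enc_fm (WSum s w ys \<phi>) = tag 6 [enc_elem s, enc_nat w, enc_nats ys, enc_fm \<phi>]"
| "enc_fm (Pred P ts) = tag 7 [enc_nat P, enc_list enc_trm ts]"

primrec enc_factor :: "'v factor \<Rightarrow> ('s + 'v) tree" where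
  "enc_factor (FElem s) = tag 0 [enc_elem s]"
| "enc_factor (FWt w ys) = tag 1 [enc_nat w, enc_nats ys]"

primrec enc_cl :: "('s, 'v) cl \<Rightarrow> ('s + 'v) tree" where
  "enc_cl (CElem S s) = tag 0 [enc_type S, enc_elem s]"
| "enc_cl (CWt w xs) = tag 1 [enc_nat w, enc_nats xs]"
| "enc_cl (CSum S p \<chi>) = tag 2 [enc_type S, enc_list enc_factor p, enc_fm \<chi>]"
| "enc_cl (CAdd t u) = tag 3 [enc_cl t, enc_cl u]"
| "enc_cl (CSub t u) = tag 4 [enc_cl t, enc_cl u]"
| "enc_cl (CMul t u) = tag 5 [enc_cl t, enc_cl u]"

primrec enc_bc :: "('s, 'v) bc \<Rightarrow> ('s + 'v) tree" where
  "enc_bc (Local \<psi>) = tag 0 [enc_fm \<psi>]"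
| "enc_bc (Agg \<chi>) = tag 1 [enc_fm \<chi>]"
| "enc_bc (Ge1 g) = tag 2 [enc_cl g]"
| "enc_bc (BNeg \<Phi>) = tag 3 [enc_bc \<Phi>]"
| "enc_bc (BOr \<Phi> \<Psi>) = tag 4 [enc_bc \<Phi>, enc_bc \<Psi>]"

text \<open>
  The output of the algorithm: the Boolean combination, the radii of its ground cl-terms (in the order of
  \<open>cl_leaves\<close>), and the locality radius of its local formulas.
\<close>

definition enc_output :: "('s, 'v) bc \<Rightarrow> nat list \<Rightarrow> nat \<Rightarrow> ('s + 'v) tree" where
  "enc_output \<Phi> rs r = tag 0 [enc_bc \<Phi>, enc_nats rs, enc_nat r]"

lemma enc_nat_inject [simp]: "enc_nat m = enc_nat n \<longleftrightarrow> m = n"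
proof (induction m arbitrary: n)
  case 0 show ?case by (cases n) auto
next
  case (Suc m) then show ?case by (cases n) auto
qed

lemma enc_list_inject:
  assumes "\<And>x y. x \<in> set xs \<Longrightarrow> e x = e y \<Longrightarrow> x = y"
  shows "enc_list e xs = enc_list e ys \<Longrightarrow> xs = ys"
  using assms
proof (induction xs arbitrary: ys)
  case Nil then show ?case by (cases ys) auto
next
  case (Cons x xs) then show ?case by (cases ys) auto
qed

lemma enc_list_inject_iff: "(\<And>x y. e x = e y \<Longrightarrow> x = y) \<Longrightarrow> enc_list e xs = enc_list e ys \<longleftrightarrow> xs = ys"
  using enc_list_inject[of xs e ys] by blast

lemma enc_nats_inject [simp]: "enc_nats xs = enc_nats ys \<longleftrightarrow> xs = ys"
  by (rule enc_list_inject_iff) simp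

lemma enc_trm_inject [simp]: "enc_trm t = enc_trm u \<longleftrightarrow> t = u"
proof (induction t arbitrary: u)
qed (case_tac u; auto simp: numeral_eq_Suc)+

lemma enc_trms_inject [simp]: "enc_list enc_trm xs = enc_list enc_trm ys \<longleftrightarrow> xs = ys"
  by (rule enc_list_inject_iff) simp

lemma enc_fm_inject [simp]: "enc_fm \<phi> = enc_fm \<psi> \<longleftrightarrow> \<phi> = \<psi>"
proof (induction \<phi> arbitrary: \<psi>)
qed (case_tac \<psi>; auto simp: numeral_eq_Suc)+

lemma enc_factor_inject [simp]: "enc_factor p = enc_factor q \<longleftrightarrow> p = q"
  by (cases p; cases q) (auto simp: numeral_eq_Suc)

lemma enc_factors_inject [simp]: "enc_list enc_factor xs = enc_list enc_factor ys \<longleftrightarrow> xs = ys"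
  by (rule enc_list_inject_iff) simp

lemma enc_cl_inject [simp]: "enc_cl t = enc_cl u \<longleftrightarrow> t = u"
proof (induction t arbitrary: u)
qed (case_tac u; auto simp: numeral_eq_Suc)+

lemma enc_bc_inject [simp]: "enc_bc \<Phi> = enc_bc \<Psi> \<longleftrightarrow> \<Phi> = \<Psi>"
proof (induction \<Phi> arbitrary: \<Psi>)
qed (case_tac \<Psi>; auto simp: numeral_eq_Suc)+

lemma enc_output_inject: "enc_output \<Phi> rs r = enc_output \<Psi> rs' r' \<longleftrightarrow> \<Phi> = \<Psi> \<and> rs = rs' \<and> r = r'"
  by (auto simp: enc_output_def)

end

theory Submission
  imports Defs
begin

text \<open>
  Every formula is rewritten, by recursion, into a Boolean combination of sentences and of local formulas
  that are \<^emph>\<open>connected\<close>: they are false unless their free variables have bounded distance from each other.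
  Atoms are connected, since relation tuples and supports of weights are cliques of the Gaifman graph.
  To eliminate a quantifier over \<open>ys\<close>, split according to whether \<open>ys\<close> is near some free variable \<open>x\<close> or
  far from all of them.  In the near case, a case distinction over the leaves without \<open>ys\<close> and over the
  distances of the other variables to \<open>x\<close> leaves a formula that is connected and local around \<open>x\<close> and the
  variables near \<open>x\<close>.  In the far case, every leaf relating \<open>ys\<close> to another variable is false, so only a local formula
  \<open>\<theta>(ys)\<close> remains; no Feferman-Vaught decomposition is needed.

  For a sum in a finite group, the far part is the aggregate over \<open>\<theta>\<close> minus its near part.  For \<open>\<exists>y\<close>, as in
  Gaifman's theorem, an element satisfying \<open>\<theta>\<close> far from the \<open>n\<close> free variables exists iff one exists at medium
  distance or, for some \<open>e \<le> n + 1\<close>, there are \<open>e\<close> scattered elements satisfying \<open>\<theta>\<close>, but not \<open>e\<close> such elements near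
  the free variables.  The number of scattered tuples is a polynomial in basic cl-terms.

  Radii are computed along with the formulas.  The recursion consists of list and tree operations, for
  which closure properties of the recursive functions on encodings suffice.
\<close>

text \<open>Connected leaves are worthwhile because they survive Boolean combinations. The truth
  value of a leaf that mixes a far tuple with other variables is known in advance, so a combination
  can be simplified leaf by leaf, under negations too; for arbitrary local leaves one would have to
  decompose formulas over disjoint parts of a structure.

  The two quantifiers are completed in different ways. Integers are ordered, so the existence of
  scattered elements can be read off from the sign of a count. In a finite group nothing can be
  compared, but the unknown parts of a sum range over finitely many values: they are guessed by a
  disjunction, the guesses are checked by local formulas, and the far part is found by cancellation.

  Local leaves must have a free variable, so truth constants and closed atoms are represented by
  ground cl-terms. For the algorithm group elements are opaque atoms, so addition in the finite
  groups has to be supplied as tables.\<close>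

lemma upd_notin: "x \<notin> set ys \<Longrightarrow> upd \<beta> ys as x = \<beta> x"
  by (auto simp: upd_def split: option.split dest!: map_of_SomeD dest: set_zip_leftD)

lemma upd_Nil [simp]: "upd \<beta> [] as = \<beta>"
  by (rule ext) (simp add: upd_def)

lemma upd_Cons: "upd \<beta> (y # ys) (a # as) = (upd \<beta> ys as)(y := a)"
  by (rule ext) (simp add: upd_def)

text \<open>With \<open>y\<close> not among \<open>ys\<close> the order of the updates is
  immaterial. This form lets an induction over bound variables change the assignment from the
  outside in.\<close>

lemma upd_Cons': "y \<notin> set ys \<Longrightarrow> upd \<beta> (y # ys) (a # as) = upd (\<beta>(y := a)) ys as"
  by (rule ext) (auto simp: upd_def split: option.split dest!: map_of_SomeD dest: set_zip_leftD)

lemma upd_in: "length as = length ys \<Longrightarrow> x \<in> set ys \<Longrightarrow> upd \<beta> ys as x \<in> set as"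
  by (induction as ys rule: list_induct2) (auto simp: upd_Cons)

lemma map_upd: "length as = length ys \<Longrightarrow> distinct ys \<Longrightarrow> map (upd \<beta> ys as) ys = as"
proof (induction as ys rule: list_induct2)
  case (Cons a as y ys)
  have "map (upd \<beta> (y # ys) (a # as)) ys = map (upd \<beta> ys as) ys"
    using Cons by (auto simp: upd_Cons)
  then show ?case using Cons by (simp only: upd_Cons list.map fun_upd_same distinct.simps)
qed simp

lemma upd_hd: "length as = length ys \<Longrightarrow> ys \<noteq> [] \<Longrightarrow> upd \<beta> ys as (hd ys) = hd as"
  by (cases ys; cases as) (auto simp: upd_Cons)

lemma upd_image: "length as = length ys \<Longrightarrow> distinct ys \<Longrightarrow> upd \<beta> ys as ` set ys = set as"
  by (metis list.set_map map_upd)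

section \<open>Dependence of values on free variables\<close>

lemma trm_val_cong:
  "(\<And>x. x \<in> trm_vars t \<Longrightarrow> \<beta> x = \<beta>' x) \<Longrightarrow> trm_val V A \<beta> S t = trm_val V A \<beta>' S t"
proof (induction t)
  case (TWt w xs)
  then have "map \<beta> xs = map \<beta>' xs" by simp
  then show ?case by (simp only: trm_val.simps)
qed auto

lemma upd_cong: "length as = length ys \<Longrightarrow> (x \<notin> set ys \<Longrightarrow> \<beta> x = \<beta>' x) \<Longrightarrow> upd \<beta> ys as x = upd \<beta>' ys as x"
  by (induction as ys rule: list_induct2) (auto simp: upd_Cons)

lemma sat_cong:
  "(\<And>x. x \<in> free \<phi> \<Longrightarrow> \<beta> x = \<beta>' x) \<Longrightarrow> sat V A \<beta> \<phi> \<longleftrightarrow> sat V A \<beta>' \<phi>"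
proof (induction \<phi> arbitrary: \<beta> \<beta>')
  case (Eq x y)
  then show ?case by auto
next
  case (Rel R xs)
  then have "map \<beta> xs = map \<beta>' xs" by simp
  then show ?case by (simp only: sat.simps)
next
  case (WEq s w xs)
  then have "map \<beta> xs = map \<beta>' xs" by simp
  then show ?case by (simp only: sat.simps)
next
  case (Neg \<phi>)
  then show ?case by (metis free.simps(4) sat.simps(4))
next
  case (Or \<phi> \<psi>)
  then show ?case by (metis UnCI free.simps(5) sat.simps(5))
next
  case (Ex y \<phi>)
  have "sat V A (\<beta>(y := a)) \<phi> = sat V A (\<beta>'(y := a)) \<phi>" for a
    by (rule Ex.IH) (use Ex.prems in auto)
  then show ?case by simp
next
  case (WSum s w ys \<phi>)
  have "sat V A (upd \<beta> ys as) \<phi> = sat V A (upd \<beta>' ys as) \<phi>" if "length as = length ys" for as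
    by (rule WSum.IH, rule upd_cong) (use WSum.prems that in auto)
  then have "{as \<in> tuples (length ys) (univ A). sat V A (upd \<beta> ys as) \<phi>}
      = {as \<in> tuples (length ys) (univ A). sat V A (upd \<beta>' ys as) \<phi>}"
    by (auto simp: tuples_def)
  then show ?case by simp
next
  case (Pred P ts)
  have "map2 (trm_val V A \<beta>) (pred_type V P) ts = map2 (trm_val V A \<beta>') (pred_type V P) ts"
  proof (rule map_cong[OF refl])
    fix p assume "p \<in> set (zip (pred_type V P) ts)"
    then have "snd p \<in> set ts" by (metis prod.collapse set_zip_rightD)
    then have "trm_val V A \<beta> (fst p) (snd p) = trm_val V A \<beta>' (fst p) (snd p)"
      using Pred.prems by (intro trm_val_cong) auto
    then show "(case p of (S, t) \<Rightarrow> trm_val V A \<beta> S t) = (case p of (S, t) \<Rightarrow> trm_val V A \<beta>' S t)"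
      by (simp add: case_prod_beta)
  qed
  then show ?case by (simp only: sat.simps)
qed

lemma finite_trm_vars [simp]: "finite (trm_vars t)"
  by (induction t) auto

section \<open>Derived connectives\<close>

lemma sat_And [simp]: "sat V A \<beta> (And \<phi> \<psi>) \<longleftrightarrow> sat V A \<beta> \<phi> \<and> sat V A \<beta> \<psi>"
  by (simp add: And_def)

lemma free_And [simp]: "free (And \<phi> \<psi>) = free \<phi> \<union> free \<psi>"
  by (simp add: And_def)

lemma fow1_And [simp]: "fow1 V (And \<phi> \<psi>) \<longleftrightarrow> fow1 V \<phi> \<and> fow1 V \<psi>"
  by (simp add: And_def)

lemma sat_Top [simp]: "sat V A \<beta> Top \<longleftrightarrow> univ A \<noteq> {}"
  by (auto simp: Top_def)

lemma free_Top [simp]: "free Top = {}"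
  by (simp add: Top_def)

lemma fow1_Top [simp]: "fow1 V Top"
  by (simp add: Top_def)

text \<open>The empty conjunction is \<open>Top\<close>, an existential statement, hence the
  assumption on the universe. For the same reason induced substructures are kept nonempty later
  on.\<close>

lemma sat_Conj [simp]: "univ A \<noteq> {} \<Longrightarrow> sat V A \<beta> (Conj \<phi>s) \<longleftrightarrow> (\<forall>\<phi>\<in>set \<phi>s. sat V A \<beta> \<phi>)"
  by (induction \<phi>s) (auto simp: Conj_def)

lemma free_Conj [simp]: "free (Conj \<phi>s) = (\<Union>\<phi>\<in>set \<phi>s. free \<phi>)"
  by (induction \<phi>s) (auto simp: Conj_def)

lemma fow1_Conj [simp]: "fow1 V (Conj \<phi>s) \<longleftrightarrow> (\<forall>\<phi>\<in>set \<phi>s. fow1 V \<phi>)"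
  by (induction \<phi>s) (auto simp: Conj_def)

lemma sat_Disj [simp]: "univ A \<noteq> {} \<Longrightarrow> sat V A \<beta> (Disj \<phi>s) \<longleftrightarrow> (\<exists>\<phi>\<in>set \<phi>s. sat V A \<beta> \<phi>)"
  by (induction \<phi>s) (auto simp: Disj_def)

lemma free_Disj [simp]: "free (Disj \<phi>s) = (\<Union>\<phi>\<in>set \<phi>s. free \<phi>)"
  by (induction \<phi>s) (auto simp: Disj_def)

lemma fow1_Disj [simp]: "fow1 V (Disj \<phi>s) \<longleftrightarrow> (\<forall>\<phi>\<in>set \<phi>s. fow1 V \<phi>)"
  by (induction \<phi>s) (auto simp: Disj_def)

lemma sat_foldr_Ex:
  "distinct zs \<Longrightarrow> sat V A \<beta> (foldr Ex zs \<phi>) \<longleftrightarrow>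
     (\<exists>as\<in>tuples (length zs) (univ A). sat V A (upd \<beta> zs as) \<phi>)"
proof (induction zs arbitrary: \<beta>)
  case (Cons z zs)
  have "tuples (length (z # zs)) (univ A) = (\<lambda>(a, as). a # as) ` (univ A \<times> tuples (length zs) (univ A))"
    by (auto simp: tuples_def length_Suc_conv image_iff)
  then have "(\<exists>as\<in>tuples (length (z # zs)) (univ A). sat V A (upd \<beta> (z # zs) as) \<phi>) \<longleftrightarrow>
      (\<exists>a\<in>univ A. \<exists>as\<in>tuples (length zs) (univ A). sat V A (upd \<beta> (z # zs) (a # as)) \<phi>)"
    by auto
  then show ?case using Cons by (simp add: upd_Cons')
qed (auto simp: tuples_def)

lemma free_foldr_Ex [simp]: "free (foldr Ex zs \<phi>) = free \<phi> - set zs"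
  by (induction zs) auto

lemma fow1_foldr_Ex [simp]: "fow1 V (foldr Ex zs \<phi>) \<longleftrightarrow> fow1 V \<phi>"
  by (induction zs) auto

section \<open>Distances\<close>

text \<open>An infimum lies strictly below a bound iff some member does; passing to
  \<open>Suc n\<close> makes the bound strict.\<close>

lemma gdist_le_iff: "gdist V A a b \<le> enat n \<longleftrightarrow> (\<exists>m\<le>n. (a, b) \<in> gaifman V A ^^ m)"
proof -
  have "x \<le> enat n \<longleftrightarrow> x < enat (Suc n)" for x
    by (cases x) auto
  then have "gdist V A a b \<le> enat n \<longleftrightarrow> (\<exists>m\<in>{m. (a, b) \<in> gaifman V A ^^ m}. enat m < enat (Suc n))"
    unfolding gdist_def INF_less_iff[symmetric] .
  then show ?thesis by (simp add: less_Suc_eq_le conj_commute)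
qed

lemma gaifman_sym: "(a, b) \<in> gaifman V A \<Longrightarrow> (b, a) \<in> gaifman V A"
  by (auto simp: gaifman_def)

lemma gaifman_relpow_sym: "(a, b) \<in> gaifman V A ^^ n \<Longrightarrow> (b, a) \<in> gaifman V A ^^ n"
proof (induction n arbitrary: b)
  case (Suc n)
  then obtain c where "(a, c) \<in> gaifman V A ^^ n" "(c, b) \<in> gaifman V A" by auto
  then show ?case using Suc.IH gaifman_sym by (metis relpow_Suc_I2)
qed auto

text \<open>Distances enter the proof only through upper bounds, so arithmetic with infinite
  distances never occurs.\<close>

definition near :: "('s, 'v) vocab \<Rightarrow> ('a, 'v) wstruct \<Rightarrow> nat \<Rightarrow> 'a \<Rightarrow> 'a \<Rightarrow> bool" where
  "near V A r a b \<longleftrightarrow> gdist V A a b \<le> enat r"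

lemma near_0 [simp]: "near V A 0 a b \<longleftrightarrow> a = b"
  by (auto simp: near_def gdist_le_iff)

lemma near_refl [simp]: "near V A r a a"
  unfolding near_def gdist_le_iff by (rule exI[of _ 0]) simp

lemma near_sym: "near V A r a b \<Longrightarrow> near V A r b a"
  by (auto simp: near_def gdist_le_iff dest: gaifman_relpow_sym)

lemma near_mono: "near V A r a b \<Longrightarrow> r \<le> r' \<Longrightarrow> near V A r' a b"
  unfolding near_def gdist_le_iff using le_trans by blast

lemma near_trans: "near V A r a b \<Longrightarrow> near V A r' b c \<Longrightarrow> near V A (r + r') a c"
  unfolding near_def gdist_le_iff
proof (elim exE conjE)
  fix m m' assume *: "m \<le> r" "(a, b) \<in> gaifman V A ^^ m" "m' \<le> r'" "(b, c) \<in> gaifman V A ^^ m'"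
  then have "(a, c) \<in> gaifman V A ^^ (m + m')" by (auto simp: relpow_add)
  then show "\<exists>m\<le>r + r'. (a, c) \<in> gaifman V A ^^ m" using * by (metis add_mono)
qed

lemma near_trans_le: "near V A r a b \<Longrightarrow> near V A r' b c \<Longrightarrow> r + r' \<le> r'' \<Longrightarrow> near V A r'' a c"
  using near_mono near_trans by metis

text \<open>Follows the recursion of \<open>dist_le_fm\<close>: a shorter path and then one edge or
  no step at all.\<close>

lemma near_Suc:
  "near V A (Suc r) a b \<longleftrightarrow> (\<exists>c. near V A r a c \<and> (c = b \<or> (c, b) \<in> gaifman V A))"
proof
  assume "near V A (Suc r) a b"
  then obtain m where m: "m \<le> Suc r" "(a, b) \<in> gaifman V A ^^ m" by (auto simp: near_def gdist_le_iff)
  show "\<exists>c. near V A r a c \<and> (c = b \<or> (c, b) \<in> gaifman V A)"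
  proof (cases "m \<le> r")
    case True
    then show ?thesis using m by (auto simp: near_def gdist_le_iff)
  next
    case False
    then have "m = Suc r" using m by simp
    then show ?thesis using m by (auto simp: near_def gdist_le_iff)
  qed
next
  assume "\<exists>c. near V A r a c \<and> (c = b \<or> (c, b) \<in> gaifman V A)"
  then obtain c where c: "near V A r a c" "c = b \<or> (c, b) \<in> gaifman V A" by blast
  have "near V A 1 c b" using c(2)
    unfolding near_def gdist_le_iff by (metis One_nat_def le_numeral_extra(4) near_def near_refl gdist_le_iff relpow_1)
  then show "near V A (Suc r) a b" using near_trans[OF c(1)] by fastforce
qed

lemma near_univ: "near V A r a b \<Longrightarrow> a \<in> univ A \<Longrightarrow> b \<in> univ A"
proof (induction r arbitrary: b)
  case (Suc r)
  then show ?case unfolding near_Suc gaifman_def by blast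
qed simp

definition ball :: "('s, 'v) vocab \<Rightarrow> ('a, 'v) wstruct \<Rightarrow> nat \<Rightarrow> 'a set \<Rightarrow> 'a set" where
  "ball V A r X = {b \<in> univ A. \<exists>a\<in>X. near V A r a b}"

lemma nbh_eq_induced: "nbh V r A X = induced A (ball V A r X)"
  by (simp add: nbh_def ball_def near_def)

lemma ball_mono: "X \<subseteq> Y \<Longrightarrow> r \<le> r' \<Longrightarrow> ball V A r X \<subseteq> ball V A r' Y"
  using near_mono[of V A r _ _ r'] by (fastforce simp: ball_def)

lemma subset_ball: "X \<subseteq> univ A \<Longrightarrow> X \<subseteq> ball V A r X"
proof
  fix x assume "X \<subseteq> univ A" "x \<in> X"
  then show "x \<in> ball V A r X" unfolding ball_def using near_refl[of V A r x] by blast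
qed

lemma induced_simps [simp]:
  "univ (induced A X) = X" "rel (induced A X) R = {t \<in> rel A R. set t \<subseteq> X}" "wt (induced A X) = wt A"
  by (simp_all add: induced_def)

text \<open>An induced substructure has fewer edges, so distances can only grow.\<close>

lemma near_inducedD: "near V (induced A X) r a b \<Longrightarrow> X \<subseteq> univ A \<Longrightarrow> near V A r a b"
proof (induction r arbitrary: b)
  case (Suc r)
  have "gaifman V (induced A X) \<subseteq> gaifman V A" using Suc.prems(2) by (auto simp: gaifman_def)
  then show ?case using Suc unfolding near_Suc by blast
qed simp

text \<open>An edge survives only if a whole relation tuple does, so it is not enough that the path
  stays in \<open>X\<close>. All entries of the tuple behind the last edge are equal or adjacent to
  its inner end \<open>c\<close>, hence at distance at most \<open>Suc r\<close> from
  \<open>a\<close> and therefore in \<open>X\<close>.\<close>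

lemma near_inducedI:
  assumes wf: "\<forall>R\<in>rel_syms V. rel A R \<subseteq> tuples (rel_ar V R) (univ A)"
  shows "near V A r a b \<Longrightarrow> a \<in> univ A \<Longrightarrow> ball V A r {a} \<subseteq> X \<Longrightarrow> near V (induced A X) r a b"
proof (induction r arbitrary: b)
  case (Suc r)
  then obtain c where c: "near V A r a c" "c = b \<or> (c, b) \<in> gaifman V A" by (auto simp: near_Suc)
  have "ball V A r {a} \<subseteq> X"
    using Suc.prems(3) ball_mono[of "{a}" "{a}" r "Suc r" V A] by auto
  then have near: "near V (induced A X) r a c" using Suc c by auto
  have "(c, b) \<in> gaifman V (induced A X)" if cb: "c \<noteq> b"
  proof -
    obtain R t where R: "R \<in> rel_syms V" "t \<in> rel A R" "c \<in> set t" "b \<in> set t"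
      using c cb by (auto simp: gaifman_def)
    have t: "set t \<subseteq> univ A" using R wf by (auto simp: tuples_def)
    have "d \<in> ball V A (Suc r) {a}" if "d \<in> set t" for d
    proof -
      have "c = d \<or> (c, d) \<in> gaifman V A" using R t that by (auto simp: gaifman_def)
      then show ?thesis using c t that by (auto simp: ball_def near_Suc)
    qed
    then have "set t \<subseteq> X" using Suc.prems by auto
    then show ?thesis using R cb by (auto simp: gaifman_def)
  qed
  then show ?case using near by (auto simp: near_Suc)
qed simp

text \<open>Isolates the disjunct for one relation with an arbitrary list of bound variables, so
  that only their freshness matters and not how they are computed.\<close>

definition cooccur_in :: "('s, 'v) vocab \<Rightarrow> nat \<Rightarrow> nat \<Rightarrow> nat \<Rightarrow> nat list \<Rightarrow> ('s, 'v) fm" where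
  "cooccur_in V x y R zs = foldr Ex zs (And (Rel R zs) (And (Disj (map (Eq x) zs)) (Disj (map (Eq y) zs))))"

lemma cooccur_fm_eq:
  "cooccur_fm V x y = Disj (map (\<lambda>R. cooccur_in V x y R [Suc (x + y) ..< Suc (x + y) + rel_ar V R])
     (sorted_list_of_set (rel_syms V)))"
  by (simp only: cooccur_fm_def cooccur_in_def Let_def)

lemma sat_cooccur_in:
  assumes "rel A R \<subseteq> tuples (length zs) (univ A)" "univ A \<noteq> {}" "distinct zs" "x \<notin> set zs" "y \<notin> set zs"
  shows "sat V A \<beta> (cooccur_in V x y R zs) \<longleftrightarrow> (\<exists>t\<in>rel A R. \<beta> x \<in> set t \<and> \<beta> y \<in> set t)"
proof -
  have "sat V A (upd \<beta> zs as) (And (Rel R zs) (And (Disj (map (Eq x) zs)) (Disj (map (Eq y) zs))))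
      \<longleftrightarrow> as \<in> rel A R \<and> \<beta> x \<in> set as \<and> \<beta> y \<in> set as" if "as \<in> tuples (length zs) (univ A)" for as
  proof -
    have "length as = length zs" using that by (simp add: tuples_def)
    then have "map (upd \<beta> zs as) zs = as" "upd \<beta> zs as ` set zs = set as"
      using map_upd upd_image assms(3) by blast+
    then show ?thesis using assms(2,4,5) by (auto simp: upd_notin)
  qed
  then show ?thesis using assms(1,3)
    unfolding cooccur_in_def by (subst sat_foldr_Ex) blast+
qed

lemma sat_cooccur_fm:
  assumes "finite (rel_syms V)" "\<forall>R\<in>rel_syms V. rel A R \<subseteq> tuples (rel_ar V R) (univ A)" "univ A \<noteq> {}"
  shows "sat V A \<beta> (cooccur_fm V x y) \<longleftrightarrow>
    (\<exists>R\<in>rel_syms V. \<exists>t\<in>rel A R. \<beta> x \<in> set t \<and> \<beta> y \<in> set t)"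
proof -
  \<comment> \<open>Every bound variable is at least \<open>Suc (x + y)\<close>, hence different
    from \<open>x\<close> and \<open>y\<close>.\<close>
  have "sat V A \<beta> (cooccur_in V x y R [Suc (x + y) ..< Suc (x + y) + rel_ar V R]) \<longleftrightarrow>
     (\<exists>t\<in>rel A R. \<beta> x \<in> set t \<and> \<beta> y \<in> set t)" if R: "R \<in> rel_syms V" for R
    by (rule sat_cooccur_in) (use R assms in \<open>auto simp del: upt_Suc\<close>)
  then show ?thesis using assms(1,3) unfolding cooccur_fm_eq by (simp del: upt_Suc)
qed

lemma free_cooccur_in: "free (cooccur_in V x y R zs) \<subseteq> {x, y}"
  by (auto simp: cooccur_in_def)

lemma free_cooccur_fm: "free (cooccur_fm V x y) \<subseteq> {x, y}"
  unfolding cooccur_fm_eq free_Disj using free_cooccur_in by fastforce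

lemma fow1_cooccur_fm [simp]: "finite (rel_syms V) \<Longrightarrow> fow1 V (cooccur_fm V x y)"
  unfolding cooccur_fm_eq fow1_Disj by (auto simp: cooccur_in_def simp del: upt_Suc)

lemma free_dist_le_fm [simp]: "free (dist_le_fm V r x y) = {x, y}"
proof (induction r arbitrary: y)
  case (Suc r)
  show ?case using free_cooccur_fm[of V "Suc (x + y)" y] by (auto simp: Let_def Suc)
qed simp

lemma fow1_dist_le_fm [simp]: "finite (rel_syms V) \<Longrightarrow> fow1 V (dist_le_fm V r x y)"
  by (induction r arbitrary: y) (auto simp: Let_def)

text \<open>Only well-formed relations are assumed, because the formula is also evaluated in
  neighbourhoods, which may violate the support condition on weights.\<close>

lemma sat_dist_le_fm:
  assumes "finite (rel_syms V)" "\<forall>R\<in>rel_syms V. rel A R \<subseteq> tuples (rel_ar V R) (univ A)"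
  shows "\<beta> x \<in> univ A \<Longrightarrow> \<beta> y \<in> univ A \<Longrightarrow> sat V A \<beta> (dist_le_fm V r x y) \<longleftrightarrow> near V A r (\<beta> x) (\<beta> y)"
proof (induction r arbitrary: \<beta> y)
  case (Suc r)
  have ne: "univ A \<noteq> {}" using Suc.prems by auto
  let ?z = "Suc (x + y)"
  have "sat V A \<beta> (dist_le_fm V (Suc r) x y) \<longleftrightarrow> (\<exists>c\<in>univ A. near V A r (\<beta> x) c \<and>
     (c = \<beta> y \<or> (\<exists>R\<in>rel_syms V. \<exists>t\<in>rel A R. c \<in> set t \<and> \<beta> y \<in> set t)))"
    using Suc by (simp add: Let_def sat_cooccur_fm[OF assms ne])
  also have "\<dots> \<longleftrightarrow> (\<exists>c\<in>univ A. near V A r (\<beta> x) c \<and> (c = \<beta> y \<or> (c, \<beta> y) \<in> gaifman V A))"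
    using Suc.prems by (auto simp: gaifman_def)
  also have "\<dots> \<longleftrightarrow> near V A (Suc r) (\<beta> x) (\<beta> y)"
    unfolding near_Suc using near_univ[of V A r "\<beta> x"] Suc.prems(1) by blast
  finally show ?case .
qed simp

declare dist_le_fm.simps [simp del]

section \<open>Free variables as lists\<close>

primrec tvl :: "('s, 'v) trm \<Rightarrow> nat list" where
  "tvl (TElem S s) = []"
| "tvl (TWt w xs) = xs"
| "tvl (TAdd t u) = tvl t @ tvl u"
| "tvl (TSub t u) = tvl t @ tvl u"
| "tvl (TMul t u) = tvl t @ tvl u"

text \<open>The free variables are data for the transformation: a list can be encoded and folded
  over, a set cannot.\<close>

primrec fvl :: "('s, 'v) fm \<Rightarrow> nat list" where
  "fvl (Eq x y) = [x, y]"
| "fvl (Rel R xs) = xs"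
| "fvl (WEq s w xs) = xs"
| "fvl (Neg \<phi>) = fvl \<phi>"
| "fvl (Or \<phi> \<psi>) = fvl \<phi> @ fvl \<psi>"
| "fvl (Ex y \<phi>) = filter (\<lambda>z. z \<noteq> y) (fvl \<phi>)"
| "fvl (WSum s w ys \<phi>) = filter (\<lambda>z. z \<notin> set ys) (fvl \<phi>)"
| "fvl (Pred P ts) = concat (map tvl ts)"

lemma set_tvl [simp]: "set (tvl t) = trm_vars t"
  by (induction t) auto

lemma set_fvl [simp]: "set (fvl \<phi>) = free \<phi>"
  by (induction \<phi>) auto

definition BAnd :: "('s, 'v) bc \<Rightarrow> ('s, 'v) bc \<Rightarrow> ('s, 'v) bc" where
  "BAnd \<Phi> \<Psi> = BNeg (BOr (BNeg \<Phi>) (BNeg \<Psi>))"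

text \<open>
  The result lists pairs of a guard and a formula: at least one guard holds, and the combination is
  equivalent to the formula of every guard that holds.  Sentences move into the guards, and \<open>f\<close> decides
  what happens to the local leaves.
\<close>

primrec cases_bc :: "(('s, 'v) fm \<Rightarrow> (('s, 'v) bc \<times> ('s, 'v) fm) list) \<Rightarrow> ('s, 'v) bc \<Rightarrow>
    (('s, 'v) bc \<times> ('s, 'v) fm) list" where
  "cases_bc f (Local \<psi>) = f \<psi>"
| "cases_bc f (Agg \<chi>) = [(Agg \<chi>, Top), (BNeg (Agg \<chi>), Neg Top)]"
| "cases_bc f (Ge1 g) = [(Ge1 g, Top), (BNeg (Ge1 g), Neg Top)]"
| "cases_bc f (BNeg \<Phi>) = map (\<lambda>p. (fst p, Neg (snd p))) (cases_bc f \<Phi>)"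
| "cases_bc f (BOr \<Phi> \<Psi>) = concat (map (\<lambda>p. map (\<lambda>q. (BAnd (fst p) (fst q), Or (snd p) (snd q)))
     (cases_bc f \<Psi>)) (cases_bc f \<Phi>))"

lemma cases_bc_BNegE:
  assumes "p \<in> set (cases_bc f (BNeg \<Phi>))"
  obtains q where "q \<in> set (cases_bc f \<Phi>)" "p = (fst q, Neg (snd q))"
  using assms unfolding cases_bc.simps set_map by (elim imageE) blast

lemma cases_bc_BOrE:
  assumes "p \<in> set (cases_bc f (BOr \<Phi> \<Psi>))"
  obtains q r where "q \<in> set (cases_bc f \<Phi>)" "r \<in> set (cases_bc f \<Psi>)"
    "p = (BAnd (fst q) (fst r), Or (snd q) (snd r))"
  using assms unfolding cases_bc.simps set_map set_concat by (elim UN_E imageE) (auto elim!: imageE)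

lemma bc_sat_BAnd [simp]: "bc_sat V Z \<iota> A \<beta> (BAnd \<Phi> \<Psi>) \<longleftrightarrow> bc_sat V Z \<iota> A \<beta> \<Phi> \<and> bc_sat V Z \<iota> A \<beta> \<Psi>"
  by (simp add: BAnd_def)

lemma product_val_cong:
  "(\<And>x. x \<in> product_vars p \<Longrightarrow> \<beta> x = \<beta>' x) \<Longrightarrow> product_val V A \<beta> S p = product_val V A \<beta>' S p"
proof (induction V A \<beta> S p rule: product_val.induct)
  case (2 V A \<beta> S f)
  then show ?case by (cases f) (auto simp: product_vars_def intro!: arg_cong[of _ _ "wt A _"])
next
  case (3 V A \<beta> S f g fs)
  have "factor_val A \<beta> f = factor_val A \<beta>' f"
    using 3(2) by (cases f) (auto simp: product_vars_def intro!: arg_cong[of _ _ "wt A _"])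
  moreover have "product_val V A \<beta> S (g # fs) = product_val V A \<beta>' S (g # fs)"
    by (rule 3(1)) (use 3(2) in \<open>auto simp: product_vars_def\<close>)
  ultimately show ?case by simp
qed simp

lemma cl_val_cong:
  "(\<And>x. x \<in> cl_free g \<Longrightarrow> \<beta> x = \<beta>' x) \<Longrightarrow> cl_val V A \<beta> S g = cl_val V A \<beta>' S g"
proof (induction g)
  case (CWt w xs)
  then have "map \<beta> xs = map \<beta>' xs" by simp
  then show ?case by (simp only: cl_val.simps)
next
  case (CSum S' p \<chi>)
  have 1: "product_val V A (override_on \<beta> f (product_vars p)) S p
      = product_val V A (override_on \<beta>' f (product_vars p)) S p" for f
    by (rule product_val_cong) simp
  have 2: "sat V A (override_on \<beta> f (product_vars p)) \<chi> = sat V A (override_on \<beta>' f (product_vars p)) \<chi>" for f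
    by (rule sat_cong) (use CSum in \<open>auto simp: override_on_def\<close>)
  show ?case by (simp add: 1 2)
qed auto

section \<open>Strong locality and connectedness\<close>

locale weighted =
  fixes V :: "('s, 'v) vocab" and Z :: 's and \<iota> :: "int \<Rightarrow> 'v" and w1 :: nat
    and K :: "('a, 'v) wstruct set"
  assumes voc: "vocabulary V"
    and ring_Z: "is_ring V Z" and iso: "\<iota> \<in> ring_iso \<Z> (alg V Z)"
    and w1: "w1 \<in> wt_syms V" "wt_ar V w1 = 1" "wt_type V w1 = Z"
    and K: "K = structures_with_one V \<iota> w1"
begin

abbreviation dl :: "nat \<Rightarrow> nat \<Rightarrow> nat \<Rightarrow> ('s, 'v) fm" where
  "dl \<equiv> dist_le_fm V"

lemma finite_rel_syms [simp]: "finite (rel_syms V)"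
  using voc by (simp add: vocabulary_def)

lemma K_structure: "A \<in> K \<Longrightarrow> is_structure V A"
  by (simp add: K structures_with_one_def)

lemma univ_nonempty: "A \<in> K \<Longrightarrow> univ A \<noteq> {}"
  using K_structure by (auto simp: is_structure_def)

lemma finite_univ: "A \<in> K \<Longrightarrow> finite (univ A)"
  using K_structure by (auto simp: is_structure_def)

lemma rel_tuples: "A \<in> K \<Longrightarrow> \<forall>R\<in>rel_syms V. rel A R \<subseteq> tuples (rel_ar V R) (univ A)"
  using K_structure by (auto simp: is_structure_def)

lemma rel_tuples_induced: "A \<in> K \<Longrightarrow>
    \<forall>R\<in>rel_syms V. rel (induced A X) R \<subseteq> tuples (rel_ar V R) (univ (induced A X))"
  using rel_tuples[of A] by (auto simp: tuples_def)

lemma sat_dl: "A \<in> K \<Longrightarrow> \<beta> x \<in> univ A \<Longrightarrow> \<beta> y \<in> univ A \<Longrightarrow> sat V A \<beta> (dl r x y) \<longleftrightarrow> near V A r (\<beta> x) (\<beta> y)"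
  by (simp add: sat_dist_le_fm rel_tuples)

text \<open>
  Stronger than \<^const>\<open>local_around\<close>, which need not be monotone in the radius or in the set of variables:
  neighbourhoods of structures in \<open>K\<close> need not belong to \<open>K\<close>.
\<close>

definition slocal :: "nat \<Rightarrow> ('s, 'v) fm \<Rightarrow> bool" where
  "slocal r \<psi> \<longleftrightarrow> (\<forall>A\<in>K. \<forall>\<beta> X. \<beta> ` free \<psi> \<subseteq> univ A \<longrightarrow> X \<subseteq> univ A \<longrightarrow> X \<noteq> {} \<longrightarrow>
     ball V A r (\<beta> ` free \<psi>) \<subseteq> X \<longrightarrow> sat V (induced A X) \<beta> \<psi> = sat V A \<beta> \<psi>)"

definition conn :: "nat \<Rightarrow> ('s, 'v) fm \<Rightarrow> bool" where
  "conn r \<psi> \<longleftrightarrow> (\<forall>A\<in>K. \<forall>\<beta>. \<beta> ` free \<psi> \<subseteq> univ A \<longrightarrow> sat V A \<beta> \<psi> \<longrightarrow>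
     (\<forall>x\<in>free \<psi>. \<forall>y\<in>free \<psi>. near V A r (\<beta> x) (\<beta> y)))"

lemma slocalD:
  assumes "slocal r \<psi>" "A \<in> K" "\<beta> ` free \<psi> \<subseteq> univ A" "X \<subseteq> univ A" "X \<noteq> {}" "ball V A r (\<beta> ` free \<psi>) \<subseteq> X"
  shows "sat V (induced A X) \<beta> \<psi> = sat V A \<beta> \<psi>"
  using assms unfolding slocal_def by blast

lemma slocal_sub:
  assumes "slocal r \<psi>" "A \<in> K" "free \<psi> \<subseteq> Y" "r \<le> r'" "\<beta> ` Y \<subseteq> univ A" "X \<subseteq> univ A" "X \<noteq> {}" "ball V A r' (\<beta> ` Y) \<subseteq> X"
  shows "sat V (induced A X) \<beta> \<psi> = sat V A \<beta> \<psi>"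
proof (rule slocalD[OF assms(1,2) _ assms(6,7)])
  have *: "\<beta> ` free \<psi> \<subseteq> \<beta> ` Y" using assms(3) by auto
  then show "\<beta> ` free \<psi> \<subseteq> univ A" using assms(5) by auto
  show "ball V A r (\<beta> ` free \<psi>) \<subseteq> X" using ball_mono[OF * assms(4)] assms(8) by blast
qed

lemma connD: "conn r \<psi> \<Longrightarrow> A \<in> K \<Longrightarrow> \<beta> ` free \<psi> \<subseteq> univ A \<Longrightarrow> sat V A \<beta> \<psi> \<Longrightarrow>
    x \<in> free \<psi> \<Longrightarrow> y \<in> free \<psi> \<Longrightarrow> near V A r (\<beta> x) (\<beta> y)"
  unfolding conn_def by blast

text \<open>A larger radius only leaves fewer sets \<open>X\<close> to be tested.\<close>

lemma slocal_mono: "slocal r \<psi> \<Longrightarrow> r \<le> r' \<Longrightarrow> slocal r' \<psi>"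
  unfolding slocal_def[of r'] using slocal_sub[of r \<psi> _ "free \<psi>" r'] by blast

lemma conn_mono: "conn r \<psi> \<Longrightarrow> r \<le> r' \<Longrightarrow> conn r' \<psi>"
  unfolding conn_def using near_mono by metis

text \<open>The ball of radius \<open>r'\<close> around \<open>Y\<close> is itself an admissible set
  \<open>X\<close>; it is nonempty because \<open>Y\<close> is.\<close>

lemma local_aroundI:
  assumes "slocal r \<psi>" "r \<le> r'" "free \<psi> \<subseteq> Y" "Y \<noteq> {}"
  shows "local_around V K r' \<psi> Y"
  unfolding local_around_def nbh_eq_induced
proof (intro conjI ballI allI impI)
  fix A \<beta> assume A: "A \<in> K" and \<beta>: "\<beta> ` Y \<subseteq> univ A"
  have "ball V A r' (\<beta> ` Y) \<noteq> {}" using subset_ball[OF \<beta>] assms(4) by blast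
  then show "sat V A \<beta> \<psi> = sat V (induced A (ball V A r' (\<beta> ` Y))) \<beta> \<psi>"
    using slocal_sub[OF assms(1) A assms(3,2) \<beta>] by (auto simp: ball_def)
qed (use assms in auto)

lemma slocal_Neg [simp]: "slocal r \<psi> \<Longrightarrow> slocal r (Neg \<psi>)"
  by (auto simp: slocal_def)

lemma slocal_Or [simp]:
  assumes "slocal r \<phi>" "slocal r \<psi>" shows "slocal r (Or \<phi> \<psi>)"
  unfolding slocal_def
proof (intro ballI allI impI)
  fix A \<beta> X
  assume A: "A \<in> K" "\<beta> ` free (Or \<phi> \<psi>) \<subseteq> univ A" "X \<subseteq> univ A" "X \<noteq> {}" "ball V A r (\<beta> ` free (Or \<phi> \<psi>)) \<subseteq> X"
  have "sat V (induced A X) \<beta> \<phi> = sat V A \<beta> \<phi>"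
    by (rule slocal_sub[OF assms(1) A(1) _ _ A(2-5)]) auto
  moreover have "sat V (induced A X) \<beta> \<psi> = sat V A \<beta> \<psi>"
    by (rule slocal_sub[OF assms(2) A(1) _ _ A(2-5)]) auto
  ultimately show "sat V (induced A X) \<beta> (Or \<phi> \<psi>) = sat V A \<beta> (Or \<phi> \<psi>)" by simp
qed

lemma slocal_And [simp]: "slocal r \<phi> \<Longrightarrow> slocal r \<psi> \<Longrightarrow> slocal r (And \<phi> \<psi>)"
  by (simp add: And_def)

lemma slocal_Top [simp]: "slocal r Top"
  by (auto simp: slocal_def)

lemma slocal_Conj: "(\<And>\<phi>. \<phi> \<in> set \<phi>s \<Longrightarrow> slocal r \<phi>) \<Longrightarrow> slocal r (Conj \<phi>s)"
  by (induction \<phi>s) (auto simp: Conj_def)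

lemma slocal_Disj: "(\<And>\<phi>. \<phi> \<in> set \<phi>s \<Longrightarrow> slocal r \<phi>) \<Longrightarrow> slocal r (Disj \<phi>s)"
  by (induction \<phi>s) (auto simp: Disj_def)

lemma slocal_Eq [simp]: "slocal r (Eq x y)"
  by (simp add: slocal_def)

lemma slocal_WEq [simp]: "slocal r (WEq s w xs)"
  by (simp add: slocal_def)

lemma slocal_Rel [simp]: "slocal r (Rel R xs)"
  unfolding slocal_def
proof (intro ballI allI impI)
  fix A \<beta> X
  assume A: "A \<in> K" "\<beta> ` free (Rel R xs) \<subseteq> univ A" "ball V A r (\<beta> ` free (Rel R xs)) \<subseteq> X"
  have "\<beta> ` set xs \<subseteq> X" using subset_ball[OF A(2), of V r] A(3) by simp
  then show "sat V (induced A X) \<beta> (Rel R xs) = sat V A \<beta> (Rel R xs)" by simp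
qed

text \<open>Inducing keeps the weight functions, so terms do not see the substructure, and
  predicates are local with every radius.\<close>

lemma trm_val_induced [simp]: "trm_val V (induced A X) \<beta> S t = trm_val V A \<beta> S t"
  by (induction t) auto

lemma slocal_Pred [simp]: "slocal r (Pred P ts)"
  by (simp add: slocal_def)

text \<open>A ball around one endpoint suffices, since a path of length at most \<open>r\<close>
  from it never leaves that ball.\<close>

lemma sat_dl_induced:
  assumes "A \<in> K" "X \<subseteq> univ A" "\<beta> x \<in> X" "\<beta> y \<in> X" "ball V A r {\<beta> x} \<subseteq> X"
  shows "sat V (induced A X) \<beta> (dl r x y) \<longleftrightarrow> near V A r (\<beta> x) (\<beta> y)"
proof -
  have "sat V (induced A X) \<beta> (dl r x y) \<longleftrightarrow> near V (induced A X) r (\<beta> x) (\<beta> y)"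
    by (rule sat_dist_le_fm[OF finite_rel_syms rel_tuples_induced[OF assms(1)]]) (use assms in auto)
  also have "\<dots> \<longleftrightarrow> near V A r (\<beta> x) (\<beta> y)"
    using near_inducedD[of V A X r] near_inducedI[OF rel_tuples[OF assms(1)], of r _ _ X] assms by blast
  finally show ?thesis .
qed

lemma slocal_dl: "r \<le> r' \<Longrightarrow> slocal r' (dl r x y)"
  unfolding slocal_def
proof (intro ballI allI impI)
  fix A \<beta> X
  assume A: "r \<le> r'" "A \<in> K" "\<beta> ` free (dl r x y) \<subseteq> univ A" "X \<subseteq> univ A" "ball V A r' (\<beta> ` free (dl r x y)) \<subseteq> X"
  have "\<beta> ` free (dl r x y) \<subseteq> X" using subset_ball[OF A(3)] A(5) by blast
  moreover have "ball V A r {\<beta> x} \<subseteq> X"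
    using ball_mono[of "{\<beta> x}" "\<beta> ` free (dl r x y)" r r' V A] A by auto
  ultimately show "sat V (induced A X) \<beta> (dl r x y) = sat V A \<beta> (dl r x y)"
    using A sat_dl_induced[of A X \<beta> x y r] sat_dl[of A \<beta> x y r] by auto
qed

lemma conn_dl: "r \<le> r' \<Longrightarrow> conn r' (dl r x y)"
  unfolding conn_def
proof (intro ballI allI impI)
  fix A \<beta> u v
  assume A: "r \<le> r'" "A \<in> K" "\<beta> ` free (dl r x y) \<subseteq> univ A" "sat V A \<beta> (dl r x y)" "u \<in> free (dl r x y)" "v \<in> free (dl r x y)"
  then have "near V A r' (\<beta> x) (\<beta> y)" using near_mono sat_dl[of A \<beta> x y r] by auto
  then show "near V A r' (\<beta> u) (\<beta> v)" using A near_sym by auto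
qed

section \<open>Boolean combinations of connected local formulas\<close>

text \<open>One number bounds both the locality radius and the diameter, which reduces the
  bookkeeping in the recursion to a single value. A free variable is demanded because locality
  around the empty set of variables is excluded.\<close>

definition lf :: "nat set \<Rightarrow> nat \<Rightarrow> ('s, 'v) fm \<Rightarrow> bool" where
  "lf X \<rho> \<psi> \<longleftrightarrow> fow1 V \<psi> \<and> free \<psi> \<noteq> {} \<and> free \<psi> \<subseteq> X \<and> slocal \<rho> \<psi> \<and> conn \<rho> \<psi>"

text \<open>Aggregation sentences have to be local for all radii from \<open>\<rho>\<close> on:
  radii grow during the recursion, and \<open>local_agg_sentence\<close> by itself gives no
  monotonicity.\<close>

definition ok :: "nat set \<Rightarrow> nat \<Rightarrow> ('s, 'v) bc \<Rightarrow> bool" where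
  "ok X \<rho> \<Phi> \<longleftrightarrow> (\<forall>\<psi>\<in>local_leaves \<Phi>. lf X \<rho> \<psi>) \<and>
     (\<forall>\<chi>\<in>agg_leaves \<Phi>. \<forall>r\<ge>\<rho>. local_agg_sentence V K r \<chi>) \<and>
     (\<forall>g\<in>set (cl_leaves \<Phi>). cl_free g = {} \<and> cl_term V K \<rho> g Z)"

lemma ok_simps [simp]:
  "ok X \<rho> (Local \<psi>) \<longleftrightarrow> lf X \<rho> \<psi>"
  "ok X \<rho> (Agg \<chi>) \<longleftrightarrow> (\<forall>r\<ge>\<rho>. local_agg_sentence V K r \<chi>)"
  "ok X \<rho> (Ge1 g) \<longleftrightarrow> cl_free g = {} \<and> cl_term V K \<rho> g Z"
  "ok X \<rho> (BNeg \<Phi>) \<longleftrightarrow> ok X \<rho> \<Phi>"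
  "ok X \<rho> (BOr \<Phi> \<Psi>) \<longleftrightarrow> ok X \<rho> \<Phi> \<and> ok X \<rho> \<Psi>"
  "ok X \<rho> (BAnd \<Phi> \<Psi>) \<longleftrightarrow> ok X \<rho> \<Phi> \<and> ok X \<rho> \<Psi>"
  by (auto simp: ok_def BAnd_def)

lemma lf_mono: "lf X \<rho> \<psi> \<Longrightarrow> X \<subseteq> X' \<Longrightarrow> \<rho> \<le> \<rho>' \<Longrightarrow> lf X' \<rho>' \<psi>"
  by (auto simp: lf_def intro: slocal_mono conn_mono)

lemma cl_term_mono: "cl_term V K r g S \<Longrightarrow> r \<le> r' \<Longrightarrow> cl_term V K r' g S"
  by (induction g) (auto intro: order_trans)

lemma ok_mono: "ok X \<rho> \<Phi> \<Longrightarrow> X \<subseteq> X' \<Longrightarrow> \<rho> \<le> \<rho>' \<Longrightarrow> ok X' \<rho>' \<Phi>"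
  by (induction \<Phi>) (auto intro: lf_mono cl_term_mono)

text \<open>A local leaf needs a free variable, so truth is expressed by the ground cl-term
  \<open>1\<close>.\<close>

definition BTop :: "('s, 'v) bc" where
  "BTop = Ge1 (CElem Z (\<iota> 1))"

definition BDisj :: "('s, 'v) bc list \<Rightarrow> ('s, 'v) bc" where
  "BDisj \<Phi>s = foldr BOr \<Phi>s (BNeg BTop)"

definition BConj :: "('s, 'v) bc list \<Rightarrow> ('s, 'v) bc" where
  "BConj \<Phi>s = foldr BAnd \<Phi>s BTop"

lemma \<iota>_carrier [simp]: "\<iota> n \<in> carrier (alg V Z)"
  using iso by (auto simp: ring_iso_def ring_hom_def)

abbreviation bsat :: "('a, 'v) wstruct \<Rightarrow> (nat \<Rightarrow> 'a) \<Rightarrow> ('s, 'v) bc \<Rightarrow> bool" where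
  "bsat \<equiv> bc_sat V Z \<iota>"

lemma bsat_BTop [simp]: "bsat A \<beta> BTop"
  by (auto simp: BTop_def)

lemma ok_BTop [simp]: "ok X \<rho> BTop"
  by (simp add: BTop_def)

lemma bsat_BDisj [simp]: "bsat A \<beta> (BDisj \<Phi>s) \<longleftrightarrow> (\<exists>\<Phi>\<in>set \<Phi>s. bsat A \<beta> \<Phi>)"
  by (induction \<Phi>s) (auto simp: BDisj_def)

lemma bsat_BConj [simp]: "bsat A \<beta> (BConj \<Phi>s) \<longleftrightarrow> (\<forall>\<Phi>\<in>set \<Phi>s. bsat A \<beta> \<Phi>)"
  by (induction \<Phi>s) (auto simp: BConj_def)

lemma ok_BDisj [simp]: "ok X \<rho> (BDisj \<Phi>s) \<longleftrightarrow> (\<forall>\<Phi>\<in>set \<Phi>s. ok X \<rho> \<Phi>)"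
  by (induction \<Phi>s) (auto simp: BDisj_def)

lemma ok_BConj [simp]: "ok X \<rho> (BConj \<Phi>s) \<longleftrightarrow> (\<forall>\<Phi>\<in>set \<Phi>s. ok X \<rho> \<Phi>)"
  by (induction \<Phi>s) (auto simp: BConj_def)

lemma lf_dl: "r \<le> \<rho> \<Longrightarrow> x \<in> X \<Longrightarrow> y \<in> X \<Longrightarrow> lf X \<rho> (dl r x y)"
  by (simp add: lf_def slocal_dl conn_dl)

section \<open>Case distinctions over the leaves without bound variables\<close>

text \<open>Exhaustiveness has to be checked at local leaves only: sentences are split into
  complementary guards, and disjunctions take all pairs of guards.\<close>

lemma cases_bc_exists:
  assumes "\<And>\<psi>. \<psi> \<in> local_leaves \<Phi> \<Longrightarrow> \<exists>p\<in>set (f \<psi>). bsat A \<beta> (fst p)"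
  shows "\<exists>p\<in>set (cases_bc f \<Phi>). bsat A \<beta> (fst p)"
  using assms
proof (induction \<Phi>)
  case (BOr \<Phi> \<Psi>)
  then obtain p q where "p \<in> set (cases_bc f \<Phi>)" "bsat A \<beta> (fst p)" "q \<in> set (cases_bc f \<Psi>)" "bsat A \<beta> (fst q)"
    by (metis UnCI local_leaves.simps(5))
  then show ?case
    by (intro bexI[of _ "(BAnd (fst p) (fst q), Or (snd p) (snd q))"]) auto
qed auto

text \<open>Guards are evaluated under \<open>\<beta>\<close>, formulas under
  \<open>\<beta>'\<close>, which will also assign the quantified variables. Sentences have the same
  value under both, so a guard may fix them as constants.\<close>

lemma cases_bc_sound:
  assumes "ok Y \<rho> \<Phi>" "univ A \<noteq> {}" "p \<in> set (cases_bc f \<Phi>)" "bsat A \<beta> (fst p)"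
    and "\<And>\<psi> p. \<psi> \<in> local_leaves \<Phi> \<Longrightarrow> p \<in> set (f \<psi>) \<Longrightarrow> bsat A \<beta> (fst p) \<Longrightarrow> sat V A \<beta>' (snd p) \<longleftrightarrow> sat V A \<beta>' \<psi>"
  shows "sat V A \<beta>' (snd p) \<longleftrightarrow> bsat A \<beta>' \<Phi>"
  using assms
proof (induction \<Phi> arbitrary: p)
  case (Agg \<chi>)
  then have "free \<chi> = {}" by (auto simp: local_agg_sentence_def)
  then have "sat V A \<beta> \<chi> = sat V A \<beta>' \<chi>" by (intro sat_cong) auto
  then show ?case using Agg.prems(2-4) by auto
next
  case (Ge1 g)
  then have "cl_val V A \<beta> Z g = cl_val V A \<beta>' Z g" by (intro cl_val_cong) auto
  then show ?case using Ge1.prems(2-4) by auto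
next
  case (BNeg \<Phi>)
  obtain q where q: "q \<in> set (cases_bc f \<Phi>)" "p = (fst q, Neg (snd q))" using BNeg.prems(3) by (rule cases_bc_BNegE)
  have "sat V A \<beta>' (snd q) \<longleftrightarrow> bsat A \<beta>' \<Phi>"
    using BNeg q by (intro BNeg.IH) auto
  then show ?case using q by simp
next
  case (BOr \<Phi> \<Psi>)
  obtain q r where q: "q \<in> set (cases_bc f \<Phi>)" "r \<in> set (cases_bc f \<Psi>)"
      "p = (BAnd (fst q) (fst r), Or (snd q) (snd r))" using BOr.prems(3) by (rule cases_bc_BOrE)
  have "sat V A \<beta>' (snd q) \<longleftrightarrow> bsat A \<beta>' \<Phi>"
    by (rule BOr.IH(1)) (use BOr.prems q in auto)
  moreover have "sat V A \<beta>' (snd r) \<longleftrightarrow> bsat A \<beta>' \<Psi>"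
    by (rule BOr.IH(2)) (use BOr.prems q in auto)
  ultimately show ?case using q by simp
qed simp

lemma cases_bc_ok:
  assumes "ok Y \<rho> \<Phi>" "\<rho> \<le> \<rho>'" "p \<in> set (cases_bc f \<Phi>)"
    and "\<And>\<psi> p. \<psi> \<in> local_leaves \<Phi> \<Longrightarrow> p \<in> set (f \<psi>) \<Longrightarrow> ok X \<rho>' (fst p)"
  shows "ok X \<rho>' (fst p)"
  using assms
proof (induction \<Phi> arbitrary: p)
  case (BOr \<Phi> \<Psi>)
  obtain q r where q: "q \<in> set (cases_bc f \<Phi>)" "r \<in> set (cases_bc f \<Psi>)"
      "p = (BAnd (fst q) (fst r), Or (snd q) (snd r))" using BOr.prems(3) by (rule cases_bc_BOrE)
  have "ok X \<rho>' (fst q)"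
    by (rule BOr.IH(1)) (use BOr.prems q in auto)
  moreover have "ok X \<rho>' (fst r)"
    by (rule BOr.IH(2)) (use BOr.prems q in auto)
  ultimately show ?case using q by simp
qed (auto intro: cl_term_mono)

text \<open>\<open>G\<close> restricts attention to certain guards. A trivial \<open>G\<close> gives
  syntactic invariants of all listed formulas; truth under an assignment as \<open>G\<close> gives
  distance bounds for the formulas whose guard holds.\<close>

lemma cases_bc_fm:
  assumes "p \<in> set (cases_bc f \<Phi>)" "G (fst p)"
    and G: "\<And>\<Phi> \<Psi>. G (BAnd \<Phi> \<Psi>) \<Longrightarrow> G \<Phi> \<and> G \<Psi>"
    and "\<And>\<psi> p. \<psi> \<in> local_leaves \<Phi> \<Longrightarrow> p \<in> set (f \<psi>) \<Longrightarrow> G (fst p) \<Longrightarrow> P (snd p)"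
    and P: "P Top" "\<And>\<phi>. P \<phi> \<Longrightarrow> P (Neg \<phi>)" "\<And>\<phi> \<psi>. P \<phi> \<Longrightarrow> P \<psi> \<Longrightarrow> P (Or \<phi> \<psi>)"
  shows "P (snd p)"
  using assms(1,2,4)
proof (induction \<Phi> arbitrary: p)
  case (BNeg \<Phi>)
  obtain q where q: "q \<in> set (cases_bc f \<Phi>)" "p = (fst q, Neg (snd q))" using BNeg.prems(1) by (rule cases_bc_BNegE)
  have "P (snd q)"
  proof (rule BNeg.IH[OF q(1)])
    show "G (fst q)" using BNeg.prems(2) unfolding q(2) fst_conv .
    show "P (snd p)" if "\<psi> \<in> local_leaves \<Phi>" "p \<in> set (f \<psi>)" "G (fst p)" for \<psi> p
      using BNeg.prems(3)[of \<psi> p] that by simp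
  qed
  then show ?case using q P(2) by simp
next
  case (BOr \<Phi> \<Psi>)
  obtain q r where q: "q \<in> set (cases_bc f \<Phi>)" "r \<in> set (cases_bc f \<Psi>)"
      "p = (BAnd (fst q) (fst r), Or (snd q) (snd r))" using BOr.prems(1) by (rule cases_bc_BOrE)
  have g: "G (fst q) \<and> G (fst r)" using BOr.prems(2) unfolding q(3) fst_conv by (rule G)
  have "P (snd q)"
  proof (rule BOr.IH(1)[OF q(1)])
    show "G (fst q)" using g by blast
    show "P (snd p)" if "\<psi> \<in> local_leaves \<Phi>" "p \<in> set (f \<psi>)" "G (fst p)" for \<psi> p
      using BOr.prems(3)[of \<psi> p] that by simp
  qed
  moreover have "P (snd r)"
  proof (rule BOr.IH(2)[OF q(2)])
    show "G (fst r)" using g by blast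
    show "P (snd p)" if "\<psi> \<in> local_leaves \<Psi>" "p \<in> set (f \<psi>)" "G (fst p)" for \<psi> p
      using BOr.prems(3)[of \<psi> p] that by simp
  qed
  ultimately show ?case using q P(3) by simp
qed (use P in auto)


section \<open>Near and far quantification\<close>

text \<open>Common abstraction of \<open>Ex y\<close> and \<open>WSum s w ys\<close>: truth depends
  only on the weights and on the set of satisfying tuples. Inducing preserves the weights and, for
  near tuples, that set, so locality is proved once for both.\<close>

definition quantifier ::
  "nat list \<Rightarrow> (('s, 'v) fm \<Rightarrow> ('s, 'v) fm) \<Rightarrow> ((nat \<Rightarrow> 'a list \<Rightarrow> 'v) \<Rightarrow> 'a list set \<Rightarrow> bool) \<Rightarrow> bool" where
  "quantifier ys Q q \<longleftrightarrow> ys \<noteq> [] \<and> distinct ys \<and>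
     (\<forall>\<psi>. free (Q \<psi>) = free \<psi> - set ys) \<and> (\<forall>\<psi>. fow1 V \<psi> \<longrightarrow> fow1 V (Q \<psi>)) \<and>
     (\<forall>A \<beta> \<psi>. sat V A \<beta> (Q \<psi>) \<longleftrightarrow>
        q (wt A) {as \<in> tuples (length ys) (univ A). sat V A (upd \<beta> ys as) \<psi>})"

lemma quantifier_Ex: "quantifier [y] (Ex y) (\<lambda>_ T. T \<noteq> {})"
proof -
  have "(\<exists>a\<in>univ A. sat V A (\<beta>(y := a)) \<psi>) \<longleftrightarrow>
      {as \<in> tuples (length [y]) (univ A). sat V A (upd \<beta> [y] as) \<psi>} \<noteq> {}"
    for A :: "('a, 'v) wstruct" and \<beta> \<psi>
  proof
    assume "\<exists>a\<in>univ A. sat V A (\<beta>(y := a)) \<psi>"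
    then obtain a where "a \<in> univ A" "sat V A (\<beta>(y := a)) \<psi>" by blast
    then have "[a] \<in> {as \<in> tuples (length [y]) (univ A). sat V A (upd \<beta> [y] as) \<psi>}"
      by (simp add: tuples_def upd_Cons)
    then show "{as \<in> tuples (length [y]) (univ A). sat V A (upd \<beta> [y] as) \<psi>} \<noteq> {}" by blast
  next
    assume "{as \<in> tuples (length [y]) (univ A). sat V A (upd \<beta> [y] as) \<psi>} \<noteq> {}"
    then obtain a where "a \<in> univ A" "sat V A (upd \<beta> [y] [a]) \<psi>"
      by (auto simp: tuples_def length_Suc_conv)
    then show "\<exists>a\<in>univ A. sat V A (\<beta>(y := a)) \<psi>" by (auto simp: upd_Cons)
  qed
  then show ?thesis by (simp add: quantifier_def)
qed

lemma quantifier_WSum: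
  assumes "ys \<noteq> []" "fow1 V (WSum s w ys Top)"
  shows "quantifier ys (WSum s w ys) (\<lambda>W T. s = finsum (alg V (wt_type V w)) (W w) T)"
  using assms by (simp add: quantifier_def)

text \<open>Tuples that violate this have weight zero, and for a single variable it is vacuous.
  Adding it therefore changes neither sums nor existential quantifiers, while it keeps the whole
  tuple near its first entry.\<close>

definition clique_fm :: "nat list \<Rightarrow> ('s, 'v) fm" where
  "clique_fm ys = Conj (map (\<lambda>y. dl 1 (hd ys) y) ys)"

definition near_fm :: "nat \<Rightarrow> nat \<Rightarrow> nat list \<Rightarrow> ('s, 'v) fm" where
  "near_fm d x ys = And (dl d x (hd ys)) (clique_fm ys)"

definition clique :: "('a, 'v) wstruct \<Rightarrow> 'a list \<Rightarrow> bool" where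
  "clique A as \<longleftrightarrow> (\<forall>b\<in>set as. near V A 1 (hd as) b)"

lemma sat_clique_fm:
  assumes "A \<in> K" "as \<in> tuples (length ys) (univ A)" "distinct ys" "ys \<noteq> []"
  shows "sat V A (upd \<beta> ys as) (clique_fm ys) \<longleftrightarrow> clique A as"
proof -
  have l: "length as = length ys" "set as \<subseteq> univ A" using assms(2) by (auto simp: tuples_def)
  have u: "upd \<beta> ys as ` set ys = set as" "upd \<beta> ys as (hd ys) = hd as"
    using upd_image[OF l(1) assms(3)] upd_hd[OF l(1) assms(4)] by auto
  have "sat V A (upd \<beta> ys as) (clique_fm ys) \<longleftrightarrow> (\<forall>y\<in>set ys. near V A 1 (hd as) (upd \<beta> ys as y))"
  proof -
    have "sat V A (upd \<beta> ys as) (dl 1 (hd ys) y) \<longleftrightarrow> near V A 1 (hd as) (upd \<beta> ys as y)" if "y \<in> set ys" for y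
    proof -
      have "upd \<beta> ys as y \<in> univ A" "upd \<beta> ys as (hd ys) \<in> univ A"
        using u(1) l(2) that hd_in_set[OF assms(4)] by blast+
      then show ?thesis using sat_dl[OF assms(1)] u(2) by metis
    qed
    then show ?thesis by (simp add: clique_fm_def univ_nonempty[OF assms(1)])
  qed
  also have "\<dots> \<longleftrightarrow> clique A as" unfolding clique_def u(1)[symmetric] by blast
  finally show ?thesis .
qed

lemma free_clique_fm [simp]: "ys \<noteq> [] \<Longrightarrow> free (clique_fm ys) = set ys"
  by (auto simp: clique_fm_def)

lemma fow1_clique_fm [simp]: "fow1 V (clique_fm ys)"
  by (auto simp: clique_fm_def)

lemma slocal_clique_fm: "1 \<le> r \<Longrightarrow> slocal r (clique_fm ys)"
  unfolding clique_fm_def by (rule slocal_Conj) (auto intro: slocal_dl)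

lemma free_near_fm [simp]: "ys \<noteq> [] \<Longrightarrow> free (near_fm d x ys) = insert x (set ys)"
  by (auto simp: near_fm_def)

lemma fow1_near_fm [simp]: "fow1 V (near_fm d x ys)"
  by (auto simp: near_fm_def)

definition tnear :: "('a, 'v) wstruct \<Rightarrow> nat \<Rightarrow> 'a \<Rightarrow> 'a list \<Rightarrow> bool" where
  "tnear A d a as \<longleftrightarrow> near V A d a (hd as) \<and> clique A as"

lemma tnear_near: "tnear A d a as \<Longrightarrow> b \<in> set as \<Longrightarrow> near V A (d + 1) a b"
  unfolding tnear_def clique_def by (metis near_trans)

lemma sat_near_fm:
  assumes "A \<in> K" "as \<in> tuples (length ys) (univ A)" "distinct ys" "ys \<noteq> []" "x \<notin> set ys" "\<beta> x \<in> univ A"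
  shows "sat V A (upd \<beta> ys as) (near_fm d x ys) \<longleftrightarrow> tnear A d (\<beta> x) as"
proof -
  have l: "length as = length ys" "set as \<subseteq> univ A" using assms(2) by (auto simp: tuples_def)
  then have "hd as \<in> univ A" using assms(4) by (cases as) auto
  then show ?thesis
    using sat_clique_fm[OF assms(1-4)] sat_dl[OF assms(1), of "upd \<beta> ys as" x "hd ys" d] assms(5,6)
    by (simp add: near_fm_def tnear_def upd_hd[OF l(1) assms(4)] upd_notin)
qed

text \<open>The quantified part alone need not be connected: a sum over no tuples may equal
  \<open>s\<close> wherever the other variables lie. The extra conjuncts tie every free variable to
  \<open>x\<close>; under the guards of \<open>near_leaf\<close> they hold anyway.\<close>

definition near_q :: "(('s, 'v) fm \<Rightarrow> ('s, 'v) fm) \<Rightarrow> nat \<Rightarrow> nat \<Rightarrow> nat \<Rightarrow> nat list \<Rightarrow> ('s, 'v) fm \<Rightarrow> ('s, 'v) fm" where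
  "near_q Q D d x ys \<psi> = And (Conj (map (dl D x) (fvl (Q (And (near_fm d x ys) \<psi>))))) (Q (And (near_fm d x ys) \<psi>))"

section \<open>Quantification over tuples near one variable\<close>

context
  fixes ys :: "nat list" and Q q and \<rho> d x D :: nat and \<psi>
  assumes Q: "quantifier ys Q q" and x: "x \<notin> set ys"
    and \<psi>: "fow1 V \<psi>" "slocal \<rho> \<psi>" and D: "D = d + \<rho> + 1"
begin

lemma ys: "ys \<noteq> []" "distinct ys"
  using Q by (auto simp: quantifier_def)

lemma free_near_body: "free (Q (And (near_fm d x ys) \<psi>)) = insert x (free \<psi> - set ys)"
  using Q x ys by (auto simp: quantifier_def)

lemma free_near_q: "free (near_q Q D d x ys \<psi>) = insert x (free \<psi> - set ys)"
  by (auto simp: near_q_def free_near_body)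

lemma fow1_near_q: "fow1 V (near_q Q D d x ys \<psi>)"
  using Q \<psi> by (simp add: near_q_def quantifier_def)

lemma sat_near_q:
  assumes A: "A \<in> K" and \<beta>: "\<beta> ` insert x (free \<psi> - set ys) \<subseteq> univ A"
  shows "sat V A \<beta> (near_q Q D d x ys \<psi>) \<longleftrightarrow> (\<forall>z\<in>free \<psi> - set ys. near V A D (\<beta> x) (\<beta> z)) \<and>
    q (wt A) {as \<in> tuples (length ys) (univ A). tnear A d (\<beta> x) as \<and> sat V A (upd \<beta> ys as) \<psi>}"
proof -
  have "sat V A \<beta> (Q (And (near_fm d x ys) \<psi>)) \<longleftrightarrow>
    q (wt A) {as \<in> tuples (length ys) (univ A). tnear A d (\<beta> x) as \<and> sat V A (upd \<beta> ys as) \<psi>}"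
    using Q \<beta> sat_near_fm[OF A _ ys(2,1) x] by (simp add: quantifier_def cong: conj_cong)
  moreover have "sat V A \<beta> (Conj (map (dl D x) (fvl (Q (And (near_fm d x ys) \<psi>))))) \<longleftrightarrow>
     (\<forall>z\<in>free \<psi> - set ys. near V A D (\<beta> x) (\<beta> z))"
    using \<beta> univ_nonempty[OF A] by (auto simp: free_near_body sat_dl[OF A] subset_iff)
  ultimately show ?thesis by (simp add: near_q_def)
qed

lemma conn_near_q: "conn (2 * D) (near_q Q D d x ys \<psi>)"
  unfolding conn_def
proof (intro ballI allI impI)
  fix A \<beta> u v
  assume A: "A \<in> K" "\<beta> ` free (near_q Q D d x ys \<psi>) \<subseteq> univ A" "sat V A \<beta> (near_q Q D d x ys \<psi>)"
    and uv: "u \<in> free (near_q Q D d x ys \<psi>)" "v \<in> free (near_q Q D d x ys \<psi>)"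
  have *: "near V A D (\<beta> x) (\<beta> z)" if "z \<in> free (near_q Q D d x ys \<psi>)" for z
    using A(3) that near_refl[of V A D] unfolding free_near_q sat_near_q[OF A(1) A(2)[unfolded free_near_q]] by auto
  show "near V A (2 * D) (\<beta> u) (\<beta> v)"
    using near_trans[OF near_sym[OF *[OF uv(1)]] *[OF uv(2)]] by (simp add: mult_2)
qed

text \<open>
  All quantified tuples that matter lie within distance \<open>d + 1\<close> of \<open>x\<close>, so their \<open>\<rho>\<close>-balls lie in the
  \<open>D\<close>-ball of \<open>x\<close>.
\<close>

lemma slocal_near_q: "slocal D (near_q Q D d x ys \<psi>)"
  unfolding slocal_def free_near_q
proof (intro ballI allI impI)
  fix A \<beta> X
  let ?F = "insert x (free \<psi> - set ys)"
  assume A: "A \<in> K" "\<beta> ` ?F \<subseteq> univ A" "X \<subseteq> univ A" "X \<noteq> {}" "ball V A D (\<beta> ` ?F) \<subseteq> X"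
  have bx: "\<beta> x \<in> X" using A subset_ball[OF A(2), of V D] by auto
  have "{as \<in> tuples (length ys) X. sat V (induced A X) (upd \<beta> ys as) (And (near_fm d x ys) \<psi>)}
     = {as \<in> tuples (length ys) (univ A). sat V A (upd \<beta> ys as) (And (near_fm d x ys) \<psi>)}" (is "?L = ?R")
  proof -
    have nf: "sat V (induced A X) (upd \<beta> ys as) (near_fm d x ys) \<longleftrightarrow> tnear A d (\<beta> x) as"
      if as: "as \<in> tuples (length ys) X" for as
    proof -
      have l: "length as = length ys" "set as \<subseteq> X" using as by (auto simp: tuples_def)
      have u: "upd \<beta> ys as ` set ys = set as" "upd \<beta> ys as (hd ys) = hd as" "upd \<beta> ys as x = \<beta> x"
        using upd_image[OF l(1) ys(2)] upd_hd[OF l(1) ys(1)] x by (auto simp: upd_notin)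
      have hd: "hd as \<in> X" using l ys(1) by (cases as) auto
      have d: "sat V (induced A X) (upd \<beta> ys as) (dl d x (hd ys)) \<longleftrightarrow> near V A d (\<beta> x) (hd as)"
      proof -
        have "ball V A d {\<beta> x} \<subseteq> X"
          using A(5) ball_mono[of "{\<beta> x}" "\<beta> ` ?F" d D V A] D by auto
        then show ?thesis using sat_dl_induced[OF A(1,3), of "upd \<beta> ys as" x "hd ys" d] hd bx by (simp add: u)
      qed
      \<comment> \<open>The clique test needs the ball of radius 1 around \<open>hd as\<close>
        inside \<open>X\<close>, which is available only once \<open>hd as\<close> is known to be
        near \<open>x\<close>.\<close>
      have c: "sat V (induced A X) (upd \<beta> ys as) (clique_fm ys) \<longleftrightarrow> clique A as" if "near V A d (\<beta> x) (hd as)"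
      proof -
        have "ball V A 1 {hd as} \<subseteq> ball V A D (\<beta> ` ?F)"
          using that near_trans_le[of V A d "\<beta> x" "hd as" 1 _ D] D by (auto simp: ball_def)
        then have "ball V A 1 {hd as} \<subseteq> X" using A(5) by blast
        then have "sat V (induced A X) (upd \<beta> ys as) (dl 1 (hd ys) y) \<longleftrightarrow> near V A 1 (hd as) (upd \<beta> ys as y)"
          if "y \<in> set ys" for y
          using sat_dl_induced[OF A(1,3), of "upd \<beta> ys as" "hd ys" y 1] hd l(2) u(1) that by (auto simp: u(2))
        then have "sat V (induced A X) (upd \<beta> ys as) (clique_fm ys) \<longleftrightarrow> (\<forall>y\<in>set ys. near V A 1 (hd as) (upd \<beta> ys as y))"
          using A(4) by (auto simp: clique_fm_def)
        also have "\<dots> \<longleftrightarrow> clique A as" unfolding clique_def u(1)[symmetric] by blast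
        finally show ?thesis .
      qed
      show ?thesis using d c by (auto simp: near_fm_def tnear_def)
    qed
    have sub: "as \<in> tuples (length ys) X" if "as \<in> tuples (length ys) (univ A)" "tnear A d (\<beta> x) as" for as
    proof -
      have "b \<in> X" if "b \<in> set as" for b
      proof -
        have "near V A (d + 1) (\<beta> x) b" using tnear_near \<open>tnear A d (\<beta> x) as\<close> that by blast
        moreover have "b \<in> univ A" using that \<open>as \<in> tuples (length ys) (univ A)\<close> by (auto simp: tuples_def)
        ultimately have "b \<in> ball V A D (\<beta> ` ?F)" using near_mono[of V A "d + 1" _ _ D] D by (auto simp: ball_def)
        then show ?thesis using A(5) by blast
      qed
      then show ?thesis using that(1) by (auto simp: tuples_def)
    qed
    have loc: "sat V (induced A X) (upd \<beta> ys as) \<psi> \<longleftrightarrow> sat V A (upd \<beta> ys as) \<psi>"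
      if as: "as \<in> tuples (length ys) X" "tnear A d (\<beta> x) as" for as
    proof (rule slocalD[OF \<psi>(2) A(1) _ A(3,4)])
      have l: "length as = length ys" "set as \<subseteq> X" using as by (auto simp: tuples_def)
      have im: "upd \<beta> ys as ` free \<psi> \<subseteq> set as \<union> \<beta> ` ?F"
      proof
        fix b assume "b \<in> upd \<beta> ys as ` free \<psi>"
        then obtain z where z: "z \<in> free \<psi>" "b = upd \<beta> ys as z" by blast
        show "b \<in> set as \<union> \<beta> ` ?F"
          using upd_in[OF l(1), of z \<beta>] upd_notin[of z ys \<beta> as] z by (cases "z \<in> set ys") auto
      qed
      then show "upd \<beta> ys as ` free \<psi> \<subseteq> univ A" using l(2) A(2,3) by blast
      have "b \<in> ball V A D (\<beta> ` ?F)" if b: "b \<in> ball V A \<rho> (upd \<beta> ys as ` free \<psi>)" for b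
      proof -
        obtain a where a: "a \<in> set as \<union> \<beta> ` ?F" "near V A \<rho> a b" "b \<in> univ A"
          using b im by (auto simp: ball_def)
        show ?thesis
        proof (cases "a \<in> set as")
          case True
          then have "near V A (d + 1) (\<beta> x) a" using tnear_near as(2) by blast
          then have "near V A D (\<beta> x) b" using near_trans_le[OF _ a(2)] D by simp
          then show ?thesis using a(3) by (auto simp: ball_def)
        next
          case False
          then show ?thesis using a near_mono[OF a(2), of D] D unfolding ball_def by auto
        qed
      qed
      then show "ball V A \<rho> (upd \<beta> ys as ` free \<psi>) \<subseteq> X" using A(5) by blast
    qed
    have nfA: "sat V A (upd \<beta> ys as) (near_fm d x ys) \<longleftrightarrow> tnear A d (\<beta> x) as"
      if "as \<in> tuples (length ys) (univ A)" for as
      using sat_near_fm[OF A(1) that ys(2,1) x] A(2) by simp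
    have mono: "as \<in> tuples (length ys) (univ A)" if "as \<in> tuples (length ys) X" for as
      using that A(3) by (auto simp: tuples_def)
    show ?thesis
    proof (intro equalityI subsetI)
      fix as assume "as \<in> ?L"
      then have as: "as \<in> tuples (length ys) X" "sat V (induced A X) (upd \<beta> ys as) (near_fm d x ys)"
        "sat V (induced A X) (upd \<beta> ys as) \<psi>" by auto
      then have "tnear A d (\<beta> x) as" using nf by blast
      then show "as \<in> ?R" using as loc mono nfA by simp
    next
      fix as assume "as \<in> ?R"
      then have as: "as \<in> tuples (length ys) (univ A)" "sat V A (upd \<beta> ys as) (near_fm d x ys)"
        "sat V A (upd \<beta> ys as) \<psi>" by auto
      then have "tnear A d (\<beta> x) as" using nfA by blast
      then show "as \<in> ?L" using as loc sub nf by simp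
    qed
  qed
  \<comment> \<open>The sets of satisfying tuples and the weights coincide, and \<open>Q\<close>
    depends on nothing else.\<close>
  then have "sat V (induced A X) \<beta> (Q (And (near_fm d x ys) \<psi>)) = sat V A \<beta> (Q (And (near_fm d x ys) \<psi>))"
    using Q by (simp add: quantifier_def)
  moreover have "sat V (induced A X) \<beta> (Conj (map (dl D x) (fvl (Q (And (near_fm d x ys) \<psi>))))) =
      sat V A \<beta> (Conj (map (dl D x) (fvl (Q (And (near_fm d x ys) \<psi>)))))"
    by (rule slocal_sub[OF slocal_Conj A(1) _ order_refl A(2-5)]) (auto intro: slocal_dl simp: free_near_body)
  ultimately show "sat V (induced A X) \<beta> (near_q Q D d x ys \<psi>) = sat V A \<beta> (near_q Q D d x ys \<psi>)"
    by (simp add: near_q_def)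
qed

end

definition outer_vars :: "nat list \<Rightarrow> ('s, 'v) fm \<Rightarrow> nat list" where
  "outer_vars ys \<psi> = filter (\<lambda>z. z \<notin> set ys) (fvl \<psi>)"

text \<open>
  Both functions serve the elimination of quantified variables \<open>ys\<close>.  Near \<open>x\<close>, a leaf relating \<open>ys\<close> to other
  variables can hold only if these are near \<open>x\<close>, which becomes a guard.  Far from all other variables it
  cannot hold at all.
\<close>

definition near_leaf :: "nat \<Rightarrow> nat \<Rightarrow> nat list \<Rightarrow> ('s, 'v) fm \<Rightarrow> (('s, 'v) bc \<times> ('s, 'v) fm) list" where
  "near_leaf D x ys \<psi> =
    (if outer_vars ys \<psi> = fvl \<psi> then [(Local \<psi>, Top), (BNeg (Local \<psi>), Neg Top)]
     else [(BConj (map (\<lambda>z. Local (dl D x z)) (outer_vars ys \<psi>)), \<psi>),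
           (BNeg (BConj (map (\<lambda>z. Local (dl D x z)) (outer_vars ys \<psi>))), Neg Top)])"

definition far_leaf :: "nat list \<Rightarrow> ('s, 'v) fm \<Rightarrow> (('s, 'v) bc \<times> ('s, 'v) fm) list" where
  "far_leaf ys \<psi> =
    (if outer_vars ys \<psi> = fvl \<psi> then [(Local \<psi>, Top), (BNeg (Local \<psi>), Neg Top)]
     else if outer_vars ys \<psi> = [] then [(BTop, \<psi>)] else [(BTop, Neg Top)])"

definition near_bc :: "(('s, 'v) fm \<Rightarrow> ('s, 'v) fm) \<Rightarrow> nat \<Rightarrow> nat \<Rightarrow> nat \<Rightarrow> nat list \<Rightarrow> ('s, 'v) bc \<Rightarrow> ('s, 'v) bc" where
  "near_bc Q \<rho> d x ys \<Phi> = BDisj (map (\<lambda>p. BAnd (fst p) (Local (near_q Q (d + \<rho> + 1) d x ys (snd p))))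
     (cases_bc (near_leaf (d + \<rho> + 1) x ys) \<Phi>))"

lemma set_outer_vars [simp]: "set (outer_vars ys \<psi>) = free \<psi> - set ys"
  by (auto simp: outer_vars_def)

lemma outer_vars_eq_iff: "outer_vars ys \<psi> = fvl \<psi> \<longleftrightarrow> free \<psi> \<inter> set ys = {}"
  unfolding outer_vars_def filter_id_conv by auto

lemma outer_vars_Nil_iff: "outer_vars ys \<psi> = [] \<longleftrightarrow> free \<psi> \<subseteq> set ys"
  using set_outer_vars[of ys \<psi>] by (metis Diff_eq_empty_iff set_empty)

lemma okD: "ok Y \<rho> \<Phi> \<Longrightarrow> \<psi> \<in> local_leaves \<Phi> \<Longrightarrow> lf Y \<rho> \<psi>"
  by (simp add: ok_def)

lemma sat_upd_outer: "free \<psi> \<inter> set ys = {} \<Longrightarrow> sat V A (upd \<beta> ys as) \<psi> = sat V A \<beta> \<psi>"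
  by (rule sat_cong) (auto intro: upd_notin)

lemma upd_image_subset:
  assumes "as \<in> tuples (length ys) (univ A)" "\<beta> ` (F - set ys) \<subseteq> univ A"
  shows "upd \<beta> ys as ` F \<subseteq> univ A"
proof
  fix b assume "b \<in> upd \<beta> ys as ` F"
  then obtain z where z: "z \<in> F" "b = upd \<beta> ys as z" by blast
  show "b \<in> univ A"
    using assms upd_in[of as ys z \<beta>] upd_notin[of z ys \<beta> as] z by (cases "z \<in> set ys") (auto simp: tuples_def)
qed

section \<open>Elimination of a quantifier near a variable\<close>

context
  fixes Q q and ys :: "nat list" and \<rho> d x :: nat and \<Phi> Y
  assumes Q: "quantifier ys Q q" and x: "x \<notin> set ys" and ok: "ok Y \<rho> \<Phi>"
begin

lemma near_cases_fm:
  assumes "p \<in> set (cases_bc (near_leaf (d + \<rho> + 1) x ys) \<Phi>)"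
  shows "fow1 V (snd p) \<and> slocal \<rho> (snd p) \<and> free (snd p) \<subseteq> Y"
  using assms
proof (rule cases_bc_fm[where G = "\<lambda>_. True"])
  show "fow1 V (snd p) \<and> slocal \<rho> (snd p) \<and> free (snd p) \<subseteq> Y"
    if "\<psi> \<in> local_leaves \<Phi>" "p \<in> set (near_leaf (d + \<rho> + 1) x ys \<psi>)" for \<psi> p
    using okD[OF ok that(1)] that(2) by (auto simp: near_leaf_def lf_def split: if_splits)
qed auto

lemma near_cases_guard:
  assumes "p \<in> set (cases_bc (near_leaf (d + \<rho> + 1) x ys) \<Phi>)"
  shows "ok (insert x (Y - set ys)) (2 * (d + \<rho> + 1)) (fst p)"
proof (rule cases_bc_ok[OF ok _ assms])
  show "ok (insert x (Y - set ys)) (2 * (d + \<rho> + 1)) (fst p)"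
    if "\<psi> \<in> local_leaves \<Phi>" "p \<in> set (near_leaf (d + \<rho> + 1) x ys \<psi>)" for \<psi> p
  proof -
    have lf: "lf Y \<rho> \<psi>" using okD[OF ok that(1)] .
    have "lf (insert x (Y - set ys)) (2 * (d + \<rho> + 1)) (dl (d + \<rho> + 1) x z)" if "z \<in> free \<psi> - set ys" for z
      using that lf by (intro lf_dl) (auto simp: lf_def)
    moreover have "lf (insert x (Y - set ys)) (2 * (d + \<rho> + 1)) \<psi>" if "free \<psi> \<inter> set ys = {}"
    proof -
      have "free \<psi> \<subseteq> Y" using lf by (simp add: lf_def)
      then have sub: "free \<psi> \<subseteq> insert x (Y - set ys)" using that by blast
      have "lf (free \<psi>) \<rho> \<psi>" using lf by (simp add: lf_def)
      then show ?thesis by (rule lf_mono[OF _ sub]) simp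
    qed
    ultimately show ?thesis using that(2)
      by (auto simp: near_leaf_def outer_vars_eq_iff split: if_splits)
  qed
qed auto

text \<open>The formula from \<open>near_q\<close> is local with radius
  \<open>d + \<rho> + 1\<close> and has at most twice that diameter, as its variables are all near
  \<open>x\<close>; the doubled number bounds both.\<close>

lemma ok_near_bc: "ok (insert x (Y - set ys)) (2 * (d + \<rho> + 1)) (near_bc Q \<rho> d x ys \<Phi>)"
proof -
  have "lf (insert x (Y - set ys)) (2 * (d + \<rho> + 1)) (near_q Q (d + \<rho> + 1) d x ys (snd p))"
    if "p \<in> set (cases_bc (near_leaf (d + \<rho> + 1) x ys) \<Phi>)" for p
  proof -
    have p: "fow1 V (snd p)" "slocal \<rho> (snd p)" "free (snd p) \<subseteq> Y" using near_cases_fm[OF that] by auto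
    show ?thesis
      unfolding lf_def free_near_q[OF Q x p(1,2) refl]
      using fow1_near_q[OF Q x p(1,2) refl] slocal_near_q[OF Q x p(1,2) refl, of d]
        conn_near_q[OF Q x p(1,2) refl, of d] p(3)
      by (auto intro: slocal_mono)
  qed
  then show ?thesis using near_cases_guard by (auto simp: near_bc_def)
qed

text \<open>A leaf mentioning \<open>ys\<close> and an outer variable \<open>z\<close> can hold at a
  tuple near \<open>x\<close> only if \<open>z\<close> is within \<open>\<rho>\<close> of an entry,
  hence within \<open>d + 1 + \<rho>\<close> of \<open>x\<close>. Where the guard denies this, a
  false formula may replace the leaf.\<close>

lemma bsat_near_bc:
  assumes A: "A \<in> K" and \<beta>: "\<beta> ` insert x (Y - set ys) \<subseteq> univ A"
  shows "bsat A \<beta> (near_bc Q \<rho> d x ys \<Phi>) \<longleftrightarrow>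
    q (wt A) {as \<in> tuples (length ys) (univ A). tnear A d (\<beta> x) as \<and> bsat A (upd \<beta> ys as) \<Phi>}"
proof -
  let ?D = "d + \<rho> + 1"
  let ?cs = "cases_bc (near_leaf ?D x ys) \<Phi>"
  note ne = univ_nonempty[OF A]
  have close: "bsat A \<beta> (BConj (map (\<lambda>z. Local (dl ?D x z)) (outer_vars ys \<psi>))) \<longleftrightarrow>
      (\<forall>z\<in>free \<psi> - set ys. near V A ?D (\<beta> x) (\<beta> z))" if "\<psi> \<in> local_leaves \<Phi>" for \<psi>
  proof -
    have "free \<psi> \<subseteq> Y" using okD[OF ok that] by (simp add: lf_def)
    then have "sat V A \<beta> (dl ?D x z) \<longleftrightarrow> near V A ?D (\<beta> x) (\<beta> z)" if "z \<in> free \<psi> - set ys" for z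
      using sat_dl[OF A, of \<beta> x z ?D] \<beta> that by blast
    then show ?thesis by simp
  qed
  have main: "sat V A \<beta> (near_q Q ?D d x ys (snd p)) \<longleftrightarrow>
     q (wt A) {as \<in> tuples (length ys) (univ A). tnear A d (\<beta> x) as \<and> bsat A (upd \<beta> ys as) \<Phi>}"
    if p: "p \<in> set ?cs" "bsat A \<beta> (fst p)" for p
  proof -
    have fm: "fow1 V (snd p)" "slocal \<rho> (snd p)" "free (snd p) \<subseteq> Y" using near_cases_fm[OF p(1)] by auto
    \<comment> \<open>Under a true guard, only leaves with all outer variables close to
      \<open>x\<close> are kept, so the conjuncts added by \<open>near_q\<close> hold.\<close>
    have cl: "\<forall>z\<in>free (snd p) - set ys. near V A ?D (\<beta> x) (\<beta> z)"
      using p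
    proof (rule cases_bc_fm[where G = "bsat A \<beta>"])
      show "\<forall>z\<in>free (snd p) - set ys. near V A ?D (\<beta> x) (\<beta> z)"
        if "\<psi> \<in> local_leaves \<Phi>" "p \<in> set (near_leaf ?D x ys \<psi>)" "bsat A \<beta> (fst p)" for \<psi> p
        using that(2,3) close[OF that(1)] unfolding near_leaf_def by (auto split: if_splits)
    qed auto
    have eq: "sat V A (upd \<beta> ys as) (snd p) \<longleftrightarrow> bsat A (upd \<beta> ys as) \<Phi>"
      if as: "as \<in> tuples (length ys) (univ A)" "tnear A d (\<beta> x) as" for as
    proof (rule cases_bc_sound[OF ok ne p])
      fix \<psi> p assume \<psi>: "\<psi> \<in> local_leaves \<Phi>" and p: "p \<in> set (near_leaf ?D x ys \<psi>)" "bsat A \<beta> (fst p)"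
      have lf: "lf Y \<rho> \<psi>" using okD[OF ok \<psi>] .
      show "sat V A (upd \<beta> ys as) (snd p) \<longleftrightarrow> sat V A (upd \<beta> ys as) \<psi>"
      proof (cases "free \<psi> \<inter> set ys = {}")
        case True
        then show ?thesis using p ne sat_upd_outer[OF True, of A \<beta> as]
          by (auto simp: near_leaf_def outer_vars_eq_iff)
      next
        case False
        then obtain y where y: "y \<in> free \<psi>" "y \<in> set ys" by blast
        have "\<forall>z\<in>free \<psi> - set ys. near V A ?D (\<beta> x) (\<beta> z)" if s: "sat V A (upd \<beta> ys as) \<psi>"
        proof
          fix z assume z: "z \<in> free \<psi> - set ys"
          have "near V A \<rho> (upd \<beta> ys as y) (upd \<beta> ys as z)"
          proof (rule connD[OF _ A _ s y(1)])
            show "upd \<beta> ys as ` free \<psi> \<subseteq> univ A"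
              using \<beta> lf by (intro upd_image_subset[OF as(1)]) (auto simp: lf_def)
          qed (use lf z in \<open>auto simp: lf_def\<close>)
          moreover have "upd \<beta> ys as z = \<beta> z" using z by (simp add: upd_notin)
          moreover have "near V A (d + 1) (\<beta> x) (upd \<beta> ys as y)"
            using tnear_near[OF as(2)] upd_in[of as ys y] y(2) as(1) by (auto simp: tuples_def)
          ultimately show "near V A ?D (\<beta> x) (\<beta> z)"
            using near_trans_le[of V A "d + 1" "\<beta> x" _ \<rho> "\<beta> z" ?D] by simp
        qed
        then show ?thesis using p False ne close[OF \<psi>] by (auto simp: near_leaf_def outer_vars_eq_iff simp del: bsat_BConj)
      qed
    qed
    have "{as \<in> tuples (length ys) (univ A). tnear A d (\<beta> x) as \<and> sat V A (upd \<beta> ys as) (snd p)} =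
      {as \<in> tuples (length ys) (univ A). tnear A d (\<beta> x) as \<and> bsat A (upd \<beta> ys as) \<Phi>}"
      using eq by blast
    moreover have "\<beta> ` insert x (free (snd p) - set ys) \<subseteq> univ A" using \<beta> fm(3) by blast
    ultimately show ?thesis
      using sat_near_q[OF Q x fm(1,2) refl A, where d = d and \<beta> = \<beta>] cl by simp
  qed
  have "\<exists>p\<in>set ?cs. bsat A \<beta> (fst p)"
    by (rule cases_bc_exists) (auto simp: near_leaf_def)
  then show ?thesis using main by (auto simp: near_bc_def)
qed

end

section \<open>Replacement of a combination far from the outer variables\<close>

context
  fixes ys :: "nat list" and \<rho> :: nat and \<Phi> Y
  assumes ys: "ys \<noteq> []" "distinct ys" and ok: "ok Y \<rho> \<Phi>"
begin

lemma far_cases_fm: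
  assumes "p \<in> set (cases_bc (far_leaf ys) \<Phi>)"
  shows "fow1 V (snd p) \<and> slocal \<rho> (snd p) \<and> free (snd p) \<subseteq> set ys"
  using assms
proof (rule cases_bc_fm[where G = "\<lambda>_. True"])
  show "fow1 V (snd p) \<and> slocal \<rho> (snd p) \<and> free (snd p) \<subseteq> set ys"
    if "\<psi> \<in> local_leaves \<Phi>" "p \<in> set (far_leaf ys \<psi>)" for \<psi> p
    using okD[OF ok that(1)] that(2)
    by (auto simp: far_leaf_def lf_def outer_vars_Nil_iff split: if_splits)
qed auto

lemma far_cases_guard:
  assumes "p \<in> set (cases_bc (far_leaf ys) \<Phi>)"
  shows "ok (Y - set ys) \<rho> (fst p)"
proof (rule cases_bc_ok[OF ok _ assms])
  show "ok (Y - set ys) \<rho> (fst p)" if "\<psi> \<in> local_leaves \<Phi>" "p \<in> set (far_leaf ys \<psi>)" for \<psi> p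
  proof -
    have "lf Y \<rho> \<psi>" using okD[OF ok that(1)] .
    then have "lf (Y - set ys) \<rho> \<psi>" if "free \<psi> \<inter> set ys = {}" using that by (auto simp: lf_def)
    then show ?thesis using that(2)
      by (auto simp: far_leaf_def outer_vars_eq_iff split: if_splits)
  qed
qed auto

lemma far_cases_exists: "\<exists>p\<in>set (cases_bc (far_leaf ys) \<Phi>). bsat A \<beta> (fst p)"
  by (rule cases_bc_exists) (auto simp: far_leaf_def)

text \<open>If a leaf with an entry \<open>y\<close> and an outer variable \<open>z\<close> held,
  there would be at most one step from \<open>hd as\<close> to \<open>y\<close> and at most
  \<open>\<rho>\<close> from \<open>y\<close> to \<open>z\<close>; this is the bound
  \<open>\<rho> + 1\<close>.\<close>

lemma far_cases_sound:
  assumes A: "A \<in> K" and \<beta>: "\<beta> ` (Y - set ys) \<subseteq> univ A"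
    and p: "p \<in> set (cases_bc (far_leaf ys) \<Phi>)" "bsat A \<beta> (fst p)"
    and as: "as \<in> tuples (length ys) (univ A)" "clique A as"
    and far: "\<And>z. z \<in> Y - set ys \<Longrightarrow> \<not> near V A (\<rho> + 1) (\<beta> z) (hd as)"
  shows "sat V A (upd \<beta> ys as) (snd p) \<longleftrightarrow> bsat A (upd \<beta> ys as) \<Phi>"
proof (rule cases_bc_sound[OF ok univ_nonempty[OF A] p])
  note ne = univ_nonempty[OF A]
  fix \<psi> p assume \<psi>: "\<psi> \<in> local_leaves \<Phi>" and p: "p \<in> set (far_leaf ys \<psi>)" "bsat A \<beta> (fst p)"
  have lf: "lf Y \<rho> \<psi>" using okD[OF ok \<psi>] .
  show "sat V A (upd \<beta> ys as) (snd p) \<longleftrightarrow> sat V A (upd \<beta> ys as) \<psi>"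
  proof (cases "free \<psi> \<inter> set ys = {}")
    case True
    then show ?thesis using p ne sat_upd_outer[OF True, of A \<beta> as]
      by (auto simp: far_leaf_def outer_vars_eq_iff)
  next
    case False
    then obtain y where y: "y \<in> free \<psi>" "y \<in> set ys" by blast
    have "free \<psi> \<subseteq> set ys" if s: "sat V A (upd \<beta> ys as) \<psi>"
    proof (rule ccontr)
      assume "\<not> free \<psi> \<subseteq> set ys"
      then obtain z where z: "z \<in> free \<psi>" "z \<notin> set ys" by blast
      have "near V A \<rho> (upd \<beta> ys as y) (upd \<beta> ys as z)"
      proof (rule connD[OF _ A _ s y(1) z(1)])
        show "upd \<beta> ys as ` free \<psi> \<subseteq> univ A"
          using \<beta> lf by (intro upd_image_subset[OF as(1)]) (auto simp: lf_def)
      qed (use lf z in \<open>auto simp: lf_def\<close>)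
      moreover have "upd \<beta> ys as z = \<beta> z" using z by (simp add: upd_notin)
      moreover have "near V A 1 (hd as) (upd \<beta> ys as y)"
        using as upd_in[of as ys y] y(2) by (auto simp: tuples_def clique_def)
      ultimately have "near V A (\<rho> + 1) (\<beta> z) (hd as)"
        using near_trans[of V A \<rho> "\<beta> z" _ 1 "hd as"] near_sym by metis
      then show False using far[of z] z lf by (auto simp: lf_def)
    qed
    then show ?thesis using p False ne by (auto simp: far_leaf_def outer_vars_eq_iff outer_vars_Nil_iff split: if_splits)
  qed
qed

end

end

section \<open>Scattered tuples\<close>

text \<open>Fubini for assignments: an assignment to a disjoint union is the pair of its
  restrictions, and each factor looks at one of them.\<close>

lemma sum_PiE_Un:
  fixes h :: "('i \<Rightarrow> 'b) \<Rightarrow> int"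
  assumes "I \<inter> J = {}"
    and h: "\<And>f g. (\<And>x. x \<in> I \<Longrightarrow> f x = g x) \<Longrightarrow> h f = h g"
    and k: "\<And>f g. (\<And>x. x \<in> J \<Longrightarrow> f x = g x) \<Longrightarrow> k f = k g"
  shows "(\<Sum>f\<in>(I \<union> J) \<rightarrow>\<^sub>E U. h f * k f) = (\<Sum>f\<in>I \<rightarrow>\<^sub>E U. h f) * (\<Sum>f\<in>J \<rightarrow>\<^sub>E U. k f)"
proof -
  have "(\<Sum>f\<in>(I \<union> J) \<rightarrow>\<^sub>E U. h f * k f) = (\<Sum>(f, g)\<in>(I \<rightarrow>\<^sub>E U) \<times> (J \<rightarrow>\<^sub>E U). h f * k g)"
  proof (rule sum.reindex_bij_witness[where i = "\<lambda>(f, g) x. if x \<in> I then f x else g x"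
        and j = "\<lambda>f. (restrict f I, restrict f J)"])
    fix f assume f: "f \<in> (I \<union> J) \<rightarrow>\<^sub>E U"
    show "(case (restrict f I, restrict f J) of (f, g) \<Rightarrow> \<lambda>x. if x \<in> I then f x else g x) = f"
      using f by (auto simp: fun_eq_iff PiE_def extensional_def)
    show "(restrict f I, restrict f J) \<in> (I \<rightarrow>\<^sub>E U) \<times> (J \<rightarrow>\<^sub>E U)" using f by auto
    show "(case (restrict f I, restrict f J) of (f, g) \<Rightarrow> h f * k g) = h f * k f"
      using h[of "restrict f I" f] k[of "restrict f J" f] by simp
  next
    fix p assume p: "p \<in> (I \<rightarrow>\<^sub>E U) \<times> (J \<rightarrow>\<^sub>E U)"
    show "(restrict (case p of (f, g) \<Rightarrow> \<lambda>x. if x \<in> I then f x else g x) I,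
       restrict (case p of (f, g) \<Rightarrow> \<lambda>x. if x \<in> I then f x else g x) J) = p"
      using p assms(1) by (auto simp: fun_eq_iff PiE_def extensional_def restrict_def)
    show "(case p of (f, g) \<Rightarrow> \<lambda>x. if x \<in> I then f x else g x) \<in> (I \<union> J) \<rightarrow>\<^sub>E U"
      using p by (auto simp: PiE_def extensional_def)
  qed
  also have "\<dots> = (\<Sum>f\<in>I \<rightarrow>\<^sub>E U. h f) * (\<Sum>f\<in>J \<rightarrow>\<^sub>E U. k f)"
    by (simp add: sum.cartesian_product sum_product)
  finally show ?thesis .
qed

text \<open>Turns a sum over all assignments into a product of sums over single clusters, each of
  which will be the value of one basic cl-term.\<close>

lemma sum_PiE_prod_list:
  fixes h :: "'c \<Rightarrow> ('i \<Rightarrow> 'b) \<Rightarrow> int"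
  assumes "distinct (concat (map v cs))"
    and "\<And>C f g. C \<in> set cs \<Longrightarrow> (\<And>x. x \<in> set (v C) \<Longrightarrow> f x = g x) \<Longrightarrow> h C f = h C g"
  shows "(\<Sum>f\<in>set (concat (map v cs)) \<rightarrow>\<^sub>E U. \<Prod>C\<leftarrow>cs. h C f) = (\<Prod>C\<leftarrow>cs. \<Sum>f\<in>set (v C) \<rightarrow>\<^sub>E U. h C f)"
  using assms
proof (induction cs)
  case (Cons C cs)
  have "(\<Sum>f\<in>set (concat (map v (C # cs))) \<rightarrow>\<^sub>E U. \<Prod>C\<leftarrow>C # cs. h C f)
      = (\<Sum>f\<in>(set (v C) \<union> set (concat (map v cs))) \<rightarrow>\<^sub>E U. h C f * (\<Prod>C\<leftarrow>cs. h C f))"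
    by simp
  also have "\<dots> = (\<Sum>f\<in>set (v C) \<rightarrow>\<^sub>E U. h C f) * (\<Sum>f\<in>set (concat (map v cs)) \<rightarrow>\<^sub>E U. \<Prod>C\<leftarrow>cs. h C f)"
  proof (rule sum_PiE_Un)
    show "set (v C) \<inter> set (concat (map v cs)) = {}" using Cons.prems(1) by auto
    show "h C f = h C g" if "\<And>x. x \<in> set (v C) \<Longrightarrow> f x = g x" for f g
      using Cons.prems(2)[of C f g] that by simp
    show "(\<Prod>C\<leftarrow>cs. h C f) = (\<Prod>C\<leftarrow>cs. h C g)"
      if eq: "\<And>x. x \<in> set (concat (map v cs)) \<Longrightarrow> f x = g x" for f g
    proof (rule arg_cong[of _ _ prod_list], rule map_cong[OF refl])
      fix D assume "D \<in> set cs"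
      then show "h D f = h D g" using Cons.prems(2)[of D f g] eq by auto
    qed
  qed
  also have "(\<Sum>f\<in>set (concat (map v cs)) \<rightarrow>\<^sub>E U. \<Prod>C\<leftarrow>cs. h C f) = (\<Prod>C\<leftarrow>cs. \<Sum>f\<in>set (v C) \<rightarrow>\<^sub>E U. h C f)"
  proof (rule Cons.IH)
    show "distinct (concat (map v cs))" using Cons.prems(1) by simp
    show "h D f = h D g" if "D \<in> set cs" "\<And>x. x \<in> set (v D) \<Longrightarrow> f x = g x" for D f g
      using Cons.prems(2)[of D f g] that by simp
  qed
  finally show ?case by simp
qed simp

section \<open>Clusters of variables and complete graphs\<close>

type_synonym ('s, 'v) cluster = "nat list \<times> ('s, 'v) fm"

definition complete_graph :: "nat \<Rightarrow> nat set set" where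
  "complete_graph k = {{i, j} |i j. i < j \<and> j < k}"

lemma complete_graph_graphs: "complete_graph k \<in> graphs k"
  by (auto simp: complete_graph_def graphs_def card_2_iff)

lemma complete_graph_iff: "i < k \<Longrightarrow> j < k \<Longrightarrow> i \<noteq> j \<Longrightarrow> {i, j} \<in> complete_graph k"
proof (induction i j rule: linorder_wlog)
  case (le i j)
  then show ?case unfolding complete_graph_def using order.strict_iff_order by blast
next
  case (sym i j)
  then show ?case by (simp add: insert_commute)
qed

lemma connected_complete_graph: "k \<ge> 1 \<Longrightarrow> connected_graph k (complete_graph k)"
  unfolding connected_graph_def
proof (intro conjI allI impI)
  fix i j assume "i < k" "j < k"
  then show "(i, j) \<in> {(a, b). {a, b} \<in> complete_graph k}\<^sup>*"
    using complete_graph_iff[of i k j] by (cases "i = j") auto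
qed simp

text \<open>An edge set is no data for the algorithm; with the edge tests of \<open>delta\<close>
  resolved, only lists of variables remain.\<close>

definition complete_delta :: "('s, 'v) vocab \<Rightarrow> nat \<Rightarrow> nat list \<Rightarrow> ('s, 'v) fm" where
  "complete_delta V r ys =
     Conj (concat (map (\<lambda>j. map (\<lambda>i. dist_le_fm V r (ys ! i) (ys ! j)) [0..<j]) [0..<length ys]))"

lemma delta_complete_graph: "delta V (complete_graph (length ys)) r ys = complete_delta V r ys"
proof -
  have "{i, j} \<in> complete_graph (length ys)" if "i < j" "j < length ys" for i j
    using that by (intro complete_graph_iff) auto
  then have "map (\<lambda>i. if {i, j} \<in> complete_graph (length ys) then dist_le_fm V r (ys ! i) (ys ! j)
        else Neg (dist_le_fm V r (ys ! i) (ys ! j))) [0..<j] = map (\<lambda>i. dist_le_fm V r (ys ! i) (ys ! j)) [0..<j]"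
    if "j < length ys" for j using that by simp
  then show ?thesis unfolding delta_def complete_delta_def
    by (intro arg_cong[of _ _ Conj] arg_cong[of _ _ concat] map_cong) auto
qed

primrec scattered :: "('s, 'v) vocab \<Rightarrow> ('a, 'v) wstruct \<Rightarrow> nat \<Rightarrow> 'a list \<Rightarrow> bool" where
  "scattered V A R [] \<longleftrightarrow> True"
| "scattered V A R (a # as) \<longleftrightarrow> (\<forall>b\<in>set as. \<not> near V A R a b) \<and> scattered V A R as"

text \<open>Substitution of \<open>z\<close> for \<open>y\<close> without renaming: the value is
  passed on by an equation. It is used for \<open>z \<noteq> y\<close> and for
  \<open>\<theta>\<close> without further free variables, so nothing is captured.\<close>

definition inst :: "nat \<Rightarrow> ('s, 'v) fm \<Rightarrow> nat \<Rightarrow> ('s, 'v) fm" where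
  "inst y \<theta> z = Ex y (And (Eq y z) \<theta>)"

section \<open>Counting assignments with cl-terms over the integers\<close>

context weighted
begin

lemma ring_V: "ring (alg V Z)"
  using voc ring_Z unfolding vocabulary_def by metis

lemma \<iota>_add [simp]: "\<iota> m \<oplus>\<^bsub>alg V Z\<^esub> \<iota> n = \<iota> (m + n)"
  using iso by (auto simp: ring_iso_def ring_hom_def)

lemma \<iota>_mult [simp]: "\<iota> m \<otimes>\<^bsub>alg V Z\<^esub> \<iota> n = \<iota> (m * n)"
  using iso by (auto simp: ring_iso_def ring_hom_def)

lemma \<iota>_inject [simp]: "\<iota> m = \<iota> n \<longleftrightarrow> m = n"
  using iso by (auto simp: ring_iso_def bij_betw_def inj_on_def)

text \<open>Homomorphisms are only required to preserve sums, products and the unit; the image of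
  \<open>0\<close> is identified as the element that equals its own double.\<close>

lemma \<iota>_0: "\<zero>\<^bsub>alg V Z\<^esub> = \<iota> 0"
proof -
  interpret R: ring "alg V Z" by (rule ring_V)
  have "\<iota> 0 \<oplus>\<^bsub>alg V Z\<^esub> \<iota> 0 = \<iota> 0" by simp
  then show ?thesis using R.add.l_cancel_one[of "\<iota> 0" "\<iota> 0"] by simp
qed

lemma \<iota>_diff [simp]: "\<iota> m \<ominus>\<^bsub>alg V Z\<^esub> \<iota> n = \<iota> (m - n)"
proof -
  interpret R: ring "alg V Z" by (rule ring_V)
  have "\<iota> (m - n) \<oplus>\<^bsub>alg V Z\<^esub> \<iota> n = \<iota> m" by simp
  then show ?thesis using R.add.inv_solve_right[of "\<iota> (m - n)" "\<iota> m" "\<iota> n"] by (simp add: a_minus_def)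
qed

lemma finsum_\<iota>: "finite S \<Longrightarrow> finsum (alg V Z) (\<lambda>f. \<iota> (h f)) S = \<iota> (\<Sum>f\<in>S. h f)"
proof (induction S rule: finite_induct)
  interpret R: ring "alg V Z" by (rule ring_V)
  case empty
  show ?case by (simp add: \<iota>_0)
next
  interpret R: ring "alg V Z" by (rule ring_V)
  case (insert x S)
  then show ?case by (subst R.finsum_insert) auto
qed

text \<open>The product of ones makes every variable of the cluster a summation variable, so the
  term counts satisfying assignments. This is the purpose of the weight symbol
  \<open>w1\<close>.\<close>

definition clus :: "nat \<Rightarrow> ('s, 'v) cluster \<Rightarrow> ('s, 'v) cl" where
  "clus r C = CSum Z (map (\<lambda>y. FWt w1 [y]) (fst C)) (And (snd C) (complete_delta V (2 * r + 1) (fst C)))"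

definition prodcl :: "nat \<Rightarrow> ('s, 'v) cluster list \<Rightarrow> ('s, 'v) cl" where
  "prodcl r cs = foldr (\<lambda>C t. CMul (clus r C) t) cs (CElem Z (\<iota> 1))"

definition polycl :: "nat \<Rightarrow> (bool \<times> ('s, 'v) cluster list) list \<Rightarrow> ('s, 'v) cl" where
  "polycl r ts = foldr (\<lambda>t u. if fst t then CAdd (prodcl r (snd t)) u else CSub u (prodcl r (snd t))) ts (CElem Z (\<iota> 0))"

text \<open>
  A cluster is a formula with its variables that keeps them within a bounded distance.  In a basic
  cl-term of large radius over the complete graph the distance formula is then redundant.
\<close>

definition good_cluster :: "nat \<Rightarrow> nat \<Rightarrow> ('s, 'v) cluster \<Rightarrow> bool" where
  "good_cluster r R C \<longleftrightarrow> fst C \<noteq> [] \<and> free (snd C) \<subseteq> set (fst C) \<and> fow1 V (snd C) \<and> slocal r (snd C) \<and>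
     (\<forall>A\<in>K. \<forall>\<beta>. \<beta> ` set (fst C) \<subseteq> univ A \<longrightarrow> sat V A \<beta> (snd C) \<longrightarrow>
        (\<forall>x\<in>set (fst C). \<forall>y\<in>set (fst C). near V A (R * (length (fst C) - 1)) (\<beta> x) (\<beta> y)))"

lemma good_clusterD:
  "good_cluster r R C \<Longrightarrow> A \<in> K \<Longrightarrow> \<beta> ` set (fst C) \<subseteq> univ A \<Longrightarrow> sat V A \<beta> (snd C) \<Longrightarrow>
    x \<in> set (fst C) \<Longrightarrow> y \<in> set (fst C) \<Longrightarrow> near V A (R * (length (fst C) - 1)) (\<beta> x) (\<beta> y)"
  unfolding good_cluster_def by simp

definition ncl :: "('a, 'v) wstruct \<Rightarrow> ('s, 'v) cluster \<Rightarrow> int" where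
  "ncl A C = (\<Sum>f\<in>set (fst C) \<rightarrow>\<^sub>E univ A. of_bool (sat V A f (snd C)))"

lemma product_vars_clus [simp]: "product_vars (map (\<lambda>y. FWt w1 [y]) ys) = set ys"
  by (auto simp: product_vars_def)

lemma product_val_ones:
  assumes "A \<in> K" "ys \<noteq> []" "\<And>y. y \<in> set ys \<Longrightarrow> \<beta> y \<in> univ A"
  shows "product_val V A \<beta> Z (map (\<lambda>y. FWt w1 [y]) ys) = \<iota> 1"
  using assms(2,3)
proof (induction ys rule: list_nonempty_induct)
  case (single y)
  then show ?case using assms(1) by (auto simp: K structures_with_one_def)
next
  case (cons y ys)
  then have "product_val V A \<beta> Z (map (\<lambda>y. FWt w1 [y]) ys) = \<iota> 1" by simp
  moreover have "wt A w1 [\<beta> y] = \<iota> 1" using cons assms(1) by (auto simp: K structures_with_one_def)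
  ultimately show ?case using cons(1) by (cases ys) auto
qed

text \<open>The diameter bound makes the distance conjuncts true wherever the cluster formula is, so
  a sum of ones over the satisfying assignments remains.\<close>

lemma cl_val_clus:
  assumes C: "good_cluster r0 R C" "distinct (fst C)" and r: "R * (length (fst C) - 1) \<le> 2 * r + 1" and A: "A \<in> K"
  shows "cl_val V A \<beta> Z (clus r C) = \<iota> (ncl A C)"
proof -
  let ?Y = "set (fst C)"
  let ?o = "\<lambda>f. override_on \<beta> f ?Y"
  note ne = univ_nonempty[OF A]
  have sat: "sat V A (?o f) (And (snd C) (complete_delta V (2 * r + 1) (fst C))) \<longleftrightarrow> sat V A f (snd C)"
    if f: "f \<in> ?Y \<rightarrow>\<^sub>E univ A" for f
  proof -
    have "sat V A (?o f) (snd C) \<longleftrightarrow> sat V A f (snd C)"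
      using C by (intro sat_cong) (auto simp: good_cluster_def)
    moreover have "sat V A (?o f) (complete_delta V (2 * r + 1) (fst C))" if s: "sat V A (?o f) (snd C)"
    proof -
      have im: "?o f ` ?Y \<subseteq> univ A" using f by auto
      have "near V A (2 * r + 1) (?o f x) (?o f y)" if "x \<in> ?Y" "y \<in> ?Y" for x y
        using good_clusterD[OF C(1) A im s that] r by (rule near_mono)
      then have "sat V A (?o f) (dl (2 * r + 1) x y)" if "x \<in> ?Y" "y \<in> ?Y" for x y
        using sat_dl[OF A, of "?o f" x y] im that by blast
      then show ?thesis using ne by (simp add: complete_delta_def)
    qed
    ultimately show ?thesis by auto
  qed
  have fin: "finite (?Y \<rightarrow>\<^sub>E univ A)" using finite_univ[OF A] by (intro finite_PiE) auto
  have ones: "product_val V A (?o f) Z (map (\<lambda>y. FWt w1 [y]) (fst C)) = \<iota> 1" if "f \<in> ?Y \<rightarrow>\<^sub>E univ A" for f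
    using that C by (intro product_val_ones[OF A]) (auto simp: good_cluster_def)
  interpret R: ring "alg V Z" by (rule ring_V)
  have "cl_val V A \<beta> Z (clus r C) = finsum (alg V Z) (\<lambda>f. \<iota> 1) {f \<in> ?Y \<rightarrow>\<^sub>E univ A. sat V A f (snd C)}"
    unfolding clus_def cl_val.simps product_vars_clus
    by (rule R.finsum_cong') (use sat ones in auto)
  also have "\<dots> = \<iota> (int (card {f \<in> ?Y \<rightarrow>\<^sub>E univ A. sat V A f (snd C)}))"
    using finsum_\<iota>[OF finite_subset[OF _ fin], of _ "\<lambda>_. 1"] by simp
  also have "int (card {f \<in> ?Y \<rightarrow>\<^sub>E univ A. sat V A f (snd C)}) = ncl A C"
  proof -
    have "{f \<in> ?Y \<rightarrow>\<^sub>E univ A. sat V A f (snd C)} = (?Y \<rightarrow>\<^sub>E univ A) \<inter> {f. sat V A f (snd C)}" by blast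
    then show ?thesis unfolding ncl_def of_bool_def by (simp add: sum.If_cases[OF fin])
  qed
  finally show ?thesis .
qed

lemma clus_cl_term:
  assumes C: "good_cluster r R C" "distinct (fst C)" and "r \<le> r'"
  shows "cl_term V K r' (clus r C) Z"
proof -
  let ?ys = "fst C"
  have "is_product V Z (map (\<lambda>y. FWt w1 [y]) ?ys)"
    using C w1 ring_Z by (auto simp: is_product_def good_cluster_def)
  moreover have "local_around V K r (snd C) (set ?ys)"
    using C by (intro local_aroundI) (auto simp: good_cluster_def)
  moreover have "connected_graph (length ?ys) (complete_graph (length ?ys))"
    using C by (intro connected_complete_graph) (auto simp: good_cluster_def Suc_le_eq)
  moreover have "fow1 V (snd C)" using C by (simp add: good_cluster_def)
  moreover have "product_vars (map (\<lambda>y. FWt w1 [y]) ?ys) \<subseteq> set ?ys" by simp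
  ultimately have "basic_cl V K r (length ?ys) Z (map (\<lambda>y. FWt w1 [y]) ?ys) (And (snd C) (complete_delta V (2 * r + 1) ?ys))"
    unfolding basic_cl_def using C(2) complete_graph_graphs delta_complete_graph[of V ?ys "2 * r + 1"] by metis
  then show ?thesis unfolding clus_def using assms(3) by auto
qed

lemma free_complete_delta: "free (complete_delta V r ys) \<subseteq> set ys"
  by (auto simp: complete_delta_def)

lemma cl_free_clus: "good_cluster r0 R C \<Longrightarrow> cl_free (clus r C) = {}"
  using free_complete_delta[of "2 * r + 1" "fst C"] by (auto simp: clus_def good_cluster_def)

definition good_term :: "nat \<Rightarrow> nat \<Rightarrow> bool \<times> ('s, 'v) cluster list \<Rightarrow> bool" where
  "good_term r R t \<longleftrightarrow> (\<forall>C\<in>set (snd t). good_cluster r R C \<and> R * (length (fst C) - 1) \<le> 2 * r + 1) \<and>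
     distinct (concat (map fst (snd t)))"

definition sgn_of :: "bool \<Rightarrow> int" where
  "sgn_of b = (if b then 1 else - 1)"

lemma distinct_clusters: "distinct (concat (map fst cs)) \<Longrightarrow> C \<in> set cs \<Longrightarrow> distinct (fst C)"
  by (induction cs) auto

lemma good_termD: "good_term r R t \<Longrightarrow>
    \<forall>C\<in>set (snd t). good_cluster r R C \<and> R * (length (fst C) - 1) \<le> 2 * r + 1 \<and> distinct (fst C)"
  unfolding good_term_def using distinct_clusters by blast

lemma prodcl:
  assumes "\<forall>C\<in>set cs. good_cluster r R C \<and> R * (length (fst C) - 1) \<le> 2 * r + 1 \<and> distinct (fst C)" "A \<in> K"
  shows "cl_val V A \<beta> Z (prodcl r cs) = \<iota> (\<Prod>C\<leftarrow>cs. ncl A C)"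
  using assms by (induction cs) (auto simp: prodcl_def cl_val_clus)

lemma prodcl_term:
  assumes "\<forall>C\<in>set cs. good_cluster r R C \<and> distinct (fst C)"
  shows "cl_term V K r (prodcl r cs) Z \<and> cl_free (prodcl r cs) = {}"
  using assms by (induction cs) (auto simp: prodcl_def clus_cl_term cl_free_clus ring_Z)

lemma polycl:
  assumes "\<forall>t\<in>set ts. good_term r R t" "A \<in> K"
  shows "cl_val V A \<beta> Z (polycl r ts) = \<iota> (\<Sum>t\<leftarrow>ts. sgn_of (fst t) * (\<Prod>C\<leftarrow>snd t. ncl A C))"
  using assms(1)
proof (induction ts)
  case (Cons t ts)
  have "cl_val V A \<beta> Z (prodcl r (snd t)) = \<iota> (\<Prod>C\<leftarrow>snd t. ncl A C)"
    by (rule prodcl[OF good_termD[of r R] assms(2)]) (use Cons.prems in simp)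
  then show ?case using Cons by (auto simp: polycl_def sgn_of_def)
qed (simp add: polycl_def)

lemma polycl_term:
  assumes "\<forall>t\<in>set ts. good_term r R t"
  shows "cl_term V K r (polycl r ts) Z \<and> cl_free (polycl r ts) = {}"
proof -
  have "cl_term V K r (prodcl r (snd t)) Z \<and> cl_free (prodcl r (snd t)) = {}" if "t \<in> set ts" for t
    using prodcl_term good_termD assms that by blast
  then show ?thesis by (induction ts) (auto simp: polycl_def)
qed

end

lemma prod_list_far:
  "(\<Prod>C\<leftarrow>cs. 1 - of_bool (P C)) = (of_bool (\<forall>C\<in>set cs. \<not> P C) :: int)"
  by (induction cs) auto

lemma prod_list_mult: "(\<Prod>C\<leftarrow>cs. f C * g C) = (\<Prod>C\<leftarrow>cs. f C) * (\<Prod>C\<leftarrow>cs. g C :: int)"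
  by (induction cs) (auto simp: algebra_simps)

lemma sum_list_sum_swap: "(\<Sum>t\<leftarrow>ts. \<Sum>f\<in>S. h t f) = (\<Sum>f\<in>S. \<Sum>t\<leftarrow>ts. (h t f :: int))"
  by (induction ts) (auto simp: sum.distrib)

lemma sum_list_concat_map:
  "(\<Sum>x\<leftarrow>concat (map (\<lambda>t. map (g t) (h t)) ts). f x) = (\<Sum>t\<leftarrow>ts. \<Sum>u\<leftarrow>h t. (f (g t u) :: int))"
  by (induction ts) (auto simp: o_def)

section \<open>Expansion of the indicator of scattered tuples\<close>

context weighted
begin

text \<open>Here \<open>m\<close> is the cluster of the new variable \<open>z\<close>; joining
  demands one link of length at most \<open>R\<close> from \<open>z\<close> into
  \<open>C\<close>.\<close>

definition join :: "nat \<Rightarrow> nat \<Rightarrow> ('s, 'v) cluster \<Rightarrow> ('s, 'v) cluster \<Rightarrow> ('s, 'v) cluster" where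
  "join R z C m = (fst C @ fst m, And (And (snd C) (Disj (map (dl R z) (fst C)))) (snd m))"

text \<open>
  \<open>expand\<close> multiplies out the indicator \<open>\<Prod> (1 - [z\<^sub>i near z\<^sub>j])\<close> of scattered tuples into a signed sum of
  products over clusters with disjoint variables.  For a new variable \<open>z\<close>, being far from a cluster is
  \<open>1\<close> minus being near it, so \<open>subs\<close> chooses the clusters that are joined with \<open>z\<close>.
\<close>

primrec subs :: "nat \<Rightarrow> nat \<Rightarrow> ('s, 'v) fm \<Rightarrow> ('s, 'v) cluster list \<Rightarrow>
    (bool \<times> ('s, 'v) cluster list \<times> ('s, 'v) cluster) list" where
  "subs R z \<eta> [] = [(True, [], ([z], \<eta>))]"
| "subs R z \<eta> (C # cs) = concat (map (\<lambda>t. [(fst t, C # fst (snd t), snd (snd t)),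
     (\<not> fst t, fst (snd t), join R z C (snd (snd t)))]) (subs R z \<eta> cs))"

primrec expand :: "nat \<Rightarrow> nat \<Rightarrow> ('s, 'v) fm \<Rightarrow> nat list \<Rightarrow> (bool \<times> ('s, 'v) cluster list) list" where
  "expand R y \<theta> [] = [(True, [])]"
| "expand R y \<theta> (z # zs) = concat (map (\<lambda>t. map (\<lambda>u. (fst u = fst t, snd (snd u) # fst (snd u)))
     (subs R z (inst y \<theta> z) (snd t))) (expand R y \<theta> zs))"

definition scat_bc :: "nat \<Rightarrow> nat \<Rightarrow> nat \<Rightarrow> ('s, 'v) fm \<Rightarrow> nat list \<Rightarrow> ('s, 'v) bc" where
  "scat_bc \<rho> R y \<theta> zs = Ge1 (polycl (\<rho> + R * length zs) (expand R y \<theta> zs))"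

text \<open>For clusters with \<open>c + 1\<close> and \<open>k + 1\<close> variables, the diameters
  \<open>R * c\<close> and \<open>R * k\<close> and the link of length \<open>R\<close> add up to
  \<open>R * (c + k + 1)\<close>, the bound for \<open>c + k + 2\<close> variables.\<close>

lemma good_cluster_join:
  assumes C: "good_cluster r R C" and m: "good_cluster r R m" and z: "z \<in> set (fst m)" and r: "R \<le> r"
  shows "good_cluster r R (join R z C m)"
  unfolding good_cluster_def
proof (intro conjI ballI allI impI)
  show "fst (join R z C m) \<noteq> []" using C by (simp add: good_cluster_def join_def)
  show "free (snd (join R z C m)) \<subseteq> set (fst (join R z C m))"
    using C m z by (auto simp: good_cluster_def join_def)
  show "fow1 V (snd (join R z C m))" using C m by (auto simp: good_cluster_def join_def)
  have "slocal r (Disj (map (dl R z) (fst C)))" using r by (intro slocal_Disj) (auto intro: slocal_dl)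
  then show "slocal r (snd (join R z C m))" using C m by (auto simp: good_cluster_def join_def)
  fix A \<beta> x y
  assume A: "A \<in> K" and \<beta>: "\<beta> ` set (fst (join R z C m)) \<subseteq> univ A" and s: "sat V A \<beta> (snd (join R z C m))"
    and xy: "x \<in> set (fst (join R z C m))" "y \<in> set (fst (join R z C m))"
  have \<beta>': "\<beta> ` set (fst C) \<subseteq> univ A" "\<beta> ` set (fst m) \<subseteq> univ A" using \<beta> by (auto simp: join_def)
  have s': "sat V A \<beta> (snd C)" "sat V A \<beta> (snd m)" using s by (auto simp: join_def)
  obtain c k where ck: "length (fst C) = Suc c" "length (fst m) = Suc k"
    using C m unfolding good_cluster_def by (metis length_0_conv not0_implies_Suc)
  have len: "R * (length (fst (join R z C m)) - 1) = R * c + R + R * k"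
    using ck by (simp add: join_def algebra_simps)
  obtain v where v: "v \<in> set (fst C)" "near V A R (\<beta> z) (\<beta> v)"
  proof -
    have "\<exists>v\<in>set (fst C). sat V A \<beta> (dl R z v)" using s univ_nonempty[OF A] by (auto simp: join_def)
    then show ?thesis using sat_dl[OF A, of \<beta> z] \<beta>' z that by blast
  qed
  have CC: "near V A (R * c) (\<beta> u) (\<beta> w)" if "u \<in> set (fst C)" "w \<in> set (fst C)" for u w
    using good_clusterD[OF C A \<beta>'(1) s'(1) that] ck by simp
  have mm: "near V A (R * k) (\<beta> u) (\<beta> w)" if "u \<in> set (fst m)" "w \<in> set (fst m)" for u w
    using good_clusterD[OF m A \<beta>'(2) s'(2) that] ck by simp
  have Cm: "near V A (R * c + R + R * k) (\<beta> u) (\<beta> w)" if "u \<in> set (fst C)" "w \<in> set (fst m)" for u w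
    by (rule near_trans[OF near_trans[OF CC[OF that(1) v(1)] near_sym[OF v(2)]] mm[OF z that(2)]])
  show "near V A (R * (length (fst (join R z C m)) - 1)) (\<beta> x) (\<beta> y)"
  proof -
    consider "x \<in> set (fst C)" "y \<in> set (fst C)" | "x \<in> set (fst m)" "y \<in> set (fst m)"
      | "x \<in> set (fst C)" "y \<in> set (fst m)" | "x \<in> set (fst m)" "y \<in> set (fst C)"
      using xy by (auto simp: join_def)
    then show ?thesis unfolding len
      by cases (use near_mono[OF CC] near_mono[OF mm] Cm near_sym[OF Cm] in auto)
  qed
qed

text \<open>Multisets record that each variable is used exactly once, so disjointness of the
  clusters will follow from distinctness of the variables.\<close>

lemma subs_props:
  assumes "\<forall>C\<in>set cs. good_cluster r R C" "fow1 V \<eta>" "free \<eta> = {z}" "slocal r \<eta>" "R \<le> r"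
    and "u \<in> set (subs R z \<eta> cs)"
  shows "set (fst (snd u)) \<subseteq> set cs \<and> good_cluster r R (snd (snd u)) \<and> z \<in> set (fst (snd (snd u))) \<and>
     mset (fst (snd (snd u)) @ concat (map fst (fst (snd u)))) = add_mset z (mset (concat (map fst cs)))"
  using assms(1,6)
proof (induction cs arbitrary: u)
  case Nil
  then show ?case using assms(2-4) by (auto simp: good_cluster_def)
next
  case (Cons C cs)
  then obtain t where t: "t \<in> set (subs R z \<eta> cs)"
    "u = (fst t, C # fst (snd t), snd (snd t)) \<or> u = (\<not> fst t, fst (snd t), join R z C (snd (snd t)))"
    by auto
  have IH: "set (fst (snd t)) \<subseteq> set cs \<and> good_cluster r R (snd (snd t)) \<and> z \<in> set (fst (snd (snd t))) \<and>
     mset (fst (snd (snd t)) @ concat (map fst (fst (snd t)))) = add_mset z (mset (concat (map fst cs)))"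
    using Cons.prems t(1) by (intro Cons.IH) auto
  have C: "good_cluster r R C" using Cons.prems by simp
  have J: "good_cluster r R (join R z C (snd (snd t)))"
    using good_cluster_join[OF C _ _ assms(5)] IH by blast
  show ?case using t(2)
  proof
    assume u: "u = (fst t, C # fst (snd t), snd (snd t))"
    show ?thesis using IH by (auto simp: u)
  next
    assume u: "u = (\<not> fst t, fst (snd t), join R z C (snd (snd t)))"
    show ?thesis using IH J by (auto simp: u join_def)
  qed
qed

definition ind :: "('a, 'v) wstruct \<Rightarrow> (nat \<Rightarrow> 'a) \<Rightarrow> ('s, 'v) cluster \<Rightarrow> int" where
  "ind A \<beta> C = of_bool (sat V A \<beta> (snd C))"

text \<open>By induction on the clusters: keeping \<open>C\<close> apart contributes its indicator,
  joining it subtracts that indicator times nearness to \<open>z\<close>, and together they produce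
  one factor of the product.\<close>

lemma subs_val:
  "(\<Sum>u\<leftarrow>subs R z \<eta> cs. sgn_of (fst u) * ((\<Prod>C\<leftarrow>fst (snd u). ind A \<beta> C) * ind A \<beta> (snd (snd u)))) =
     of_bool (sat V A \<beta> \<eta>) * (\<Prod>C\<leftarrow>cs. ind A \<beta> C * (1 - of_bool (sat V A \<beta> (Disj (map (dl R z) (fst C))))))"
proof (induction cs)
  case Nil
  then show ?case by (simp add: sgn_of_def ind_def)
next
  case (Cons C cs)
  let ?n = "of_bool (sat V A \<beta> (Disj (map (dl R z) (fst C)))) :: int"
  let ?v = "\<lambda>u. sgn_of (fst u) * ((\<Prod>C\<leftarrow>fst (snd u). ind A \<beta> C) * ind A \<beta> (snd (snd u)))"
  have "(\<Sum>u\<leftarrow>subs R z \<eta> (C # cs). ?v u) = (\<Sum>t\<leftarrow>subs R z \<eta> cs. (ind A \<beta> C * (1 - ?n)) * ?v t)"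
  proof -
    have *: "?v (fst t, C # fst (snd t), snd (snd t)) + ?v (\<not> fst t, fst (snd t), join R z C (snd (snd t)))
        = (ind A \<beta> C * (1 - ?n)) * ?v t" for t
      by (auto simp: ind_def join_def sgn_of_def of_bool_def)
    have "(\<Sum>u\<leftarrow>concat (map (\<lambda>t. [(fst t, C # fst (snd t), snd (snd t)),
        (\<not> fst t, fst (snd t), join R z C (snd (snd t)))]) ts). ?v u) = (\<Sum>t\<leftarrow>ts. (ind A \<beta> C * (1 - ?n)) * ?v t)" for ts
    proof (induction ts)
      case (Cons t ts)
      then show ?case using *[of t] by simp
    qed simp
    then show ?thesis by simp
  qed
  also have "\<dots> = (ind A \<beta> C * (1 - ?n)) * (\<Sum>t\<leftarrow>subs R z \<eta> cs. ?v t)"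
    by (rule sum_list_const_mult)
  finally show ?case unfolding Cons.IH by simp
qed

section \<open>Counting scattered tuples\<close>

context
  fixes R \<rho> y :: nat and \<theta>
  assumes \<theta>: "fow1 V \<theta>" "free \<theta> \<subseteq> {y}" "slocal \<rho> \<theta>"
begin

lemma free_inst: "z \<noteq> y \<Longrightarrow> free (inst y \<theta> z) = {z}"
  using \<theta> by (auto simp: inst_def)

lemma fow1_inst: "fow1 V (inst y \<theta> z)"
  using \<theta> by (auto simp: inst_def)

text \<open>As \<open>\<theta>\<close> has no free variable besides \<open>y\<close>, its truth
  depends on one element, which a constant assignment represents.\<close>

lemma sat_inst_gen:
  assumes "z \<noteq> y" "\<beta> z \<in> univ A"
  shows "sat V A \<beta> (inst y \<theta> z) \<longleftrightarrow> sat V A (\<lambda>_. \<beta> z) \<theta>"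
proof -
  have "sat V A (\<beta>(y := \<beta> z)) \<theta> \<longleftrightarrow> sat V A (\<lambda>_. \<beta> z) \<theta>"
    using \<theta>(2) by (intro sat_cong) auto
  then show ?thesis using assms by (auto simp: inst_def)
qed

lemma slocal_inst: "z \<noteq> y \<Longrightarrow> slocal \<rho> (inst y \<theta> z)"
  unfolding slocal_def
proof (intro ballI allI impI)
  fix A \<beta> X
  assume z: "z \<noteq> y" and A: "A \<in> K" "\<beta> ` free (inst y \<theta> z) \<subseteq> univ A" "X \<subseteq> univ A" "X \<noteq> {}"
    "ball V A \<rho> (\<beta> ` free (inst y \<theta> z)) \<subseteq> X"
  have zX: "\<beta> z \<in> X" using subset_ball[OF A(2), of V \<rho>] A(5) free_inst[OF z] by auto
  have "sat V (induced A X) (\<lambda>_. \<beta> z) \<theta> = sat V A (\<lambda>_. \<beta> z) \<theta>"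
    by (rule slocal_sub[OF \<theta>(3) A(1) \<theta>(2) order_refl _ A(3,4)]) (use A free_inst[OF z] in auto)
  moreover have "\<beta> z \<in> univ A" using zX A(3) by blast
  ultimately show "sat V (induced A X) \<beta> (inst y \<theta> z) = sat V A \<beta> (inst y \<theta> z)"
    using sat_inst_gen[OF z, of \<beta> "induced A X"] sat_inst_gen[OF z, of \<beta> A] zX by simp
qed

lemma expand_props:
  assumes "distinct zs" "y \<notin> set zs" "\<rho> + R * length zs \<le> r" "t \<in> set (expand R y \<theta> zs)"
  shows "(\<forall>C\<in>set (snd t). good_cluster r R C) \<and> mset (concat (map fst (snd t))) = mset zs"
  using assms
proof (induction zs arbitrary: t)
  case (Cons z zs)
  then obtain s u where su: "s \<in> set (expand R y \<theta> zs)" "u \<in> set (subs R z (inst y \<theta> z) (snd s))"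
    "t = (fst u = fst s, snd (snd u) # fst (snd u))" by auto
  have IH: "(\<forall>C\<in>set (snd s). good_cluster r R C) \<and> mset (concat (map fst (snd s))) = mset zs"
    using Cons.prems su by (intro Cons.IH) auto
  have z: "z \<noteq> y" using Cons.prems by auto
  have "set (fst (snd u)) \<subseteq> set (snd s) \<and> good_cluster r R (snd (snd u)) \<and> z \<in> set (fst (snd (snd u))) \<and>
     mset (fst (snd (snd u)) @ concat (map fst (fst (snd u)))) = add_mset z (mset (concat (map fst (snd s))))"
    by (rule subs_props[OF _ fow1_inst free_inst[OF z] slocal_mono[OF slocal_inst[OF z]] _ su(2)])
      (use IH Cons.prems in auto)
  then show ?case using IH su(3) by auto
qed simp

text \<open>No cluster has more variables than \<open>zs\<close>, so \<open>R * length zs\<close>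
  bounds all diameters that arise.\<close>

lemma expand_good_term:
  assumes "distinct zs" "y \<notin> set zs" "\<rho> + R * length zs \<le> r" "t \<in> set (expand R y \<theta> zs)"
  shows "good_term r R t"
proof -
  have p: "\<forall>C\<in>set (snd t). good_cluster r R C" "mset (concat (map fst (snd t))) = mset zs"
    using expand_props[OF assms] by auto
  have "length (fst C) \<le> length zs" if "C \<in> set (snd t)" for C
  proof -
    have "length (fst C) \<le> sum_list (map (length \<circ> fst) (snd t))"
      using that by (intro member_le_sum_list) auto
    also have "\<dots> = length (concat (map fst (snd t)))" by (simp add: length_concat)
    also have "\<dots> = length zs" using p(2) by (metis size_mset)
    finally show ?thesis .
  qed
  then have "R * (length (fst C) - 1) \<le> 2 * r + 1" if "C \<in> set (snd t)" for C
  proof -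
    have "R * (length (fst C) - 1) \<le> R * length zs"
      using \<open>\<And>C. C \<in> set (snd t) \<Longrightarrow> length (fst C) \<le> length zs\<close>[OF that] by (intro mult_le_mono2) simp
    then show ?thesis using assms(3) by linarith
  qed
  moreover have "distinct (concat (map fst (snd t)))"
    using p(2) assms(1) by (metis mset_eq_imp_distinct_iff)
  ultimately show ?thesis using p(1) by (simp add: good_term_def)
qed

text \<open>Scatteredness of \<open>z # zs\<close> factors into that of \<open>zs\<close> and
  distance of \<open>z\<close> from each variable in \<open>zs\<close>; the clusters of each term
  partition \<open>zs\<close>, so distance from all clusters expresses the latter.\<close>

lemma expand_val:
  assumes "distinct zs" "y \<notin> set zs" "A \<in> K" "\<beta> ` set zs \<subseteq> univ A"
  shows "(\<Sum>t\<leftarrow>expand R y \<theta> zs. sgn_of (fst t) * (\<Prod>C\<leftarrow>snd t. ind A \<beta> C)) =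
    of_bool ((\<forall>z\<in>set zs. sat V A (\<lambda>_. \<beta> z) \<theta>) \<and> scattered V A R (map \<beta> zs))"
  using assms
proof (induction zs)
  case (Cons z zs)
  let ?v = "\<lambda>t. sgn_of (fst t) * (\<Prod>C\<leftarrow>snd t. ind A \<beta> C)"
  let ?w = "\<lambda>u. sgn_of (fst u) * ((\<Prod>C\<leftarrow>fst (snd u). ind A \<beta> C) * ind A \<beta> (snd (snd u)))"
  let ?far = "of_bool (\<forall>z'\<in>set zs. \<not> near V A R (\<beta> z) (\<beta> z')) :: int"
  let ?\<eta> = "inst y \<theta> z"
  have z: "z \<noteq> y" "\<beta> z \<in> univ A" using Cons.prems by auto
  have inner: "(\<Sum>u\<leftarrow>subs R z ?\<eta> (snd t). ?v (fst u = fst t, snd (snd u) # fst (snd u))) =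
      of_bool (sat V A (\<lambda>_. \<beta> z) \<theta>) * ?far * ?v t" if t: "t \<in> set (expand R y \<theta> zs)" for t
  proof -
    \<comment> \<open>Equality of the Boolean signs encodes the product of the signs.\<close>
    have "?v (fst u = fst t, snd (snd u) # fst (snd u)) = sgn_of (fst t) * ?w u" for u
      by (auto simp: sgn_of_def)
    then have "(\<Sum>u\<leftarrow>subs R z ?\<eta> (snd t). ?v (fst u = fst t, snd (snd u) # fst (snd u))) =
        sgn_of (fst t) * (\<Sum>u\<leftarrow>subs R z ?\<eta> (snd t). ?w u)"
      by (simp only: sum_list_const_mult)
    also have "(\<Sum>u\<leftarrow>subs R z ?\<eta> (snd t). ?w u) = of_bool (sat V A \<beta> ?\<eta>) *
        ((\<Prod>C\<leftarrow>snd t. ind A \<beta> C) * (\<Prod>C\<leftarrow>snd t. 1 - of_bool (sat V A \<beta> (Disj (map (dl R z) (fst C))))))"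
      unfolding subs_val prod_list_mult ..
    also have "(\<Prod>C\<leftarrow>snd t. 1 - of_bool (sat V A \<beta> (Disj (map (dl R z) (fst C))))) = ?far"
    proof -
      have "set (concat (map fst (snd t))) = set zs"
        using expand_props[OF _ _ order_refl t] Cons.prems by (metis distinct.simps(2) list.set_intros(2) mset_eq_setD)
      then have zs: "set zs = (\<Union>C\<in>set (snd t). set (fst C))" by simp
      have "sat V A \<beta> (dl R z z') \<longleftrightarrow> near V A R (\<beta> z) (\<beta> z')" if "z' \<in> set zs" for z'
        using sat_dl[OF Cons.prems(3), of \<beta> z z' R] Cons.prems(4) that by auto
      then have "(\<forall>C\<in>set (snd t). \<not> sat V A \<beta> (Disj (map (dl R z) (fst C)))) \<longleftrightarrow>
          (\<forall>z'\<in>set zs. \<not> near V A R (\<beta> z) (\<beta> z'))"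
        unfolding zs by (auto simp: univ_nonempty[OF Cons.prems(3)])
      then show ?thesis unfolding prod_list_far by simp
    qed
    also have "sat V A \<beta> ?\<eta> = sat V A (\<lambda>_. \<beta> z) \<theta>" using sat_inst_gen z by blast
    finally show ?thesis by (simp only: mult_ac)
  qed
  have "(\<Sum>t\<leftarrow>expand R y \<theta> (z # zs). ?v t) =
      (\<Sum>t\<leftarrow>expand R y \<theta> zs. \<Sum>u\<leftarrow>subs R z ?\<eta> (snd t). ?v (fst u = fst t, snd (snd u) # fst (snd u)))"
    unfolding expand.simps by (rule sum_list_concat_map)
  also have "\<dots> = (\<Sum>t\<leftarrow>expand R y \<theta> zs. of_bool (sat V A (\<lambda>_. \<beta> z) \<theta>) * ?far * ?v t)"
    by (rule arg_cong[of _ _ sum_list], rule map_cong[OF refl inner])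
  also have "\<dots> = of_bool (sat V A (\<lambda>_. \<beta> z) \<theta>) * ?far * (\<Sum>t\<leftarrow>expand R y \<theta> zs. ?v t)"
    by (rule sum_list_const_mult)
  also have "(\<Sum>t\<leftarrow>expand R y \<theta> zs. ?v t) =
      of_bool ((\<forall>z\<in>set zs. sat V A (\<lambda>_. \<beta> z) \<theta>) \<and> scattered V A R (map \<beta> zs))"
    using Cons.prems by (intro Cons.IH) auto
  finally show ?case by auto
qed (simp add: sgn_of_def)

lemma ok_scat_bc:
  assumes "distinct zs" "y \<notin> set zs"
  shows "ok X (\<rho> + R * length zs) (scat_bc \<rho> R y \<theta> zs)"
  using polycl_term[of "expand R y \<theta> zs" "\<rho> + R * length zs" R] expand_good_term[OF assms order_refl]
  by (simp add: scat_bc_def)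

text \<open>The polynomial counts scattered tuples of elements satisfying \<open>\<theta>\<close>:
  each product of cluster counts is a sum over all assignments to \<open>zs\<close>, and exchanging
  the two sums leaves the indicator from \<open>expand_val\<close>.\<close>

lemma bsat_scat_bc:
  assumes zs: "distinct zs" "y \<notin> set zs" and A: "A \<in> K"
  shows "bsat A \<beta> (scat_bc \<rho> R y \<theta> zs) \<longleftrightarrow>
    (\<exists>as\<in>tuples (length zs) (univ A). (\<forall>a\<in>set as. sat V A (\<lambda>_. a) \<theta>) \<and> scattered V A R as)"
proof -
  let ?r = "\<rho> + R * length zs"
  let ?P = "\<lambda>as. (\<forall>a\<in>set as. sat V A (\<lambda>_. a) \<theta>) \<and> scattered V A R as"
  have fin: "finite (set zs \<rightarrow>\<^sub>E univ A)" using finite_univ[OF A] by (intro finite_PiE) auto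
  have good: "\<forall>t\<in>set (expand R y \<theta> zs). good_term ?r R t"
    using expand_good_term[OF zs order_refl] by blast
  have prod: "(\<Prod>C\<leftarrow>snd t. ncl A C) = (\<Sum>f\<in>set zs \<rightarrow>\<^sub>E univ A. \<Prod>C\<leftarrow>snd t. ind A f C)"
    if t: "t \<in> set (expand R y \<theta> zs)" for t
  proof -
    have p: "\<forall>C\<in>set (snd t). good_cluster ?r R C" "set (concat (map fst (snd t))) = set zs"
      using expand_props[OF zs order_refl t] mset_eq_setD by blast+
    have d: "distinct (concat (map fst (snd t)))" using good t by (auto simp: good_term_def)
    have "(\<Sum>f\<in>set (concat (map fst (snd t))) \<rightarrow>\<^sub>E univ A. \<Prod>C\<leftarrow>snd t. ind A f C) =
        (\<Prod>C\<leftarrow>snd t. \<Sum>f\<in>set (fst C) \<rightarrow>\<^sub>E univ A. ind A f C)"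
    proof (rule sum_PiE_prod_list[OF d])
      fix C and f g :: "nat \<Rightarrow> 'a"
      assume "C \<in> set (snd t)" "\<And>x. x \<in> set (fst C) \<Longrightarrow> f x = g x"
      moreover have "free (snd C) \<subseteq> set (fst C)"
        using p(1) \<open>C \<in> set (snd t)\<close> by (simp add: good_cluster_def)
      ultimately have "sat V A f (snd C) = sat V A g (snd C)" by (intro sat_cong) blast
      then show "ind A f C = ind A g C" by (simp add: ind_def)
    qed
    then show ?thesis unfolding p(2) by (simp add: ncl_def ind_def)
  qed
  have "(\<Sum>t\<leftarrow>expand R y \<theta> zs. sgn_of (fst t) * (\<Prod>C\<leftarrow>snd t. ncl A C)) =
      (\<Sum>t\<leftarrow>expand R y \<theta> zs. \<Sum>f\<in>set zs \<rightarrow>\<^sub>E univ A. sgn_of (fst t) * (\<Prod>C\<leftarrow>snd t. ind A f C))"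
    by (rule arg_cong[of _ _ sum_list], rule map_cong[OF refl]) (simp add: prod sum_distrib_left)
  also have "\<dots> = (\<Sum>f\<in>set zs \<rightarrow>\<^sub>E univ A. \<Sum>t\<leftarrow>expand R y \<theta> zs. sgn_of (fst t) * (\<Prod>C\<leftarrow>snd t. ind A f C))"
    by (rule sum_list_sum_swap)
  also have "\<dots> = (\<Sum>f\<in>set zs \<rightarrow>\<^sub>E univ A. of_bool (?P (map f zs)))"
  proof (rule sum.cong[OF refl])
    fix f assume "f \<in> set zs \<rightarrow>\<^sub>E univ A"
    then have "f ` set zs \<subseteq> univ A" by auto
    then show "(\<Sum>t\<leftarrow>expand R y \<theta> zs. sgn_of (fst t) * (\<Prod>C\<leftarrow>snd t. ind A f C)) = of_bool (?P (map f zs))"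
      using expand_val[OF zs A] by simp
  qed
  also have "\<dots> \<ge> 1 \<longleftrightarrow> (\<exists>f\<in>set zs \<rightarrow>\<^sub>E univ A. ?P (map f zs))"
  proof
    assume "(\<Sum>f\<in>set zs \<rightarrow>\<^sub>E univ A. of_bool (?P (map f zs))) \<ge> (1::int)"
    then have "(\<Sum>f\<in>set zs \<rightarrow>\<^sub>E univ A. of_bool (?P (map f zs))) \<noteq> (0::int)" by linarith
    then obtain f where "f \<in> set zs \<rightarrow>\<^sub>E univ A" "of_bool (?P (map f zs)) \<noteq> (0::int)"
      by (rule sum.not_neutral_contains_not_neutral)
    then show "\<exists>f\<in>set zs \<rightarrow>\<^sub>E univ A. ?P (map f zs)" by (auto split: if_splits)
  next
    assume "\<exists>f\<in>set zs \<rightarrow>\<^sub>E univ A. ?P (map f zs)"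
    then obtain f where f: "f \<in> set zs \<rightarrow>\<^sub>E univ A" "?P (map f zs)" by blast
    have "(1::int) = of_bool (?P (map f zs))" using f(2) by simp
    also have "\<dots> \<le> (\<Sum>f\<in>set zs \<rightarrow>\<^sub>E univ A. of_bool (?P (map f zs)))"
      by (rule member_le_sum[OF f(1) _ fin]) simp
    finally show "(\<Sum>f\<in>set zs \<rightarrow>\<^sub>E univ A. of_bool (?P (map f zs))) \<ge> (1::int)" .
  qed
  also have "(\<exists>f\<in>set zs \<rightarrow>\<^sub>E univ A. ?P (map f zs)) \<longleftrightarrow> (\<exists>as\<in>tuples (length zs) (univ A). ?P as)"
  proof
    assume "\<exists>f\<in>set zs \<rightarrow>\<^sub>E univ A. ?P (map f zs)"
    then obtain f where f: "f \<in> set zs \<rightarrow>\<^sub>E univ A" "?P (map f zs)" by blast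
    then have "map f zs \<in> tuples (length zs) (univ A)" by (auto simp: tuples_def)
    then show "\<exists>as\<in>tuples (length zs) (univ A). ?P as" using f(2) by blast
  next
    assume "\<exists>as\<in>tuples (length zs) (univ A). ?P as"
    then obtain as where as: "as \<in> tuples (length zs) (univ A)" "?P as" by blast
    then have l: "length as = length zs" "set as \<subseteq> univ A" by (auto simp: tuples_def)
    let ?f = "restrict (upd undefined zs as) (set zs)"
    have "map ?f zs = as" using map_upd[OF l(1) zs(1)] by (metis (no_types, lifting) map_eq_conv restrict_apply)
    moreover have "?f \<in> set zs \<rightarrow>\<^sub>E univ A" using l upd_in[OF l(1)] by auto
    ultimately show "\<exists>f\<in>set zs \<rightarrow>\<^sub>E univ A. ?P (map f zs)" using as(2) by metis
  qed
  finally have "(\<Sum>t\<leftarrow>expand R y \<theta> zs. sgn_of (fst t) * (\<Prod>C\<leftarrow>snd t. ncl A C)) \<ge> 1 \<longleftrightarrow>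
      (\<exists>as\<in>tuples (length zs) (univ A). ?P as)" .
  moreover have "bsat A \<beta> (scat_bc \<rho> R y \<theta> zs) \<longleftrightarrow>
      (\<Sum>t\<leftarrow>expand R y \<theta> zs. sgn_of (fst t) * (\<Prod>C\<leftarrow>snd t. ncl A C)) \<ge> 1"
    unfolding scat_bc_def bc_sat.simps polycl[OF good A] by simp
  ultimately show ?thesis by blast
qed

end


section \<open>Existential quantifiers\<close>

text \<open>The radius travels with the combination, so that the quantifier can be folded over a
  list of variables.\<close>

definition exq :: "nat list \<Rightarrow> nat \<Rightarrow> nat \<Rightarrow> ('s, 'v) bc \<times> nat \<Rightarrow> ('s, 'v) bc \<times> nat" where
  "exq X d z p = (BDisj (map (\<lambda>x. near_bc (Ex z) (snd p) d x [z] (fst p)) X), 2 * (d + snd p + 1))"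

lemma ok_exq:
  assumes "ok Y (snd p) (fst p)" "z \<notin> set X"
  shows "ok (set X \<union> (Y - {z})) (snd (exq X d z p)) (fst (exq X d z p))"
proof -
  have "ok (set X \<union> (Y - {z})) (2 * (d + snd p + 1)) (near_bc (Ex z) (snd p) d x [z] (fst p))" if x: "x \<in> set X" for x
    by (rule ok_mono[OF ok_near_bc[OF quantifier_Ex _ assms(1)]]) (use x assms(2) in auto)
  then show ?thesis by (simp add: exq_def)
qed

lemma bsat_exq:
  assumes ok: "ok Y (snd p) (fst p)" and z: "z \<notin> set X" and A: "A \<in> K" and \<beta>: "\<beta> ` (set X \<union> (Y - {z})) \<subseteq> univ A"
  shows "bsat A \<beta> (fst (exq X d z p)) \<longleftrightarrow>
    (\<exists>a\<in>univ A. (\<exists>x\<in>set X. near V A d (\<beta> x) a) \<and> bsat A (\<beta>(z := a)) (fst p))"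
proof -
  have "bsat A \<beta> (near_bc (Ex z) (snd p) d x [z] (fst p)) \<longleftrightarrow>
      (\<exists>a\<in>univ A. near V A d (\<beta> x) a \<and> bsat A (\<beta>(z := a)) (fst p))" if x: "x \<in> set X" for x
  proof -
    have "bsat A \<beta> (near_bc (Ex z) (snd p) d x [z] (fst p)) \<longleftrightarrow>
        {as \<in> tuples (length [z]) (univ A). tnear A d (\<beta> x) as \<and> bsat A (upd \<beta> [z] as) (fst p)} \<noteq> {}"
      by (rule bsat_near_bc[OF quantifier_Ex _ ok A]) (use x z \<beta> in auto)
    also have "{as \<in> tuples (length [z]) (univ A). tnear A d (\<beta> x) as \<and> bsat A (upd \<beta> [z] as) (fst p)} =
        (\<lambda>a. [a]) ` {a \<in> univ A. near V A d (\<beta> x) a \<and> bsat A (\<beta>(z := a)) (fst p)}"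
      by (auto simp: tuples_def length_Suc_conv tnear_def clique_def upd_Cons)
    finally show ?thesis by auto
  qed
  then show ?thesis unfolding exq_def by (auto simp: image_iff)
qed

text \<open>The variables in \<open>X\<close> are disjoint from the eliminated ones, so nearness is
  measured to the same elements at every stage.\<close>

lemma foldr_exq:
  assumes "ok Y (snd p) (fst p)" "distinct us" "set us \<inter> set X = {}"
  shows "ok (set X \<union> (Y - set us)) (snd (foldr (exq X d) us p)) (fst (foldr (exq X d) us p)) \<and>
    (\<forall>A\<in>K. \<forall>\<beta>. \<beta> ` (set X \<union> (Y - set us)) \<subseteq> univ A \<longrightarrow>
       bsat A \<beta> (fst (foldr (exq X d) us p)) = (\<exists>as\<in>tuples (length us) (univ A).
          (\<forall>a\<in>set as. \<exists>x\<in>set X. near V A d (\<beta> x) a) \<and> bsat A (upd \<beta> us as) (fst p)))"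
  using assms(2,3)
proof (induction us)
  case Nil
  have "ok (set X \<union> Y) (snd p) (fst p)" by (rule ok_mono[OF assms(1)]) auto
  then show ?case by (auto simp: tuples_def)
next
  case (Cons u us)
  let ?q = "foldr (exq X d) us p"
  let ?Y = "set X \<union> (Y - set us)"
  have IH: "ok ?Y (snd ?q) (fst ?q)"
    "\<And>A \<beta>. A \<in> K \<Longrightarrow> \<beta> ` ?Y \<subseteq> univ A \<Longrightarrow> bsat A \<beta> (fst ?q) = (\<exists>as\<in>tuples (length us) (univ A).
          (\<forall>a\<in>set as. \<exists>x\<in>set X. near V A d (\<beta> x) a) \<and> bsat A (upd \<beta> us as) (fst p))"
    using Cons by auto
  have u: "u \<notin> set X" "u \<notin> set us" using Cons.prems by auto
  have Yeq: "set X \<union> (?Y - {u}) = set X \<union> (Y - set (u # us))" using u by auto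
  show ?case
  proof (intro conjI ballI allI impI)
    show "ok (set X \<union> (Y - set (u # us))) (snd (foldr (exq X d) (u # us) p)) (fst (foldr (exq X d) (u # us) p))"
      using ok_exq[OF IH(1) u(1), of d] unfolding Yeq by simp
    fix A \<beta> assume A: "A \<in> K" and \<beta>: "\<beta> ` (set X \<union> (Y - set (u # us))) \<subseteq> univ A"
    have "bsat A \<beta> (fst (foldr (exq X d) (u # us) p)) \<longleftrightarrow>
        (\<exists>a\<in>univ A. (\<exists>x\<in>set X. near V A d (\<beta> x) a) \<and> bsat A (\<beta>(u := a)) (fst ?q))"
      using bsat_exq[OF IH(1) u(1) A, of \<beta> d] \<beta> unfolding Yeq by simp
    also have "\<dots> \<longleftrightarrow> (\<exists>a\<in>univ A. (\<exists>x\<in>set X. near V A d (\<beta> x) a) \<and> (\<exists>as\<in>tuples (length us) (univ A).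
          (\<forall>a\<in>set as. \<exists>x\<in>set X. near V A d (\<beta> x) a) \<and> bsat A (upd \<beta> (u # us) (a # as)) (fst p)))"
    proof (intro bex_cong refl conj_cong)
      fix a assume a: "a \<in> univ A"
      have im: "(\<beta>(u := a)) ` ?Y \<subseteq> univ A" using \<beta> a by auto
      have X: "(\<beta>(u := a)) x = \<beta> x" if "x \<in> set X" for x using u that by auto
      show "bsat A (\<beta>(u := a)) (fst ?q) \<longleftrightarrow> (\<exists>as\<in>tuples (length us) (univ A).
          (\<forall>a\<in>set as. \<exists>x\<in>set X. near V A d (\<beta> x) a) \<and> bsat A (upd \<beta> (u # us) (a # as)) (fst p))"
        using IH(2)[OF A im] X u(2) by (simp add: upd_Cons')
    qed
    also have "\<dots> \<longleftrightarrow> (\<exists>as\<in>tuples (length (u # us)) (univ A).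
          (\<forall>a\<in>set as. \<exists>x\<in>set X. near V A d (\<beta> x) a) \<and> bsat A (upd \<beta> (u # us) as) (fst p))" (is "?l \<longleftrightarrow> ?r")
    proof
      assume ?l
      then obtain a as where "a \<in> univ A" "as \<in> tuples (length us) (univ A)" "\<exists>x\<in>set X. near V A d (\<beta> x) a"
        "\<forall>a\<in>set as. \<exists>x\<in>set X. near V A d (\<beta> x) a" "bsat A (upd \<beta> (u # us) (a # as)) (fst p)" by blast
      then show ?r by (intro bexI[of _ "a # as"]) (auto simp: tuples_def)
    next
      assume ?r
      then obtain as' where as': "as' \<in> tuples (length (u # us)) (univ A)"
        "\<forall>a\<in>set as'. \<exists>x\<in>set X. near V A d (\<beta> x) a" "bsat A (upd \<beta> (u # us) as') (fst p)" by blast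
      then obtain a as where "as' = a # as" by (cases as') (auto simp: tuples_def)
      then show ?l using as' by (intro bexI[of _ a] conjI bexI[of _ as]) (auto simp: tuples_def)
    qed
    finally show "bsat A \<beta> (fst (foldr (exq X d) (u # us) p)) \<longleftrightarrow> (\<exists>as\<in>tuples (length (u # us)) (univ A).
          (\<forall>a\<in>set as. \<exists>x\<in>set X. near V A d (\<beta> x) a) \<and> bsat A (upd \<beta> (u # us) as) (fst p))" .
  qed
qed

section \<open>Existence of an element far from the free variables\<close>

primrec scat_at :: "nat \<Rightarrow> nat \<Rightarrow> ('s, 'v) fm \<Rightarrow> nat list \<Rightarrow> ('s, 'v) bc" where
  "scat_at R y \<theta> [] = BTop"
| "scat_at R y \<theta> (z # zs) = BAnd (Local (inst y \<theta> z))
     (BAnd (BConj (map (\<lambda>z'. BNeg (Local (dl R z z'))) zs)) (scat_at R y \<theta> zs))"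

definition scat_near :: "nat list \<Rightarrow> nat \<Rightarrow> nat \<Rightarrow> nat \<Rightarrow> nat \<Rightarrow> ('s, 'v) fm \<Rightarrow> nat list \<Rightarrow> ('s, 'v) bc \<times> nat" where
  "scat_near X d \<rho> R y \<theta> zs = foldr (exq X d) zs (scat_at R y \<theta> zs, \<rho> + R)"

text \<open>The sum is a computable bound on \<open>y\<close> and all entries of
  \<open>X\<close>.\<close>

definition fresh_vars :: "nat list \<Rightarrow> nat \<Rightarrow> nat \<Rightarrow> nat list" where
  "fresh_vars X y e = map (\<lambda>i. Suc (y + sum_list X) + i) [0..<e]"

definition far_scat :: "nat list \<Rightarrow> nat \<Rightarrow> nat \<Rightarrow> nat \<Rightarrow> ('s, 'v) fm \<Rightarrow> nat \<Rightarrow> ('s, 'v) bc \<times> nat" where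
  "far_scat X y d \<rho> \<theta> e =
    (BAnd (scat_bc \<rho> (2 * d) y \<theta> (fresh_vars X y e))
       (BNeg (fst (scat_near X d \<rho> (2 * d) y \<theta> (fresh_vars X y e)))),
     \<rho> + 2 * d * e + snd (scat_near X d \<rho> (2 * d) y \<theta> (fresh_vars X y e)))"

text \<open>The outer radius \<open>3 * d\<close> consists of \<open>d\<close> from \<open>X\<close>
  to a near element and \<open>2 * d\<close> from there, the distance up to which scatteredness
  fails.\<close>

definition far_mid :: "nat list \<Rightarrow> nat \<Rightarrow> nat \<Rightarrow> nat \<Rightarrow> ('s, 'v) fm \<Rightarrow> ('s, 'v) bc \<times> nat" where
  "far_mid X y d \<rho> \<theta> =
    exq X (3 * d) y (BAnd (Local \<theta>) (BConj (map (\<lambda>x. BNeg (Local (dl d x y))) X)), \<rho> + d)"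

definition BDisjs :: "(('s, 'v) bc \<times> nat) list \<Rightarrow> ('s, 'v) bc \<times> nat" where
  "BDisjs ps = (BDisj (map fst ps), sum_list (map snd ps))"

text \<open>The largest length tested is \<open>length X + 1\<close>, since that many scattered
  elements cannot all be near \<open>X\<close>.\<close>

definition far_ex :: "nat list \<Rightarrow> nat \<Rightarrow> nat \<Rightarrow> nat \<Rightarrow> ('s, 'v) fm \<Rightarrow> ('s, 'v) bc \<times> nat" where
  "far_ex X y d \<rho> \<theta> = BDisjs (far_mid X y d \<rho> \<theta> # map (far_scat X y d \<rho> \<theta>) [0..<length X + 2])"

text \<open>The distance \<open>snd q + 2\<close> is large enough for
  \<open>far_cases_sound\<close>. The conjunct \<open>Eq y y\<close> supplies the free variable that
  a local leaf needs when the remaining formula is closed.\<close>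

definition norm_ex :: "nat list \<Rightarrow> nat \<Rightarrow> ('s, 'v) bc \<times> nat \<Rightarrow> ('s, 'v) bc \<times> nat" where
  "norm_ex X y q = BDisjs (exq X (snd q + 2) y q #
     map (\<lambda>p. (BAnd (fst p) (fst (far_ex X y (snd q + 2) (snd q) (And (Eq y y) (snd p)))),
               snd q + snd (far_ex X y (snd q + 2) (snd q) (And (Eq y y) (snd p)))))
       (cases_bc (far_leaf [y]) (fst q)))"

lemma ok_BDisjs:
  assumes "\<And>p. p \<in> set ps \<Longrightarrow> ok X (snd p) (fst p)"
  shows "ok X (snd (BDisjs ps)) (fst (BDisjs ps))"
proof -
  have "ok X (sum_list (map snd ps)) (fst p)" if p: "p \<in> set ps" for p
    by (rule ok_mono[OF assms[OF p] order_refl]) (use p in \<open>auto intro: member_le_sum_list\<close>)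
  then show ?thesis by (auto simp: BDisjs_def)
qed

lemma bsat_BDisjs: "bsat A \<beta> (fst (BDisjs ps)) \<longleftrightarrow> (\<exists>p\<in>set ps. bsat A \<beta> (fst p))"
  by (simp add: BDisjs_def)

text \<open>Two members of a \<open>2 * d\<close>-scattered tuple cannot be within \<open>d\<close>
  of the same element of \<open>X\<close>, so choosing such elements is injective.\<close>

lemma scattered_cover:
  assumes "\<And>a. a \<in> set as \<Longrightarrow> \<exists>x\<in>set X. near V A d x a" "scattered V A (2 * d) as"
  shows "length as \<le> length X"
proof -
  have "\<exists>f. \<forall>a\<in>set as. f a \<in> set X \<and> near V A d (f a) a" using assms(1) by (intro bchoice) blast
  then obtain f where f: "\<And>a. a \<in> set as \<Longrightarrow> f a \<in> set X \<and> near V A d (f a) a" by blast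
  have "distinct (map f as)" using assms(2) f
  proof (induction as)
    case (Cons a as)
    have "f a \<noteq> f b" if b: "b \<in> set as" for b
    proof
      assume "f a = f b"
      then have "near V A d a (f a)" "near V A d (f a) b"
        using Cons.prems(2)[of a] Cons.prems(2)[of b] b near_sym[of V A d "f a" a] by auto
      then have "near V A (d + d) a b" by (rule near_trans)
      then show False using Cons.prems(1) b by (simp add: mult_2)
    qed
    then show ?case using Cons by auto
  qed simp
  then have "length as = card (set (map f as))" by (metis distinct_card length_map)
  also have "\<dots> \<le> card (set X)" using f by (intro card_mono) auto
  also have "\<dots> \<le> length X" by (rule card_length)
  finally show ?thesis .
qed

text \<open>
  If some element of \<open>T\<close> is far from \<open>X\<close> but none of these lies at distance at most \<open>3 d\<close> from \<open>X\<close>, then a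
  largest \<open>2 d\<close>-scattered subset of \<open>T\<close> cannot be found inside the \<open>d\<close>-neighbourhood of \<open>X\<close>: such a set
  would cover \<open>T\<close> by its \<open>2 d\<close>-neighbourhood.
\<close>

lemma scattered_far:
  assumes T: "a \<in> T" "\<And>x. x \<in> set X \<Longrightarrow> \<not> near V A d x a"
    and mid: "\<And>b x. b \<in> T \<Longrightarrow> x \<in> set X \<Longrightarrow> near V A (3 * d) x b \<Longrightarrow> \<exists>x\<in>set X. near V A d x b"
  shows "\<exists>e<length X + 2. (\<exists>as. length as = e \<and> set as \<subseteq> T \<and> scattered V A (2 * d) as) \<and>
    \<not> (\<exists>as. length as = e \<and> set as \<subseteq> T \<and> scattered V A (2 * d) as \<and> (\<forall>b\<in>set as. \<exists>x\<in>set X. near V A d x b))"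
proof (rule ccontr)
  assume no: "\<not> ?thesis"
  have "\<exists>as. length as = e \<and> set as \<subseteq> T \<and> scattered V A (2 * d) as" if "e < length X + 2" for e
    using that
  proof (induction e)
    case (Suc e)
    then obtain as where as: "length as = e" "set as \<subseteq> T" "scattered V A (2 * d) as"
      "\<forall>b\<in>set as. \<exists>x\<in>set X. near V A d x b" using no by (metis Suc_lessD)
    \<comment> \<open>Otherwise \<open>a\<close> would be within \<open>3 * d\<close> of
      \<open>X\<close>, and \<open>mid\<close> would make it near \<open>X\<close>; so the far
      element \<open>a\<close> extends every near scattered tuple.\<close>
    have "\<not> near V A (2 * d) a b" if b: "b \<in> set as" for b
    proof
      assume n: "near V A (2 * d) a b"
      obtain x where x: "x \<in> set X" "near V A d x b" using as b by blast
      then have "near V A (3 * d) x a" using near_trans_le[OF x(2) near_sym[OF n]] by simp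
      then show False using mid[OF T(1) x(1)] T(2) by blast
    qed
    then have "scattered V A (2 * d) (a # as)" "set (a # as) \<subseteq> T" using as T by auto
    then show ?case using as(1) by (metis length_Cons)
  qed auto
  \<comment> \<open>At the last length tested the refuted claim even gives a near tuple, which is
    one element too long for \<open>scattered_cover\<close>.\<close>
  then obtain as where "length as = Suc (length X)" "set as \<subseteq> T" "scattered V A (2 * d) as"
      "\<forall>b\<in>set as. \<exists>x\<in>set X. near V A d x b" using no by (metis add_2_eq_Suc' lessI)
  then show False using scattered_cover[of as X A d] by simp
qed

context
  fixes \<rho> y :: nat and \<theta>
  assumes \<theta>: "fow1 V \<theta>" "free \<theta> = {y}" "slocal \<rho> \<theta>"
begin

lemma \<theta>_sub: "free \<theta> \<subseteq> {y}" using \<theta> by simp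

lemma scat_at:
  assumes "y \<notin> set zs"
  shows "ok (set zs) (\<rho> + R) (scat_at R y \<theta> zs) \<and> (\<forall>A\<in>K. \<forall>\<beta>. \<beta> ` set zs \<subseteq> univ A \<longrightarrow>
    bsat A \<beta> (scat_at R y \<theta> zs) = ((\<forall>z\<in>set zs. sat V A (\<lambda>_. \<beta> z) \<theta>) \<and> scattered V A R (map \<beta> zs)))"
  using assms
proof (induction zs)
  case (Cons z zs)
  have z: "z \<noteq> y" using Cons.prems by auto
  have "lf (set (z # zs)) (\<rho> + R) (inst y \<theta> z)"
    using free_inst[OF \<theta>(1) \<theta>_sub \<theta>(3) z] slocal_mono[OF slocal_inst[OF \<theta>(1) \<theta>_sub \<theta>(3) z], of "\<rho> + R"]
      fow1_inst[OF \<theta>(1) \<theta>_sub \<theta>(3)] by (simp add: lf_def conn_def)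
  moreover have "lf (set (z # zs)) (\<rho> + R) (dl R z z')" if "z' \<in> set zs" for z'
    using that by (intro lf_dl) auto
  moreover have "ok (set (z # zs)) (\<rho> + R) (scat_at R y \<theta> zs)"
    by (rule ok_mono[of "set zs" "\<rho> + R"]) (use Cons in simp_all, blast)
  moreover have "bsat A \<beta> (scat_at R y \<theta> (z # zs)) =
      ((\<forall>z\<in>set (z # zs). sat V A (\<lambda>_. \<beta> z) \<theta>) \<and> scattered V A R (map \<beta> (z # zs)))"
    if A: "A \<in> K" and \<beta>: "\<beta> ` set (z # zs) \<subseteq> univ A" for A \<beta>
  proof -
    have "sat V A \<beta> (inst y \<theta> z) = sat V A (\<lambda>_. \<beta> z) \<theta>"
      using sat_inst_gen[OF \<theta>(1) \<theta>_sub \<theta>(3) z, of \<beta> A] \<beta> by simp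
    moreover have "sat V A \<beta> (dl R z z') \<longleftrightarrow> near V A R (\<beta> z) (\<beta> z')" if "z' \<in> set zs" for z'
      using sat_dl[OF A, of \<beta> z z' R] \<beta> that by auto
    moreover have "bsat A \<beta> (scat_at R y \<theta> zs) = ((\<forall>z\<in>set zs. sat V A (\<lambda>_. \<beta> z) \<theta>) \<and> scattered V A R (map \<beta> zs))"
      using Cons A \<beta> by simp
    ultimately show ?thesis by auto
  qed
  ultimately show ?case by simp
qed simp

lemma scat_near:
  assumes zs: "distinct zs" "y \<notin> set zs" "set zs \<inter> set X = {}"
  shows "ok (set X) (snd (scat_near X d \<rho> R y \<theta> zs)) (fst (scat_near X d \<rho> R y \<theta> zs)) \<and>
    (\<forall>A\<in>K. \<forall>\<beta>. \<beta> ` set X \<subseteq> univ A \<longrightarrow> bsat A \<beta> (fst (scat_near X d \<rho> R y \<theta> zs)) =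
      (\<exists>as\<in>tuples (length zs) (univ A). (\<forall>a\<in>set as. \<exists>x\<in>set X. near V A d (\<beta> x) a) \<and>
         (\<forall>a\<in>set as. sat V A (\<lambda>_. a) \<theta>) \<and> scattered V A R as))"
proof -
  let ?p = "(scat_at R y \<theta> zs, \<rho> + R)"
  have ok: "ok (set zs) (snd ?p) (fst ?p)" using scat_at[OF zs(2), of R] by simp
  note F = foldr_exq[OF ok zs(1,3), of d, simplified]
  show ?thesis
  proof (intro conjI ballI allI impI)
    show "ok (set X) (snd (scat_near X d \<rho> R y \<theta> zs)) (fst (scat_near X d \<rho> R y \<theta> zs))"
      using F by (simp add: scat_near_def)
    fix A \<beta> assume A: "A \<in> K" and \<beta>: "\<beta> ` set X \<subseteq> univ A"
    have "bsat A (upd \<beta> zs as) (scat_at R y \<theta> zs) \<longleftrightarrow> (\<forall>a\<in>set as. sat V A (\<lambda>_. a) \<theta>) \<and> scattered V A R as"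
      if as: "as \<in> tuples (length zs) (univ A)" for as
    proof -
      have l: "length as = length zs" "set as \<subseteq> univ A" using as by (auto simp: tuples_def)
      have m: "map (upd \<beta> zs as) zs = as" "upd \<beta> zs as ` set zs = set as"
        using map_upd[OF l(1) zs(1)] upd_image[OF l(1) zs(1)] by auto
      have "bsat A (upd \<beta> zs as) (scat_at R y \<theta> zs) = ((\<forall>z\<in>set zs. sat V A (\<lambda>_. upd \<beta> zs as z) \<theta>) \<and> scattered V A R (map (upd \<beta> zs as) zs))"
        using scat_at[OF zs(2), of R] A l(2) m(2) by simp
      then show ?thesis unfolding m(1) m(2)[symmetric] by simp
    qed
    then show "bsat A \<beta> (fst (scat_near X d \<rho> R y \<theta> zs)) \<longleftrightarrow>
      (\<exists>as\<in>tuples (length zs) (univ A). (\<forall>a\<in>set as. \<exists>x\<in>set X. near V A d (\<beta> x) a) \<and>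
         (\<forall>a\<in>set as. sat V A (\<lambda>_. a) \<theta>) \<and> scattered V A R as)"
      using F A \<beta> by (simp add: scat_near_def cong: bex_cong)
  qed
qed

lemma fresh_vars:
  "distinct (fresh_vars X y e)" "y \<notin> set (fresh_vars X y e)" "set (fresh_vars X y e) \<inter> set X = {}"
  "length (fresh_vars X y e) = e"
proof -
  have "x \<le> sum_list X" if "x \<in> set X" for x using that by (intro member_le_sum_list) auto
  then show "set (fresh_vars X y e) \<inter> set X = {}" by (fastforce simp: fresh_vars_def)
qed (auto simp: fresh_vars_def distinct_map inj_on_def)

text \<open>A true disjunct yields a witness: for \<open>far_mid\<close> directly, and for
  \<open>far_scat\<close> because a scattered tuple exists while none of its length lies near
  \<open>X\<close> entirely, so one of its entries is far. The converse is
  \<open>scattered_far\<close>.\<close>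

lemma far_ex:
  assumes y: "y \<notin> set X"
  shows "ok (set X) (snd (far_ex X y d \<rho> \<theta>)) (fst (far_ex X y d \<rho> \<theta>)) \<and>
    (\<forall>A\<in>K. \<forall>\<beta>. \<beta> ` set X \<subseteq> univ A \<longrightarrow> bsat A \<beta> (fst (far_ex X y d \<rho> \<theta>)) =
      (\<exists>a\<in>univ A. sat V A (\<lambda>_. a) \<theta> \<and> (\<forall>x\<in>set X. \<not> near V A d (\<beta> x) a)))"
proof -
  let ?m = "BAnd (Local \<theta>) (BConj (map (\<lambda>x. BNeg (Local (dl d x y))) X))"
  have okm: "ok (insert y (set X)) (snd (?m, \<rho> + d)) (fst (?m, \<rho> + d))"
  proof -
    have "lf (insert y (set X)) (\<rho> + d) (dl d x y)" if "x \<in> set X" for x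
      using that by (intro lf_dl) auto
    moreover have "lf (insert y (set X)) (\<rho> + d) \<theta>"
      using \<theta> slocal_mono[OF \<theta>(3), of "\<rho> + d"] by (simp add: lf_def conn_def)
    ultimately show ?thesis by simp
  qed
  have Xy: "set X \<union> (insert y (set X) - {y}) = set X" using y by auto
  have ok_mid: "ok (set X) (snd (far_mid X y d \<rho> \<theta>)) (fst (far_mid X y d \<rho> \<theta>))"
    using ok_exq[OF okm y, of "3 * d"] unfolding Xy far_mid_def .
  have ok_scat: "ok (set X) (snd (far_scat X y d \<rho> \<theta> e)) (fst (far_scat X y d \<rho> \<theta> e))" for e
  proof -
    let ?N = "scat_near X d \<rho> (2 * d) y \<theta> (fresh_vars X y e)"
    have "ok (set X) (\<rho> + 2 * d * e + snd ?N) (scat_bc \<rho> (2 * d) y \<theta> (fresh_vars X y e))"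
      by (rule ok_mono[OF ok_scat_bc[OF \<theta>(1) \<theta>_sub \<theta>(3) fresh_vars(1,2)] order_refl]) (simp add: fresh_vars)
    moreover have "ok (set X) (\<rho> + 2 * d * e + snd ?N) (fst ?N)"
      using scat_near[OF fresh_vars(1,2,3), where d = d and R = "2 * d"] by (blast intro: ok_mono[OF _ order_refl le_add2])
    ultimately show ?thesis by (simp add: far_scat_def)
  qed
  show ?thesis
  proof (intro conjI ballI allI impI)
    show "ok (set X) (snd (far_ex X y d \<rho> \<theta>)) (fst (far_ex X y d \<rho> \<theta>))"
      unfolding far_ex_def using ok_mid ok_scat by (intro ok_BDisjs) auto
    fix A \<beta> assume A: "A \<in> K" and \<beta>: "\<beta> ` set X \<subseteq> univ A"
    let ?T = "{a \<in> univ A. sat V A (\<lambda>_. a) \<theta>}"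
    let ?nr = "\<lambda>a. \<exists>x\<in>set X. near V A d (\<beta> x) a"
    have mid: "bsat A \<beta> (fst (far_mid X y d \<rho> \<theta>)) \<longleftrightarrow>
        (\<exists>a\<in>?T. (\<exists>x\<in>set X. near V A (3 * d) (\<beta> x) a) \<and> \<not> ?nr a)"
    proof -
      have "bsat A (\<beta>(y := a)) ?m \<longleftrightarrow> sat V A (\<lambda>_. a) \<theta> \<and> \<not> ?nr a" if a: "a \<in> univ A" for a
      proof -
        have "sat V A (\<beta>(y := a)) \<theta> = sat V A (\<lambda>_. a) \<theta>" using \<theta>(2) by (intro sat_cong) auto
        moreover have "sat V A (\<beta>(y := a)) (dl d x y) \<longleftrightarrow> near V A d (\<beta> x) a" if "x \<in> set X" for x
        proof -
          have "x \<noteq> y" "\<beta> x \<in> univ A" using y \<beta> that by auto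
          then show ?thesis using sat_dl[OF A, of "\<beta>(y := a)" x y d] a by simp
        qed
        ultimately show ?thesis by simp
      qed
      then show ?thesis
        using bsat_exq[OF okm y A, of \<beta> "3 * d"] \<beta> unfolding Xy far_mid_def by auto
    qed
    have scat: "bsat A \<beta> (fst (far_scat X y d \<rho> \<theta> e)) \<longleftrightarrow>
        (\<exists>as. length as = e \<and> set as \<subseteq> ?T \<and> scattered V A (2 * d) as) \<and>
        \<not> (\<exists>as. length as = e \<and> set as \<subseteq> ?T \<and> scattered V A (2 * d) as \<and> (\<forall>b\<in>set as. ?nr b))" for e
    proof -
      have "bsat A \<beta> (scat_bc \<rho> (2 * d) y \<theta> (fresh_vars X y e)) \<longleftrightarrow>
          (\<exists>as. length as = e \<and> set as \<subseteq> ?T \<and> scattered V A (2 * d) as)"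
        unfolding bsat_scat_bc[OF \<theta>(1) \<theta>_sub \<theta>(3) fresh_vars(1,2) A] fresh_vars(4) by (auto simp: tuples_def)
      moreover have "bsat A \<beta> (fst (scat_near X d \<rho> (2 * d) y \<theta> (fresh_vars X y e))) \<longleftrightarrow>
          (\<exists>as. length as = e \<and> set as \<subseteq> ?T \<and> scattered V A (2 * d) as \<and> (\<forall>b\<in>set as. ?nr b))"
      proof -
        have "bsat A \<beta> (fst (scat_near X d \<rho> (2 * d) y \<theta> (fresh_vars X y e))) \<longleftrightarrow>
            (\<exists>as\<in>tuples e (univ A). (\<forall>a\<in>set as. ?nr a) \<and> (\<forall>a\<in>set as. sat V A (\<lambda>_. a) \<theta>) \<and> scattered V A (2 * d) as)"
          using scat_near[OF fresh_vars(1,2,3), where d = d and R = "2 * d"] A \<beta> unfolding fresh_vars(4) by blast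
        then show ?thesis by (auto simp: tuples_def)
      qed
      ultimately show ?thesis by (simp add: far_scat_def)
    qed
    have nrX: "?nr b \<longleftrightarrow> (\<exists>x\<in>set (map \<beta> X). near V A d x b)" for b by simp
    show "bsat A \<beta> (fst (far_ex X y d \<rho> \<theta>)) \<longleftrightarrow>
      (\<exists>a\<in>univ A. sat V A (\<lambda>_. a) \<theta> \<and> (\<forall>x\<in>set X. \<not> near V A d (\<beta> x) a))" (is "?l \<longleftrightarrow> ?r")
    proof
      assume ?l
      then consider "bsat A \<beta> (fst (far_mid X y d \<rho> \<theta>))" | e where "bsat A \<beta> (fst (far_scat X y d \<rho> \<theta> e))"
        unfolding far_ex_def bsat_BDisjs by auto
      then show ?r
      proof cases
        case 1
        then show ?thesis using mid by blast
      next
        case 2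
        then obtain as where "length as = e" "set as \<subseteq> ?T" "scattered V A (2 * d) as" "\<not> (\<forall>b\<in>set as. ?nr b)"
          unfolding scat by blast
        then show ?thesis by blast
      qed
    next
      assume ?r
      then obtain a where a: "a \<in> ?T" "\<forall>x\<in>set X. \<not> near V A d (\<beta> x) a" by blast
      show ?l
      proof (cases "bsat A \<beta> (fst (far_mid X y d \<rho> \<theta>))")
        case True
        then show ?thesis unfolding far_ex_def bsat_BDisjs by simp
      next
        case False
        then have m: "\<And>b x. b \<in> ?T \<Longrightarrow> x \<in> set (map \<beta> X) \<Longrightarrow> near V A (3 * d) x b \<Longrightarrow>
            \<exists>x\<in>set (map \<beta> X). near V A d x b" using mid by auto
        have far: "\<And>x. x \<in> set (map \<beta> X) \<Longrightarrow> \<not> near V A d x a" using a(2) by auto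
        have "\<exists>e<length (map \<beta> X) + 2. (\<exists>as. length as = e \<and> set as \<subseteq> ?T \<and> scattered V A (2 * d) as) \<and>
            \<not> (\<exists>as. length as = e \<and> set as \<subseteq> ?T \<and> scattered V A (2 * d) as \<and>
                (\<forall>b\<in>set as. \<exists>x\<in>set (map \<beta> X). near V A d x b))"
          by (rule scattered_far[where a = a]) (fact a(1), fact far, fact m)
        then obtain e where "e < length X + 2" "bsat A \<beta> (fst (far_scat X y d \<rho> \<theta> e))"
          unfolding scat nrX length_map by blast
        moreover from this(1) have "far_scat X y d \<rho> \<theta> e \<in> set (map (far_scat X y d \<rho> \<theta>) [0..<length X + 2])"
          by (simp del: upt_Suc)
        ultimately show ?thesis unfolding far_ex_def bsat_BDisjs by (metis list.set_intros(2))
      qed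
    qed
  qed
qed

end

lemma norm_ex:
  assumes ok: "ok Y (snd q) (fst q)" and Y: "Y - {y} \<subseteq> set X" and y: "y \<notin> set X"
  shows "ok (set X) (snd (norm_ex X y q)) (fst (norm_ex X y q)) \<and>
    (\<forall>A\<in>K. \<forall>\<beta>. \<beta> ` set X \<subseteq> univ A \<longrightarrow>
       bsat A \<beta> (fst (norm_ex X y q)) = (\<exists>a\<in>univ A. bsat A (\<beta>(y := a)) (fst q)))"
proof -
  let ?d = "snd q + 2"
  let ?\<theta> = "\<lambda>p. And (Eq y y) (snd p) :: ('s, 'v) fm"
  let ?cs = "cases_bc (far_leaf [y]) (fst q)"
  have XY: "set X \<union> (Y - {y}) = set X" using Y by auto
  have c: "fow1 V (?\<theta> p)" "free (?\<theta> p) = {y}" "slocal (snd q) (?\<theta> p)" if "p \<in> set ?cs" for p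
    using far_cases_fm[OF _ _ ok that] by auto
  note far = far_ex[OF c y, where d = ?d]
  show ?thesis
  proof (intro conjI ballI allI impI)
    have "ok (set X) (snd (exq X ?d y q)) (fst (exq X ?d y q))"
      using ok_exq[OF ok y, of ?d] unfolding XY .
    moreover have "ok (set X) (snd q + snd (far_ex X y ?d (snd q) (?\<theta> p)))
        (BAnd (fst p) (fst (far_ex X y ?d (snd q) (?\<theta> p))))" if p: "p \<in> set ?cs" for p
    proof -
      have "ok (Y - {y}) (snd q) (fst p)" using far_cases_guard[OF _ _ ok p] by simp
      then have "ok (set X) (snd q + snd (far_ex X y ?d (snd q) (?\<theta> p))) (fst p)"
        by (rule ok_mono[OF _ Y]) simp
      moreover have "ok (set X) (snd q + snd (far_ex X y ?d (snd q) (?\<theta> p))) (fst (far_ex X y ?d (snd q) (?\<theta> p)))"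
        using far[OF p p p] by (blast intro: ok_mono[OF _ order_refl le_add2])
      ultimately show ?thesis by simp
    qed
    ultimately show "ok (set X) (snd (norm_ex X y q)) (fst (norm_ex X y q))"
      unfolding norm_ex_def by (intro ok_BDisjs) auto
    fix A \<beta> assume A: "A \<in> K" and \<beta>: "\<beta> ` set X \<subseteq> univ A"
    let ?far = "\<lambda>a. \<forall>x\<in>set X. \<not> near V A ?d (\<beta> x) a"
    have nr: "bsat A \<beta> (fst (exq X ?d y q)) \<longleftrightarrow> (\<exists>a\<in>univ A. \<not> ?far a \<and> bsat A (\<beta>(y := a)) (fst q))"
      using bsat_exq[OF ok y A, of \<beta> ?d] \<beta> unfolding XY by blast
    have fr: "bsat A \<beta> (fst (far_ex X y ?d (snd q) (?\<theta> p))) \<longleftrightarrow> (\<exists>a\<in>univ A. ?far a \<and> bsat A (\<beta>(y := a)) (fst q))"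
      if p: "p \<in> set ?cs" "bsat A \<beta> (fst p)" for p
    proof -
      have "sat V A (\<lambda>_. a) (?\<theta> p) \<longleftrightarrow> bsat A (\<beta>(y := a)) (fst q)" if a: "a \<in> univ A" "?far a" for a
      proof -
        have "sat V A (upd \<beta> [y] [a]) (snd p) \<longleftrightarrow> bsat A (upd \<beta> [y] [a]) (fst q)"
        proof (rule far_cases_sound[OF _ _ ok A _ p])
          show "\<not> near V A (snd q + 1) (\<beta> z) (hd [a])" if "z \<in> Y - set [y]" for z
            using a(2) that Y near_mono[of V A "snd q + 1" "\<beta> z" a ?d] by auto
        qed (use a Y \<beta> in \<open>auto simp: tuples_def clique_def\<close>)
        moreover have "sat V A (\<lambda>_. a) (?\<theta> p) = sat V A (\<beta>(y := a)) (?\<theta> p)"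
          using c(2)[OF p(1)] by (intro sat_cong) auto
        ultimately show ?thesis by (simp add: upd_Cons)
      qed
      then show ?thesis using far[OF p(1) p(1) p(1)] A \<beta> by blast
    qed
    have "\<exists>p\<in>set ?cs. bsat A \<beta> (fst p)" by (rule far_cases_exists[OF _ _ ok]) auto
    then obtain p where p: "p \<in> set ?cs" "bsat A \<beta> (fst p)" by blast
    have "bsat A \<beta> (fst (norm_ex X y q)) \<longleftrightarrow> bsat A \<beta> (fst (exq X ?d y q)) \<or>
        (\<exists>p\<in>set ?cs. bsat A \<beta> (fst p) \<and> bsat A \<beta> (fst (far_ex X y ?d (snd q) (?\<theta> p))))"
      unfolding norm_ex_def bsat_BDisjs by simp
    then show "bsat A \<beta> (fst (norm_ex X y q)) \<longleftrightarrow> (\<exists>a\<in>univ A. bsat A (\<beta>(y := a)) (fst q))"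
      using nr fr p by blast
  qed
qed

end

section \<open>Sums in finite groups\<close>

lemma mem_concat_map_filter:
  "p \<in> set (concat (map (\<lambda>t. map (g t) (filter (P t) qs)) ts)) \<longleftrightarrow> (\<exists>t\<in>set ts. \<exists>q\<in>set qs. P t q \<and> p = g t q)"
  by (simp add: image_iff) blast

context weighted
begin

abbreviation wgrp :: "nat \<Rightarrow> 'v ring" where
  "wgrp w \<equiv> alg V (wt_type V w)"

lemma wgrp: "abelian_group (wgrp w)"
  using voc ring.is_abelian_group unfolding vocabulary_def by metis

lemma wt_carrier: "A \<in> K \<Longrightarrow> w \<in> wt_syms V \<Longrightarrow> as \<in> tuples (wt_ar V w) (univ A) \<Longrightarrow> wt A w as \<in> carrier (wgrp w)"
  using K_structure unfolding is_structure_def by blast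

text \<open>The support condition on weights, read in the Gaifman graph.\<close>

lemma wt_support:
  assumes "A \<in> K" "w \<in> wt_syms V" "as \<in> tuples (wt_ar V w) (univ A)" "wt A w as \<noteq> \<zero>\<^bsub>wgrp w\<^esub>"
    and ab: "a \<in> set as" "b \<in> set as"
  shows "near V A 1 a b"
proof -
  have "wt_ar V w = 1 \<or> (\<forall>a\<in>set as. \<forall>b\<in>set as. a = b) \<or> (\<exists>R\<in>rel_syms V. \<exists>t\<in>rel A R. set as \<subseteq> set t)"
    using K_structure[OF assms(1)] assms(2-4) unfolding is_structure_def by blast
  then have "a = b \<or> (\<exists>R\<in>rel_syms V. \<exists>t\<in>rel A R. a \<in> set t \<and> b \<in> set t)"
  proof (elim disjE)
    assume "wt_ar V w = 1"
    then have "length as = 1" using assms(3) by (simp add: tuples_def)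
    then obtain c where "as = [c]" by (cases as) auto
    then show ?thesis using ab by simp
  qed (use ab in blast)+
  then consider "a = b" | R t where "R \<in> rel_syms V" "t \<in> rel A R" "a \<in> set t" "b \<in> set t"
    by blast
  then show ?thesis
  proof cases
    case 2
    then have "a = b \<or> (a, b) \<in> gaifman V A" using ab assms(3) by (auto simp: gaifman_def tuples_def)
    then show ?thesis unfolding One_nat_def near_Suc by auto
  qed simp
qed

lemma finite_tuples [simp]: "finite X \<Longrightarrow> finite (tuples k X)"
  using finite_lists_length_eq[of X k] by (simp add: tuples_def conj_commute)

definition wsum :: "nat \<Rightarrow> ('a, 'v) wstruct \<Rightarrow> ('a list \<Rightarrow> bool) \<Rightarrow> 'v" where
  "wsum w A P = finsum (wgrp w) (wt A w) {as \<in> tuples (wt_ar V w) (univ A). P as}"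

context
  fixes A w
  assumes A: "A \<in> K" and w: "w \<in> wt_syms V"
begin

interpretation G: abelian_group "wgrp w" by (rule wgrp)

lemma wsum_closed [simp]: "wsum w A P \<in> carrier (wgrp w)"
  unfolding wsum_def by (rule G.finsum_closed) (use wt_carrier[OF A w] in auto)

lemma wsum_split: "wsum w A P = wsum w A (\<lambda>as. P as \<and> Q as) \<oplus>\<^bsub>wgrp w\<^esub> wsum w A (\<lambda>as. P as \<and> \<not> Q as)"
proof -
  have "{as \<in> tuples (wt_ar V w) (univ A). P as} = {as \<in> tuples (wt_ar V w) (univ A). P as \<and> Q as} \<union>
      {as \<in> tuples (wt_ar V w) (univ A). P as \<and> \<not> Q as}" by blast
  then show ?thesis unfolding wsum_def using wt_carrier[OF A w] finite_univ[OF A]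
    by (simp only:) (rule G.finsum_Un_disjoint, auto)
qed

text \<open>Other tuples have weight zero by \<open>wt_support\<close>, so comparing conditions on
  cliques is enough.\<close>

lemma wsum_cong:
  assumes "\<And>as. as \<in> tuples (wt_ar V w) (univ A) \<Longrightarrow> clique A as \<Longrightarrow> P as = P' as"
  shows "wsum w A P = wsum w A P'"
proof -
  have z: "wt A w as = \<zero>\<^bsub>wgrp w\<^esub>" if as: "as \<in> tuples (wt_ar V w) (univ A)" "P as \<noteq> P' as" for as
  proof (rule ccontr)
    assume n: "wt A w as \<noteq> \<zero>\<^bsub>wgrp w\<^esub>"
    have "near V A 1 (hd as) b" if "b \<in> set as" for b
      using wt_support[OF A w as(1) n hd_in_set that] that by fastforce
    then show False using assms as by (auto simp: clique_def)
  qed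
  show ?thesis unfolding wsum_def
    by (rule G.add.finprod_mono_neutral_cong) (use z finite_univ[OF A] wt_carrier[OF A w] in auto)
qed

end

text \<open>
  The list \<open>tab\<close> tabulates the addition of a finite group; its zero is the \<open>a\<close> with \<open>a + a = a\<close>.  In
  \<open>sum_near\<close> a tuple near several variables of \<open>X\<close> is counted at the last of these.
\<close>

primrec sum_near :: "('v \<times> 'v \<times> 'v) list \<Rightarrow> nat \<Rightarrow> nat \<Rightarrow> nat \<Rightarrow> nat list \<Rightarrow> ('s, 'v) bc \<Rightarrow> nat list \<Rightarrow> (('s, 'v) bc \<times> 'v) list" where
  "sum_near tab w \<rho> d ys \<Phi> [] = map (\<lambda>t. (BTop, fst t)) (filter (\<lambda>t. fst (snd t) = fst t \<and> snd (snd t) = fst t) tab)"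
| "sum_near tab w \<rho> d ys \<Phi> (x # X) = concat (map (\<lambda>t. map (\<lambda>p.
       (BAnd (near_bc (WSum (fst t) w ys) \<rho> d x ys
          (BAnd \<Phi> (BConj (map (\<lambda>x'. BNeg (Local (dl d x' (hd ys)))) X)))) (fst p), snd (snd t)))
     (filter (\<lambda>p. snd p = fst (snd t)) (sum_near tab w \<rho> d ys \<Phi> X))) tab)"

text \<open>
  With \<open>\<theta>\<close> equivalent to \<open>\<Phi>\<close> far from \<open>X\<close>, the far part \<open>u\<close> of the sum over \<open>\<Phi>\<close> is the aggregate over \<open>\<theta>\<close>
  minus the part near \<open>X\<close>.
\<close>

definition norm_sum :: "('v \<times> 'v \<times> 'v) list \<Rightarrow> nat list \<Rightarrow> 'v \<Rightarrow> nat \<Rightarrow> nat list \<Rightarrow> ('s, 'v) bc \<times> nat \<Rightarrow> ('s, 'v) bc \<times> nat" where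
  "norm_sum tab X s w ys q =
    (BDisj (concat (map (\<lambda>p. concat (map (\<lambda>p1. concat (map (\<lambda>p2.
       map (\<lambda>t. BAnd (fst p) (BAnd (fst p1) (BAnd (fst p2) (Agg (WSum (snd (snd t)) w ys (And (clique_fm ys) (snd p)))))))
         (filter (\<lambda>t. fst t = snd p2 \<and> (snd p1, fst (snd t), s) \<in> set tab) tab))
       (sum_near tab w (snd q + 2) (snd q + 2) ys (Local (And (clique_fm ys) (snd p))) X)))
       (sum_near tab w (snd q + 2) (snd q + 2) ys (fst q) X)))
       (cases_bc (far_leaf ys) (fst q)))),
     2 * ((snd q + 2) + (snd q + 2) + 1))"

section \<open>Near and far parts of a sum\<close>

context
  fixes w tab and s :: 'v and ys :: "nat list"
  assumes fw: "\<And>\<phi> s'. fow1 V \<phi> \<Longrightarrow> s' \<in> carrier (wgrp w) \<Longrightarrow> fow1 V (WSum s' w ys \<phi>)"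
    and w: "w \<in> wt_syms V" and ysl: "length ys = wt_ar V w" "distinct ys" "ys \<noteq> []"
    and tab: "set tab = {(a, b, a \<oplus>\<^bsub>wgrp w\<^esub> b) |a b. a \<in> carrier (wgrp w) \<and> b \<in> carrier (wgrp w)}"
begin

interpretation G: abelian_group "wgrp w" by (rule wgrp)

lemma wsum_quantifier:
  assumes "s' \<in> carrier (wgrp w)"
  shows "quantifier ys (WSum s' w ys) (\<lambda>W T. s' = finsum (wgrp w) (W w) T)"
  using ysl fw[OF fow1_Top assms] by (intro quantifier_WSum) auto

lemma ok_far_conj:
  assumes "ok Y \<rho> \<Phi>" "d \<le> \<rho>"
  shows "ok (Y \<union> set X \<union> set ys) \<rho> (BAnd \<Phi> (BConj (map (\<lambda>x'. BNeg (Local (dl d x' (hd ys)))) X)))"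
  using assms(1) hd_in_set[OF ysl(3)] by (auto intro!: lf_dl[OF assms(2)] intro: ok_mono)

text \<open>Each entry guesses the contribution of every variable in \<open>X\<close>, and its guard
  verifies the guesses, so any entry with a true guard carries the correct near part. The near part
  is specified as what complements the far part to the whole sum.\<close>

lemma sum_near:
  assumes ok: "ok Y \<rho> \<Phi>" and d: "d \<le> \<rho>" and X: "set X \<inter> set ys = {}"
  shows "(\<forall>p\<in>set (sum_near tab w \<rho> d ys \<Phi> X). ok (set X \<union> (Y - set ys)) (2 * (d + \<rho> + 1)) (fst p)) \<and>
   (\<forall>A\<in>K. \<forall>\<beta>. \<beta> ` (set X \<union> (Y - set ys)) \<subseteq> univ A \<longrightarrow>
     (\<exists>p\<in>set (sum_near tab w \<rho> d ys \<Phi> X). bsat A \<beta> (fst p)) \<and>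
     (\<forall>p\<in>set (sum_near tab w \<rho> d ys \<Phi> X). bsat A \<beta> (fst p) \<longrightarrow> snd p \<in> carrier (wgrp w) \<and>
       snd p \<oplus>\<^bsub>wgrp w\<^esub> wsum w A (\<lambda>as. bsat A (upd \<beta> ys as) \<Phi> \<and> (\<forall>x\<in>set X. \<not> near V A d (\<beta> x) (hd as))) =
       wsum w A (\<lambda>as. bsat A (upd \<beta> ys as) \<Phi>)))"
  using X
proof (induction X)
  case Nil
  have z: "a = \<zero>\<^bsub>wgrp w\<^esub>" if "a \<in> carrier (wgrp w)" "a \<oplus>\<^bsub>wgrp w\<^esub> a = a" for a
    using that by (simp add: G.add.l_cancel_one)
  have mem: "p \<in> set (sum_near tab w \<rho> d ys \<Phi> []) \<longleftrightarrow> p = (BTop, \<zero>\<^bsub>wgrp w\<^esub>)" for p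
  proof -
    have "p \<in> set (sum_near tab w \<rho> d ys \<Phi> []) \<longleftrightarrow> (\<exists>a. (a, a, a) \<in> set tab \<and> p = (BTop, a))" by (force simp: image_iff)
    also have "\<dots> \<longleftrightarrow> p = (BTop, \<zero>\<^bsub>wgrp w\<^esub>)" unfolding tab using z by auto
    finally show ?thesis .
  qed
  have "set (sum_near tab w \<rho> d ys \<Phi> []) = {(BTop, \<zero>\<^bsub>wgrp w\<^esub>)}" using mem by blast
  then show ?case using wsum_closed[OF _ w] by (simp del: sum_near.simps)
next
  case (Cons x X)
  let ?S = "sum_near tab w \<rho> d ys \<Phi> X"
  let ?\<Psi> = "BAnd \<Phi> (BConj (map (\<lambda>x'. BNeg (Local (dl d x' (hd ys)))) X))"
  have x: "x \<notin> set ys" and X: "set X \<inter> set ys = {}" using Cons.prems by auto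
  have IHok: "ok (set X \<union> (Y - set ys)) (2 * (d + \<rho> + 1)) (fst p)" if "p \<in> set ?S" for p
    using Cons.IH[OF X] that by blast
  have ok\<Psi>: "ok (Y \<union> set X \<union> set ys) \<rho> ?\<Psi>" by (rule ok_far_conj[OF ok d])
  have sub: "insert x ((Y \<union> set X \<union> set ys) - set ys) = set (x # X) \<union> (Y - set ys)" using X by auto
  have mem: "p \<in> set (sum_near tab w \<rho> d ys \<Phi> (x # X)) \<longleftrightarrow>
      (\<exists>a\<in>carrier (wgrp w). \<exists>q\<in>set ?S. snd q \<in> carrier (wgrp w) \<and>
         p = (BAnd (near_bc (WSum a w ys) \<rho> d x ys ?\<Psi>) (fst q), a \<oplus>\<^bsub>wgrp w\<^esub> snd q))" for p
  proof -
    have "p \<in> set (sum_near tab w \<rho> d ys \<Phi> (x # X)) \<longleftrightarrow> (\<exists>t\<in>set tab. \<exists>q\<in>set ?S. snd q = fst (snd t) \<and>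
         p = (BAnd (near_bc (WSum (fst t) w ys) \<rho> d x ys ?\<Psi>) (fst q), snd (snd t)))"
      unfolding sum_near.simps mem_concat_map_filter ..
    also have "\<dots> \<longleftrightarrow> (\<exists>a\<in>carrier (wgrp w). \<exists>q\<in>set ?S. snd q \<in> carrier (wgrp w) \<and>
         p = (BAnd (near_bc (WSum a w ys) \<rho> d x ys ?\<Psi>) (fst q), a \<oplus>\<^bsub>wgrp w\<^esub> snd q))"
      unfolding tab by force
    finally show ?thesis .
  qed
  show ?case
  proof (intro conjI ballI allI impI)
    fix p assume "p \<in> set (sum_near tab w \<rho> d ys \<Phi> (x # X))"
    then obtain a q where a: "a \<in> carrier (wgrp w)" and q: "q \<in> set ?S"
      and p: "p = (BAnd (near_bc (WSum a w ys) \<rho> d x ys ?\<Psi>) (fst q), a \<oplus>\<^bsub>wgrp w\<^esub> snd q)"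
      unfolding mem by blast
    have "ok (set (x # X) \<union> (Y - set ys)) (2 * (d + \<rho> + 1)) (near_bc (WSum a w ys) \<rho> d x ys ?\<Psi>)"
      using ok_near_bc[OF wsum_quantifier[OF a] x ok\<Psi>, of d] unfolding sub .
    moreover have "ok (set (x # X) \<union> (Y - set ys)) (2 * (d + \<rho> + 1)) (fst q)"
      by (rule ok_mono[OF IHok[OF q]]) auto
    ultimately show "ok (set (x # X) \<union> (Y - set ys)) (2 * (d + \<rho> + 1)) (fst p)" by (simp add: p)
  next
    fix A \<beta> assume A: "A \<in> K" and \<beta>: "\<beta> ` (set (x # X) \<union> (Y - set ys)) \<subseteq> univ A"
    let ?B = "\<lambda>as. bsat A (upd \<beta> ys as) \<Phi>"
    let ?far = "\<lambda>X as. \<forall>x\<in>set X. \<not> near V A d (\<beta> x) (hd as)"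
    let ?nr = "wsum w A (\<lambda>as. (?B as \<and> ?far X as) \<and> near V A d (\<beta> x) (hd as))"
    have \<beta>': "\<beta> ` (set X \<union> (Y - set ys)) \<subseteq> univ A" using \<beta> by auto
    have IH: "\<exists>p\<in>set ?S. bsat A \<beta> (fst p)"
      "\<And>q. q \<in> set ?S \<Longrightarrow> bsat A \<beta> (fst q) \<Longrightarrow> snd q \<in> carrier (wgrp w) \<and>
         snd q \<oplus>\<^bsub>wgrp w\<^esub> wsum w A (\<lambda>as. ?B as \<and> ?far X as) = wsum w A ?B"
      using Cons.IH[OF X] A \<beta>' by blast+
    have near: "bsat A \<beta> (near_bc (WSum a w ys) \<rho> d x ys ?\<Psi>) \<longleftrightarrow> a = ?nr" if a: "a \<in> carrier (wgrp w)" for a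
    proof -
      have far: "bsat A (upd \<beta> ys as) ?\<Psi> \<longleftrightarrow> ?B as \<and> ?far X as" if as: "as \<in> tuples (wt_ar V w) (univ A)" for as
      proof -
        have l: "length as = length ys" "set as \<subseteq> univ A" using as ysl(1) by (auto simp: tuples_def)
        have "hd as \<in> univ A" using l ysl(3) by (cases as) auto
        then have "sat V A (upd \<beta> ys as) (dl d x' (hd ys)) \<longleftrightarrow> near V A d (\<beta> x') (hd as)" if x': "x' \<in> set X" for x'
        proof -
          have "x' \<notin> set ys" "\<beta> x' \<in> univ A" using X \<beta>' x' by auto
          then show ?thesis using sat_dl[OF A, of "upd \<beta> ys as" x' "hd ys" d] \<open>hd as \<in> univ A\<close>
            by (simp add: upd_notin upd_hd[OF l(1) ysl(3)])
        qed
        then show ?thesis by simp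
      qed
      have "bsat A \<beta> (near_bc (WSum a w ys) \<rho> d x ys ?\<Psi>) \<longleftrightarrow>
          a = finsum (wgrp w) (wt A w) {as \<in> tuples (length ys) (univ A). tnear A d (\<beta> x) as \<and> bsat A (upd \<beta> ys as) ?\<Psi>}"
        by (rule bsat_near_bc[OF wsum_quantifier[OF a] x ok\<Psi> A]) (use \<beta> sub in blast)
      also have "\<dots> \<longleftrightarrow> a = wsum w A (\<lambda>as. tnear A d (\<beta> x) as \<and> bsat A (upd \<beta> ys as) ?\<Psi>)"
        by (simp only: wsum_def ysl(1))
      also have "wsum w A (\<lambda>as. tnear A d (\<beta> x) as \<and> bsat A (upd \<beta> ys as) ?\<Psi>) = ?nr"
        by (rule wsum_cong[OF A w]) (use far in \<open>auto simp: tnear_def\<close>)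
      finally show ?thesis .
    qed
    \<comment> \<open>Tuples far from \<open>X\<close> are split by their distance to
      \<open>x\<close>; those near \<open>x\<close> are the ones that the new guard sums up.\<close>
    have split: "wsum w A (\<lambda>as. ?B as \<and> ?far X as) = ?nr \<oplus>\<^bsub>wgrp w\<^esub> wsum w A (\<lambda>as. ?B as \<and> ?far (x # X) as)"
    proof -
      have "wsum w A (\<lambda>as. ?B as \<and> ?far (x # X) as) = wsum w A (\<lambda>as. (?B as \<and> ?far X as) \<and> \<not> near V A d (\<beta> x) (hd as))"
        by (intro arg_cong[of _ _ "wsum w A"] ext) auto
      then show ?thesis by (simp only:) (rule wsum_split[OF A w])
    qed
    show "\<exists>p\<in>set (sum_near tab w \<rho> d ys \<Phi> (x # X)). bsat A \<beta> (fst p)"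
    proof -
      obtain q where q: "q \<in> set ?S" "bsat A \<beta> (fst q)" using IH(1) by blast
      let ?p = "(BAnd (near_bc (WSum ?nr w ys) \<rho> d x ys ?\<Psi>) (fst q), ?nr \<oplus>\<^bsub>wgrp w\<^esub> snd q)"
      have "?p \<in> set (sum_near tab w \<rho> d ys \<Phi> (x # X))"
        unfolding mem using q IH(2) wsum_closed[OF A w] by blast
      moreover have "bsat A \<beta> (fst ?p)"
        unfolding fst_conv bc_sat_BAnd using q(2) near[OF wsum_closed[OF A w]] by blast
      ultimately show ?thesis by (rule bexI[rotated])
    qed
    fix p assume "p \<in> set (sum_near tab w \<rho> d ys \<Phi> (x # X))" and bp: "bsat A \<beta> (fst p)"
    then obtain a q where a: "a \<in> carrier (wgrp w)" and q: "q \<in> set ?S"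
      and p: "p = (BAnd (near_bc (WSum a w ys) \<rho> d x ys ?\<Psi>) (fst q), a \<oplus>\<^bsub>wgrp w\<^esub> snd q)"
      unfolding mem by blast
    have an: "a = ?nr" using bp near[OF a] by (simp add: p)
    have "bsat A \<beta> (fst q)" using bp by (simp add: p)
    note IHq = IH(2)[OF q this]
    show "snd p \<in> carrier (wgrp w)" using a IHq by (simp add: p)
    have "snd p \<oplus>\<^bsub>wgrp w\<^esub> wsum w A (\<lambda>as. ?B as \<and> ?far (x # X) as) =
        snd q \<oplus>\<^bsub>wgrp w\<^esub> (?nr \<oplus>\<^bsub>wgrp w\<^esub> wsum w A (\<lambda>as. ?B as \<and> ?far (x # X) as))"
      using a IHq wsum_closed[OF A w] unfolding p an by (simp only: snd_conv G.a_ac)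
    also have "\<dots> = wsum w A ?B" using IHq split by simp
    finally show "snd p \<oplus>\<^bsub>wgrp w\<^esub> wsum w A (\<lambda>as. ?B as \<and> ?far (x # X) as) = wsum w A ?B" .
  qed
qed

text \<open>Far from \<open>X\<close> the combination and its replacement \<open>?\<theta> p\<close>
  have the same sum \<open>u\<close>. The guards determine both near parts, so the aggregation
  sentence over \<open>?\<theta> p\<close> fixes \<open>u\<close> by cancellation, and
  \<open>s\<close> must be the near part of the combination plus \<open>u\<close>.\<close>

lemma norm_sum:
  assumes ok: "ok Y (snd q) (fst q)" and Y: "Y - set ys \<subseteq> set X" and X: "set X \<inter> set ys = {}" and s: "s \<in> carrier (wgrp w)"
  shows "ok (set X) (snd (norm_sum tab X s w ys q)) (fst (norm_sum tab X s w ys q)) \<and>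
    (\<forall>A\<in>K. \<forall>\<beta>. \<beta> ` set X \<subseteq> univ A \<longrightarrow>
       bsat A \<beta> (fst (norm_sum tab X s w ys q)) = (s = wsum w A (\<lambda>as. bsat A (upd \<beta> ys as) (fst q))))"
proof -
  \<comment> \<open>The far case needs at least \<open>snd q + 1\<close>, and the variables of a
    clique formula may be at distance 2 from each other.\<close>
  let ?\<rho> = "snd q + 2"
  let ?\<theta> = "\<lambda>p. And (clique_fm ys) (snd p) :: ('s, 'v) fm"
  let ?cs = "cases_bc (far_leaf ys) (fst q)"
  let ?S = "sum_near tab w ?\<rho> ?\<rho> ys (fst q) X"
  let ?T = "\<lambda>p. sum_near tab w ?\<rho> ?\<rho> ys (Local (?\<theta> p)) X"
  let ?r = "2 * (?\<rho> + ?\<rho> + 1)"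
  have okq: "ok Y ?\<rho> (fst q)" by (rule ok_mono[OF ok]) auto
  have fm: "fow1 V (snd p)" "slocal (snd q) (snd p)" "free (snd p) \<subseteq> set ys" if "p \<in> set ?cs" for p
    using far_cases_fm[OF ysl(3,2) ok that] by auto
  have ft: "free (?\<theta> p) = set ys" if "p \<in> set ?cs" for p
    using fm[OF that] free_clique_fm[OF ysl(3)] by auto
  have lf\<theta>: "lf (set ys) ?\<rho> (?\<theta> p)" if p: "p \<in> set ?cs" for p
  proof -
    have "conn ?\<rho> (?\<theta> p)"
      unfolding conn_def ft[OF p]
    proof (intro ballI allI impI)
      fix A \<beta> x y assume A: "A \<in> K" "\<beta> ` set ys \<subseteq> univ A" "sat V A \<beta> (?\<theta> p)" and xy: "x \<in> set ys" "y \<in> set ys"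
      have "near V A 1 (\<beta> (hd ys)) (\<beta> z)" if z: "z \<in> set ys" for z
      proof -
        have "sat V A \<beta> (dl 1 (hd ys) z)" using A(3) z univ_nonempty[OF A(1)] by (simp add: clique_fm_def)
        moreover have "\<beta> (hd ys) \<in> univ A" "\<beta> z \<in> univ A" using A(2) z hd_in_set[OF ysl(3)] by blast+
        ultimately show ?thesis using sat_dl[OF A(1)] by blast
      qed
      then have "near V A 1 (\<beta> x) (\<beta> (hd ys))" "near V A 1 (\<beta> (hd ys)) (\<beta> y)" using xy near_sym by metis+
      then show "near V A ?\<rho> (\<beta> x) (\<beta> y)" by (rule near_trans_le) simp
    qed
    moreover have "slocal ?\<rho> (?\<theta> p)"
      by (intro slocal_And slocal_clique_fm slocal_mono[OF fm(2)[OF p]]) auto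
    ultimately show ?thesis
      using fm(1)[OF p] ysl(3) unfolding lf_def ft[OF p] by simp
  qed
  have agg: "local_agg_sentence V K r (WSum s' w ys (?\<theta> p))"
    if p: "p \<in> set ?cs" "s' \<in> carrier (wgrp w)" "?\<rho> \<le> r" for p s' r
  proof -
    have "fow1 V (?\<theta> p)" using lf\<theta>[OF p(1)] unfolding lf_def by blast
    then have f: "fow1 V (WSum s' w ys (?\<theta> p))" using p(2) by (rule fw)
    have l: "local_around V K r (?\<theta> p) (set ys)"
      using lf\<theta>[OF p(1)] ysl(3) by (intro local_aroundI[OF _ p(3)]) (simp_all add: lf_def)
    have "free (WSum s' w ys (?\<theta> p)) = {}" using ft[OF p(1)] by simp
    then show ?thesis unfolding local_agg_sentence_def using f l by blast
  qed
  have mem: "\<Psi> \<in> set (concat (map (\<lambda>p. concat (map (\<lambda>p1. concat (map (\<lambda>p2.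
       map (\<lambda>t. BAnd (fst p) (BAnd (fst p1) (BAnd (fst p2) (Agg (WSum (snd (snd t)) w ys (?\<theta> p))))))
         (filter (\<lambda>t. fst t = snd p2 \<and> (snd p1, fst (snd t), s) \<in> set tab) tab)) (?T p))) ?S)) ?cs)) \<longleftrightarrow>
     (\<exists>p\<in>set ?cs. \<exists>p1\<in>set ?S. \<exists>p2\<in>set (?T p). \<exists>u. u \<in> carrier (wgrp w) \<and> snd p1 \<in> carrier (wgrp w) \<and>
        snd p2 \<in> carrier (wgrp w) \<and> s = snd p1 \<oplus>\<^bsub>wgrp w\<^esub> u \<and>
        \<Psi> = BAnd (fst p) (BAnd (fst p1) (BAnd (fst p2) (Agg (WSum (snd p2 \<oplus>\<^bsub>wgrp w\<^esub> u) w ys (?\<theta> p))))))" for \<Psi>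
  proof -
    have "\<Psi> \<in> set (map (\<lambda>t. BAnd (fst p) (BAnd (fst p1) (BAnd (fst p2) (Agg (WSum (snd (snd t)) w ys (?\<theta> p))))))
         (filter (\<lambda>t. fst t = snd p2 \<and> (snd p1, fst (snd t), s) \<in> set tab) tab)) \<longleftrightarrow>
      (\<exists>u. u \<in> carrier (wgrp w) \<and> snd p1 \<in> carrier (wgrp w) \<and>
        snd p2 \<in> carrier (wgrp w) \<and> s = snd p1 \<oplus>\<^bsub>wgrp w\<^esub> u \<and>
        \<Psi> = BAnd (fst p) (BAnd (fst p1) (BAnd (fst p2) (Agg (WSum (snd p2 \<oplus>\<^bsub>wgrp w\<^esub> u) w ys (?\<theta> p))))))"
      for p :: "('s, 'v) bc \<times> ('s, 'v) fm" and p1 p2 :: "('s, 'v) bc \<times> 'v"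
      unfolding set_map set_filter tab by (auto simp: image_iff)
    then show ?thesis unfolding set_concat set_map by simp
  qed
  note S = sum_near[OF okq order_refl X]
  have XY: "set X \<union> (Y - set ys) = set X" "set X \<union> (set ys - set ys) = set X" using Y by auto
  have T: "(\<forall>p2\<in>set (?T p). ok (set X) ?r (fst p2)) \<and> (\<forall>A\<in>K. \<forall>\<beta>. \<beta> ` set X \<subseteq> univ A \<longrightarrow>
     (\<exists>p2\<in>set (?T p). bsat A \<beta> (fst p2)) \<and>
     (\<forall>p2\<in>set (?T p). bsat A \<beta> (fst p2) \<longrightarrow> snd p2 \<in> carrier (wgrp w) \<and>
       snd p2 \<oplus>\<^bsub>wgrp w\<^esub> wsum w A (\<lambda>as. sat V A (upd \<beta> ys as) (?\<theta> p) \<and> (\<forall>x\<in>set X. \<not> near V A ?\<rho> (\<beta> x) (hd as))) =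
       wsum w A (\<lambda>as. sat V A (upd \<beta> ys as) (?\<theta> p))))" if p: "p \<in> set ?cs" for p
    using sum_near[of "set ys" ?\<rho> "Local (?\<theta> p)" ?\<rho> X] lf\<theta>[OF p] X unfolding XY by simp
  show ?thesis
  proof (intro conjI ballI allI impI)
    have "ok (set X) ?r \<Psi>" if "p \<in> set ?cs" "p1 \<in> set ?S" "p2 \<in> set (?T p)" "u \<in> carrier (wgrp w)"
      "snd p2 \<in> carrier (wgrp w)"
      "\<Psi> = BAnd (fst p) (BAnd (fst p1) (BAnd (fst p2) (Agg (WSum (snd p2 \<oplus>\<^bsub>wgrp w\<^esub> u) w ys (?\<theta> p)))))"
      for \<Psi> p p1 p2 u
    proof -
      have "ok (set X) ?r (fst p)"
        by (rule ok_mono[OF far_cases_guard[OF ysl(3,2) ok that(1)] Y]) simp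
      moreover have "ok (set X) ?r (fst p1)" using S that(2) unfolding XY by blast
      moreover have "ok (set X) ?r (fst p2)" using T[OF that(1)] that(3) by blast
      moreover have "ok (set X) ?r (Agg (WSum (snd p2 \<oplus>\<^bsub>wgrp w\<^esub> u) w ys (?\<theta> p)))"
        using agg[OF that(1)] that(4,5) by simp
      ultimately show ?thesis using that(6) by simp
    qed
    then show "ok (set X) (snd (norm_sum tab X s w ys q)) (fst (norm_sum tab X s w ys q))"
      unfolding norm_sum_def fst_conv snd_conv ok_BDisj Ball_def mem by blast
    fix A \<beta> assume A: "A \<in> K" and \<beta>: "\<beta> ` set X \<subseteq> univ A"
    let ?B = "\<lambda>as. bsat A (upd \<beta> ys as) (fst q)"
    let ?far = "\<lambda>as. \<forall>x\<in>set X. \<not> near V A ?\<rho> (\<beta> x) (hd as)"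
    let ?W = "wsum w A"
    note cl = wsum_closed[OF A w]
    have S1: "\<exists>p1\<in>set ?S. bsat A \<beta> (fst p1)"
      "\<And>p1. p1 \<in> set ?S \<Longrightarrow> bsat A \<beta> (fst p1) \<Longrightarrow> snd p1 \<in> carrier (wgrp w) \<and>
         snd p1 \<oplus>\<^bsub>wgrp w\<^esub> ?W (\<lambda>as. ?B as \<and> ?far as) = ?W ?B"
      using S A \<beta> unfolding XY by blast+
    have T1: "\<exists>p2\<in>set (?T p). bsat A \<beta> (fst p2)"
      "\<And>p2. p2 \<in> set (?T p) \<Longrightarrow> bsat A \<beta> (fst p2) \<Longrightarrow> snd p2 \<in> carrier (wgrp w) \<and>
         snd p2 \<oplus>\<^bsub>wgrp w\<^esub> ?W (\<lambda>as. ?B as \<and> ?far as) = ?W (\<lambda>as. sat V A (upd \<beta> ys as) (?\<theta> p))"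
      if p: "p \<in> set ?cs" "bsat A \<beta> (fst p)" for p
    proof -
      \<comment> \<open>Only cliques carry weight, and at far cliques the guard makes the
        combination and its replacement equivalent.\<close>
      have eq: "?W (\<lambda>as. sat V A (upd \<beta> ys as) (?\<theta> p) \<and> ?far as) = ?W (\<lambda>as. ?B as \<and> ?far as)"
      proof (rule wsum_cong[OF A w])
        fix as assume as: "as \<in> tuples (wt_ar V w) (univ A)" "clique A as"
        then have as': "as \<in> tuples (length ys) (univ A)" using ysl(1) by simp
        have "sat V A (upd \<beta> ys as) (snd p) \<longleftrightarrow> ?B as" if far: "?far as"
        proof (rule far_cases_sound[OF ysl(3,2) ok A _ p as' as(2)])
          show "\<beta> ` (Y - set ys) \<subseteq> univ A" using \<beta> Y by blast
          show "\<not> near V A (snd q + 1) (\<beta> z) (hd as)" if "z \<in> Y - set ys" for z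
            using far that Y near_mono[of V A "snd q + 1" "\<beta> z" "hd as" ?\<rho>] by auto
        qed
        moreover have "sat V A (upd \<beta> ys as) (clique_fm ys)"
          using sat_clique_fm[OF A as' ysl(2,3)] as(2) by blast
        ultimately show "(sat V A (upd \<beta> ys as) (?\<theta> p) \<and> ?far as) = (?B as \<and> ?far as)" by auto
      qed
      note t = T[OF p(1), THEN conjunct2, THEN bspec, OF A, THEN spec, THEN mp, OF \<beta>, unfolded eq]
      show "\<exists>p2\<in>set (?T p). bsat A \<beta> (fst p2)"
        "\<And>p2. p2 \<in> set (?T p) \<Longrightarrow> bsat A \<beta> (fst p2) \<Longrightarrow> snd p2 \<in> carrier (wgrp w) \<and>
         snd p2 \<oplus>\<^bsub>wgrp w\<^esub> ?W (\<lambda>as. ?B as \<and> ?far as) = ?W (\<lambda>as. sat V A (upd \<beta> ys as) (?\<theta> p))"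
        using t by blast+
    qed
    have aggsat: "bsat A \<beta> (Agg (WSum s' w ys (?\<theta> p))) \<longleftrightarrow> s' = ?W (\<lambda>as. sat V A (upd \<beta> ys as) (?\<theta> p))" for s' p
      by (simp only: bc_sat.simps sat.simps wsum_def ysl(1))
    show "bsat A \<beta> (fst (norm_sum tab X s w ys q)) \<longleftrightarrow> s = ?W ?B"
    proof
      assume "bsat A \<beta> (fst (norm_sum tab X s w ys q))"
      then obtain p p1 p2 u where h: "p \<in> set ?cs" "p1 \<in> set ?S" "p2 \<in> set (?T p)" "u \<in> carrier (wgrp w)"
        "s = snd p1 \<oplus>\<^bsub>wgrp w\<^esub> u" "bsat A \<beta> (fst p)" "bsat A \<beta> (fst p1)" "bsat A \<beta> (fst p2)"
        "bsat A \<beta> (Agg (WSum (snd p2 \<oplus>\<^bsub>wgrp w\<^esub> u) w ys (?\<theta> p)))"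
        unfolding norm_sum_def fst_conv bsat_BDisj Bex_def mem by auto
      have p2: "snd p2 \<in> carrier (wgrp w)"
        "snd p2 \<oplus>\<^bsub>wgrp w\<^esub> ?W (\<lambda>as. ?B as \<and> ?far as) = ?W (\<lambda>as. sat V A (upd \<beta> ys as) (?\<theta> p))"
        using T1(2)[OF h(1,6,3,8)] by auto
      have eq: "snd p2 \<oplus>\<^bsub>wgrp w\<^esub> u = snd p2 \<oplus>\<^bsub>wgrp w\<^esub> ?W (\<lambda>as. ?B as \<and> ?far as)"
        using h(9) p2(2) unfolding aggsat by (rule trans[OF _ sym])
      have "u \<oplus>\<^bsub>wgrp w\<^esub> snd p2 = ?W (\<lambda>as. ?B as \<and> ?far as) \<oplus>\<^bsub>wgrp w\<^esub> snd p2"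
        unfolding G.a_comm[OF h(4) p2(1)] G.a_comm[OF cl p2(1)] by (rule eq)
      then have "u = ?W (\<lambda>as. ?B as \<and> ?far as)"
        using G.add.right_cancel[OF p2(1) h(4) cl] by blast
      then show "s = ?W ?B" using h(5) S1(2)[OF h(2,7)] by simp
    next
      assume s: "s = ?W ?B"
      have "\<exists>p\<in>set ?cs. bsat A \<beta> (fst p)" by (rule far_cases_exists[OF ysl(3,2) ok])
      then obtain p where p: "p \<in> set ?cs" "bsat A \<beta> (fst p)" by blast
      obtain p1 where p1: "p1 \<in> set ?S" "bsat A \<beta> (fst p1)" using S1(1) by blast
      obtain p2 where p2: "p2 \<in> set (?T p)" "bsat A \<beta> (fst p2)" using T1(1)[OF p] by blast
      let ?u = "?W (\<lambda>as. ?B as \<and> ?far as)"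
      let ?\<Psi> = "BAnd (fst p) (BAnd (fst p1) (BAnd (fst p2) (Agg (WSum (snd p2 \<oplus>\<^bsub>wgrp w\<^esub> ?u) w ys (?\<theta> p)))))"
      have "\<exists>p\<in>set ?cs. \<exists>p1\<in>set ?S. \<exists>p2\<in>set (?T p). \<exists>u. u \<in> carrier (wgrp w) \<and> snd p1 \<in> carrier (wgrp w) \<and>
        snd p2 \<in> carrier (wgrp w) \<and> s = snd p1 \<oplus>\<^bsub>wgrp w\<^esub> u \<and>
        ?\<Psi> = BAnd (fst p) (BAnd (fst p1) (BAnd (fst p2) (Agg (WSum (snd p2 \<oplus>\<^bsub>wgrp w\<^esub> u) w ys (?\<theta> p)))))"
        using p(1) p1(1) p2(1) cl S1(2)[OF p1] T1(2)[OF p p2] s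
        by (intro bexI[of _ p] bexI[of _ p1] bexI[of _ p2] exI[of _ ?u]) auto
      moreover have "bsat A \<beta> (Agg (WSum (snd p2 \<oplus>\<^bsub>wgrp w\<^esub> ?u) w ys (?\<theta> p)))"
        using T1(2)[OF p p2] unfolding aggsat by blast
      then have "bsat A \<beta> ?\<Psi>" using p p1 p2 unfolding bc_sat_BAnd by blast
      ultimately show "bsat A \<beta> (fst (norm_sum tab X s w ys q))"
        unfolding norm_sum_def fst_conv bsat_BDisj Bex_def mem by blast
    qed
  qed
qed

end


section \<open>The normal form\<close>

text \<open>Elements are opaque atoms, so group addition cannot be computed from their encodings.
  There are finitely many weight symbols, and the table of each finite group enters the algorithm as
  a constant; for infinite groups the list is arbitrary.\<close>

definition tab :: "nat \<Rightarrow> ('v \<times> 'v \<times> 'v) list" where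
  "tab w = (if w \<in> wt_syms V then
     SOME xs. finite (carrier (wgrp w)) \<longrightarrow>
       set xs = {(a, b, a \<oplus>\<^bsub>wgrp w\<^esub> b) |a b. a \<in> carrier (wgrp w) \<and> b \<in> carrier (wgrp w)}
     else [])"

text \<open>The empty list is a common value for all numbers that are no weight symbols, as
  \<open>eff_finite_support\<close> requires.\<close>

definition zeros :: "nat \<Rightarrow> 'v list" where
  "zeros w = (if w \<in> wt_syms V then [\<zero>\<^bsub>wgrp w\<^esub>] else [])"

text \<open>A relation of arity zero or a predicate on constants is a sentence and cannot be a local
  leaf. It becomes a count over the dummy variable \<open>0\<close>, which is positive iff the
  sentence holds, because universes are nonempty.\<close>

definition norm_atom :: "('s, 'v) fm \<Rightarrow> ('s, 'v) bc \<times> nat" where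
  "norm_atom \<phi> = (if fvl \<phi> = [] then Ge1 (clus 1 ([0], \<phi>)) else Local \<phi>, 1)"

text \<open>
  \<open>w(xs) \<noteq> 0\<close> forces the elements \<open>xs\<close> to be close, so \<open>s = w(xs)\<close> is a connected formula for \<open>s \<noteq> 0\<close> and the
  negation of one for \<open>s = 0\<close>.
\<close>

primrec nform :: "('s, 'v) fm \<Rightarrow> ('s, 'v) bc \<times> nat" where
  "nform (Eq x y) = (Local (Eq x y), 1)"
| "nform (Rel R xs) = norm_atom (Rel R xs)"
| "nform (WEq s w xs) = (if zeros w = [s] then BNeg (Local (Neg (WEq s w xs))) else Local (WEq s w xs), 1)"
| "nform (Neg \<phi>) = (BNeg (fst (nform \<phi>)), snd (nform \<phi>))"
| "nform (Or \<phi> \<psi>) = (BOr (fst (nform \<phi>)) (fst (nform \<psi>)), snd (nform \<phi>) + snd (nform \<psi>))"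
| "nform (Ex y \<phi>) = norm_ex (fvl (Ex y \<phi>)) y (nform \<phi>)"
| "nform (WSum s w ys \<phi>) = norm_sum (tab w) (fvl (WSum s w ys \<phi>)) s w ys (nform \<phi>)"
| "nform (Pred P ts) = norm_atom (Pred P ts)"

lemma set_tab:
  assumes "w \<in> wt_syms V" "finite (carrier (wgrp w))"
  shows "set (tab w) = {(a, b, a \<oplus>\<^bsub>wgrp w\<^esub> b) |a b. a \<in> carrier (wgrp w) \<and> b \<in> carrier (wgrp w)}" (is "_ = ?S")
proof -
  have "?S = (\<lambda>(a, b). (a, b, a \<oplus>\<^bsub>wgrp w\<^esub> b)) ` (carrier (wgrp w) \<times> carrier (wgrp w))" by auto
  then have "finite ?S" using assms(2) by simp
  then obtain xs where "set xs = ?S" using finite_list[of ?S] by metis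
  then have "\<exists>xs. finite (carrier (wgrp w)) \<longrightarrow> set xs = ?S" by (intro exI impI)
  then have "finite (carrier (wgrp w)) \<longrightarrow> set (SOME xs. finite (carrier (wgrp w)) \<longrightarrow> set xs = ?S) = ?S"
    by (rule someI_ex)
  then show ?thesis unfolding tab_def if_P[OF assms(1)] by (rule mp[OF _ assms(2)])
qed

definition norm_ok :: "('s, 'v) fm \<Rightarrow> ('s, 'v) bc \<times> nat \<Rightarrow> bool" where
  "norm_ok \<phi> p \<longleftrightarrow> ok (free \<phi>) (snd p) (fst p) \<and>
     (\<forall>A\<in>K. \<forall>\<beta>. \<beta> ` free \<phi> \<subseteq> univ A \<longrightarrow> bsat A \<beta> (fst p) = sat V A \<beta> \<phi>)"

lemma norm_ok_atom:
  assumes "fow1 V \<phi>" "slocal 1 \<phi>" "conn 1 \<phi>"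
  shows "norm_ok \<phi> (norm_atom \<phi>)"
proof (cases "fvl \<phi> = []")
  case True
  then have f: "free \<phi> = {}" using set_fvl[of \<phi>] by simp
  \<comment> \<open>A cluster with a single variable has diameter 0, so \<open>R = 0\<close> is
    possible.\<close>
  have C: "good_cluster 1 0 ([0], \<phi>)" using assms f by (simp add: good_cluster_def)
  have "bsat A \<beta> (Ge1 (clus 1 ([0], \<phi>))) = sat V A \<beta> \<phi>" if A: "A \<in> K" for A \<beta>
  proof -
    have v: "cl_val V A \<beta> Z (clus 1 ([0], \<phi>)) = \<iota> (ncl A ([0], \<phi>))"
      by (rule cl_val_clus[OF C _ _ A]) auto
    have fin: "finite ({0} \<rightarrow>\<^sub>E univ A)" "{0} \<rightarrow>\<^sub>E univ A \<noteq> {}"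
      using finite_univ[OF A] univ_nonempty[OF A] by (auto intro: finite_PiE simp: PiE_eq_empty_iff)
    then have c: "card ({0::nat} \<rightarrow>\<^sub>E univ A) \<ge> 1" by (simp add: Suc_le_eq card_gt_0_iff)
    have "sat V A f \<phi> = sat V A \<beta> \<phi>" for f by (rule sat_cong) (simp add: f)
    then have "ncl A ([0], \<phi>) = (\<Sum>f\<in>{0::nat} \<rightarrow>\<^sub>E univ A. of_bool (sat V A \<beta> \<phi>))"
      unfolding ncl_def by (intro sum.cong) auto
    then have "ncl A ([0], \<phi>) = int (card ({0::nat} \<rightarrow>\<^sub>E univ A)) * of_bool (sat V A \<beta> \<phi>)"
      by simp
    then show ?thesis using v c by auto
  qed
  moreover have "ok (free \<phi>) 1 (Ge1 (clus 1 ([0], \<phi>)))"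
    using cl_free_clus[OF C] clus_cl_term[OF C _ order_refl] by simp
  ultimately show ?thesis using True by (simp add: norm_ok_def norm_atom_def)
next
  case False
  then have "free \<phi> \<noteq> {}" using set_fvl[of \<phi>] by (metis set_empty)
  then show ?thesis using False assms by (simp add: norm_ok_def norm_atom_def lf_def)
qed

lemma conn_Rel: "fow1 V (Rel R xs) \<Longrightarrow> conn 1 (Rel R xs)"
  unfolding conn_def
proof (intro ballI allI impI)
  fix A \<beta> x y
  assume R: "fow1 V (Rel R xs)" and A: "A \<in> K" "\<beta> ` free (Rel R xs) \<subseteq> univ A" "sat V A \<beta> (Rel R xs)"
    "x \<in> free (Rel R xs)" "y \<in> free (Rel R xs)"
  have "\<beta> x \<in> set (map \<beta> xs)" "\<beta> y \<in> set (map \<beta> xs)" "\<beta> x \<in> univ A" "\<beta> y \<in> univ A" using A by auto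
  moreover have "map \<beta> xs \<in> rel A R" "R \<in> rel_syms V" using A R by auto
  ultimately have "\<beta> x = \<beta> y \<or> (\<beta> x, \<beta> y) \<in> gaifman V A" unfolding gaifman_def by blast
  then show "near V A 1 (\<beta> x) (\<beta> y)" unfolding One_nat_def near_Suc by auto
qed

text \<open>This is where the restriction of predicates to one free variable enters.\<close>

lemma conn_Pred: "fow1 V (Pred P ts) \<Longrightarrow> conn 1 (Pred P ts)"
  unfolding conn_def
proof (intro ballI allI impI)
  fix A \<beta> x y
  assume P: "fow1 V (Pred P ts)" and xy: "x \<in> free (Pred P ts)" "y \<in> free (Pred P ts)"
  have "card (free (Pred P ts)) \<le> 1" "finite (free (Pred P ts))" using P by auto
  then have "x = y" using xy card_le_Suc0_iff_eq[of "free (Pred P ts)"] by auto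
  then show "near V A 1 (\<beta> x) (\<beta> y)" by simp
qed

lemma norm_ok_WEq:
  assumes "fow1 V (WEq s w xs)"
  shows "norm_ok (WEq s w xs) (nform (WEq s w xs))"
proof -
  have w: "w \<in> wt_syms V" "length xs = wt_ar V w" using assms by auto
  \<comment> \<open>Weight symbols have positive arity, so the leaf has a free variable.\<close>
  then have ne: "xs \<noteq> []" using voc by (auto simp: vocabulary_def)
  have supp: "near V A 1 (\<beta> x) (\<beta> y)" if "A \<in> K" "\<beta> ` set xs \<subseteq> univ A" "x \<in> set xs" "y \<in> set xs"
    "wt A w (map \<beta> xs) \<noteq> \<zero>\<^bsub>wgrp w\<^esub>" for A \<beta> x y
    using wt_support[OF that(1) w(1) _ that(5)] that w(2) by (auto simp: tuples_def)
  show ?thesis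
  proof (cases "s = \<zero>\<^bsub>wgrp w\<^esub>")
    case True
    then have "conn 1 (Neg (WEq s w xs))" using supp by (auto simp: conn_def)
    then show ?thesis using True assms w ne by (simp add: norm_ok_def zeros_def lf_def)
  next
    case False
    then have "conn 1 (WEq s w xs)" using supp by (auto simp: conn_def)
    then show ?thesis using False assms w ne by (simp add: norm_ok_def zeros_def lf_def)
  qed
qed

lemma norm_correct: "fow1 V \<phi> \<Longrightarrow> norm_ok \<phi> (nform \<phi>)"
proof (induction \<phi>)
  case (Eq x y)
  have "conn 1 (Eq x y :: ('s, 'v) fm)" by (auto simp: conn_def)
  then show ?case by (simp add: norm_ok_def lf_def)
next
  case (Rel R xs)
  then show ?case unfolding nform.simps by (intro norm_ok_atom slocal_Rel conn_Rel)
next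
  case (WEq s w xs)
  then show ?case by (rule norm_ok_WEq)
next
  case (Neg \<phi>)
  then show ?case by (simp add: norm_ok_def)
next
  case (Or \<phi> \<psi>)
  then have IH: "norm_ok \<phi> (nform \<phi>)" "norm_ok \<psi> (nform \<psi>)" by auto
  have "ok (free (Or \<phi> \<psi>)) (snd (nform (Or \<phi> \<psi>))) (fst (nform \<phi>))"
    by (rule ok_mono[of "free \<phi>" "snd (nform \<phi>)"]) (use IH in \<open>simp_all add: norm_ok_def\<close>)
  moreover have "ok (free (Or \<phi> \<psi>)) (snd (nform (Or \<phi> \<psi>))) (fst (nform \<psi>))"
    by (rule ok_mono[of "free \<psi>" "snd (nform \<psi>)"]) (use IH in \<open>simp_all add: norm_ok_def\<close>)
  ultimately show ?case using IH by (simp add: norm_ok_def image_Un)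
next
  case (Ex y \<phi>)
  let ?X = "fvl (Ex y \<phi>)"
  have IH: "ok (free \<phi>) (snd (nform \<phi>)) (fst (nform \<phi>))"
    "\<And>A \<beta>. A \<in> K \<Longrightarrow> \<beta> ` free \<phi> \<subseteq> univ A \<Longrightarrow> bsat A \<beta> (fst (nform \<phi>)) = sat V A \<beta> \<phi>"
    using Ex by (auto simp: norm_ok_def)
  have X: "set ?X = free (Ex y \<phi>)" by (rule set_fvl)
  have N: "ok (free (Ex y \<phi>)) (snd (nform (Ex y \<phi>))) (fst (nform (Ex y \<phi>))) \<and>
    (\<forall>A\<in>K. \<forall>\<beta>. \<beta> ` free (Ex y \<phi>) \<subseteq> univ A \<longrightarrow>
       bsat A \<beta> (fst (nform (Ex y \<phi>))) = (\<exists>a\<in>univ A. bsat A (\<beta>(y := a)) (fst (nform \<phi>))))"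
    using norm_ex[OF IH(1), of y ?X] unfolding X by simp
  have "bsat A (\<beta>(y := a)) (fst (nform \<phi>)) = sat V A (\<beta>(y := a)) \<phi>"
    if "A \<in> K" "\<beta> ` free (Ex y \<phi>) \<subseteq> univ A" "a \<in> univ A" for A \<beta> a
    by (rule IH(2)) (use that in auto)
  then show ?case using N by (simp add: norm_ok_def del: nform.simps)
next
  case (WSum s w ys \<phi>)
  let ?X = "fvl (WSum s w ys \<phi>)"
  have IH: "ok (free \<phi>) (snd (nform \<phi>)) (fst (nform \<phi>))"
    "\<And>A \<beta>. A \<in> K \<Longrightarrow> \<beta> ` free \<phi> \<subseteq> univ A \<Longrightarrow> bsat A \<beta> (fst (nform \<phi>)) = sat V A \<beta> \<phi>"
    using WSum by (auto simp: norm_ok_def)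
  have X: "set ?X = free (WSum s w ys \<phi>)" by (rule set_fvl)
  have w: "w \<in> wt_syms V" "finite (carrier (wgrp w))" "s \<in> carrier (wgrp w)" "length ys = wt_ar V w" "distinct ys"
    using WSum.prems by auto
  have ne: "ys \<noteq> []" using w voc by (auto simp: vocabulary_def)
  have N: "ok (free (WSum s w ys \<phi>)) (snd (nform (WSum s w ys \<phi>))) (fst (nform (WSum s w ys \<phi>))) \<and>
    (\<forall>A\<in>K. \<forall>\<beta>. \<beta> ` free (WSum s w ys \<phi>) \<subseteq> univ A \<longrightarrow>
       bsat A \<beta> (fst (nform (WSum s w ys \<phi>))) = (s = wsum w A (\<lambda>as. bsat A (upd \<beta> ys as) (fst (nform \<phi>)))))"
    unfolding nform.simps X[symmetric]
    by (rule norm_sum[OF _ w(1,4,5) ne set_tab[OF w(1,2)] IH(1) _ _ w(3)]) (use w in auto)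
  have "wsum w A (\<lambda>as. bsat A (upd \<beta> ys as) (fst (nform \<phi>))) = wsum w A (\<lambda>as. sat V A (upd \<beta> ys as) \<phi>)"
    if A: "A \<in> K" "\<beta> ` free (WSum s w ys \<phi>) \<subseteq> univ A" for A \<beta>
  proof (rule wsum_cong[OF A(1) w(1)])
    fix as assume "as \<in> tuples (wt_ar V w) (univ A)"
    then show "bsat A (upd \<beta> ys as) (fst (nform \<phi>)) = sat V A (upd \<beta> ys as) \<phi>"
      using A w(4) by (intro IH(2) upd_image_subset) auto
  qed
  then have "\<forall>A\<in>K. \<forall>\<beta>. \<beta> ` free (WSum s w ys \<phi>) \<subseteq> univ A \<longrightarrow>
       bsat A \<beta> (fst (nform (WSum s w ys \<phi>))) = sat V A \<beta> (WSum s w ys \<phi>)"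
    using N w(4) by (simp add: wsum_def del: nform.simps)
  then show ?case using N unfolding norm_ok_def by blast
next
  case (Pred P ts)
  then show ?case unfolding nform.simps by (intro norm_ok_atom slocal_Pred conn_Pred)
qed

text \<open>The same number is reported for all ground cl-terms and for the local formulas, since
  radii are upper bounds and the invariant \<open>ok\<close> shares one value.\<close>

theorem nform_properties:
  assumes "fow1 V \<phi>"
  defines "\<Phi> \<equiv> fst (nform \<phi>)" and "r \<equiv> snd (nform \<phi>)"
  shows "normal_form V K Z (free \<phi>) \<Phi>" "equivalent_on V K Z \<iota> \<phi> \<Phi>"
    "list_all2 (\<lambda>g r'. cl_term V K r' g Z) (cl_leaves \<Phi>) (map (\<lambda>_. r) (cl_leaves \<Phi>))"
    "\<forall>\<psi>\<in>local_leaves \<Phi>. local_around V K r \<psi> (free \<psi>)"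
    "\<forall>\<chi>\<in>agg_leaves \<Phi>. local_agg_sentence V K r \<chi>"
proof -
  have n: "norm_ok \<phi> (nform \<phi>)" by (rule norm_correct[OF assms(1)])
  then have ok: "ok (free \<phi>) r \<Phi>" by (simp add: norm_ok_def \<Phi>_def r_def)
  show l: "\<forall>\<psi>\<in>local_leaves \<Phi>. local_around V K r \<psi> (free \<psi>)"
    using ok by (auto simp: ok_def lf_def intro: local_aroundI)
  show a: "\<forall>\<chi>\<in>agg_leaves \<Phi>. local_agg_sentence V K r \<chi>" using ok by (simp add: ok_def)
  have c: "\<forall>g\<in>set (cl_leaves \<Phi>). cl_free g = {} \<and> cl_term V K r g Z" using ok by (simp add: ok_def)
  then show "list_all2 (\<lambda>g r'. cl_term V K r' g Z) (cl_leaves \<Phi>) (map (\<lambda>_. r) (cl_leaves \<Phi>))"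
    by (simp add: list_all2_conv_all_nth)
  have "\<forall>\<psi>\<in>local_leaves \<Phi>. fow1 V \<psi> \<and> free \<psi> \<subseteq> free \<phi>" using ok by (simp add: ok_def lf_def)
  then show "normal_form V K Z (free \<phi>) \<Phi>" using l a c unfolding normal_form_def by blast
  show "equivalent_on V K Z \<iota> \<phi> \<Phi>" using n by (simp add: norm_ok_def equivalent_on_def \<Phi>_def)
qed

end

section \<open>Computability on encodings\<close>

text \<open>Computability relative to encodings of arguments and values; trees that encode no
  argument are unconstrained.\<close>

definition effective :: "('x \<Rightarrow> 'c tree) \<Rightarrow> ('y \<Rightarrow> 'c tree) \<Rightarrow> ('x \<Rightarrow> 'y) \<Rightarrow> bool" where
  "effective e e' f \<longleftrightarrow> (\<exists>F. computable F \<and> (\<forall>x. F (e x) = e' (f x)))"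

definition enc_pair :: "('x \<Rightarrow> 'c tree) \<Rightarrow> ('y \<Rightarrow> 'c tree) \<Rightarrow> 'x \<times> 'y \<Rightarrow> 'c tree" where
  "enc_pair e e' p = Node (e (fst p)) (e' (snd p))"

definition enc_bool :: "bool \<Rightarrow> 'c tree" where
  "enc_bool b = (if b then Leaf else Node Leaf Leaf)"

text \<open>The rules follow the syntax of terms, so computability of most definitions results from
  unfolding them and applying rules.\<close>

named_theorems eff_intros

lemma computable_left: "computable f \<Longrightarrow> computable (\<lambda>x. left (f x))"
  by (rule computable.comp[OF computable.left])

lemma computable_right: "computable f \<Longrightarrow> computable (\<lambda>x. right (f x))"
  by (rule computable.comp[OF computable.right])

lemmas computable_intros = computable.ident computable_left computable_right computable.node computable.const

lemma effI: "computable F \<Longrightarrow> (\<And>x. F (e x) = e' (f x)) \<Longrightarrow> effective e e' f"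
  unfolding effective_def by blast

lemma effE:
  assumes "effective e e' f"
  obtains F where "computable F" "\<forall>x. F (e x) = e' (f x)"
  using assms unfolding effective_def by blast

lemma eff_id [eff_intros]: "effective e e (\<lambda>x. x)"
  by (rule effI[OF computable.ident]) simp

text \<open>Constants may contain atoms; through them the algorithm knows the fixed elements and
  types of the vocabulary.\<close>

lemma eff_const: "effective e e' (\<lambda>x. c)"
  by (rule effI[OF computable.const]) simp

lemma eff_comp:
  assumes "effective e1 e2 g" "effective e e1 f" shows "effective e e2 (\<lambda>x. g (f x))"
proof -
  obtain F where F: "computable F" "\<forall>x. F (e x) = e1 (f x)" using assms(2) by (rule effE)
  obtain G where G: "computable G" "\<forall>x. G (e1 x) = e2 (g x)" using assms(1) by (rule effE)
  show ?thesis by (rule effI[OF computable.comp[OF G(1) F(1)]]) (simp add: F G)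
qed

lemma eff_node:
  assumes "effective e e1 f" "effective e e2 g" "\<And>x. e' (h x) = Node (e1 (f x)) (e2 (g x))"
  shows "effective e e' h"
proof -
  obtain F where F: "computable F" "\<forall>x. F (e x) = e1 (f x)" using assms(1) by (rule effE)
  obtain G where G: "computable G" "\<forall>x. G (e x) = e2 (g x)" using assms(2) by (rule effE)
  show ?thesis by (rule effI[OF computable.node[OF F(1) G(1)]]) (simp add: F G assms(3))
qed

lemma eff_Pair [eff_intros]: "effective e e1 f \<Longrightarrow> effective e e2 g \<Longrightarrow> effective e (enc_pair e1 e2) (\<lambda>x. (f x, g x))"
  by (rule eff_node[of e e1 f e2 g]) (auto simp: enc_pair_def)

lemma eff_fst [eff_intros]:
  assumes "effective e (enc_pair e1 e2) f" shows "effective e e1 (\<lambda>x. fst (f x))"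
proof -
  obtain F where F: "computable F" "\<forall>x. F (e x) = enc_pair e1 e2 (f x)" using assms by (rule effE)
  show ?thesis by (rule effI[OF computable_left[OF F(1)]]) (simp add: F enc_pair_def)
qed

lemma eff_snd [eff_intros]:
  assumes "effective e (enc_pair e1 e2) f" shows "effective e e2 (\<lambda>x. snd (f x))"
proof -
  obtain F where F: "computable F" "\<forall>x. F (e x) = enc_pair e1 e2 (f x)" using assms by (rule effE)
  show ?thesis by (rule effI[OF computable_right[OF F(1)]]) (simp add: F enc_pair_def)
qed

text \<open>A function of several arguments is treated as a function of one encoded tuple; this rule
  applies it to computed arguments.\<close>

lemma eff_app2:
  assumes "effective (enc_pair e1 e2) e' (\<lambda>p. g (fst p) (snd p))" "effective e e1 a" "effective e e2 b"
  shows "effective e e' (\<lambda>x. g (a x) (b x))"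
  using eff_comp[OF assms(1) eff_Pair[OF assms(2,3)]] by simp

lemma eff_app3:
  assumes "effective (enc_pair e1 (enc_pair e2 e3)) e' (\<lambda>p. g (fst p) (fst (snd p)) (snd (snd p)))"
    "effective e e1 a" "effective e e2 b" "effective e e3 c"
  shows "effective e e' (\<lambda>x. g (a x) (b x) (c x))"
  using eff_comp[OF assms(1) eff_Pair[OF assms(2) eff_Pair[OF assms(3,4)]]] by simp

lemma eff_if [eff_intros]:
  assumes "effective e enc_bool b" "effective e e' f" "effective e e' g"
  shows "effective e e' (\<lambda>x. if b x then f x else g x)"
proof -
  obtain B where B: "computable B" "\<forall>x. B (e x) = enc_bool (b x)" using assms(1) by (rule effE)
  obtain F where F: "computable F" "\<forall>x. F (e x) = e' (f x)" using assms(2) by (rule effE)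
  obtain G where G: "computable G" "\<forall>x. G (e x) = e' (g x)" using assms(3) by (rule effE)
  show ?thesis
    by (rule effI[OF computable.if_eq[OF B(1) computable.const[of Leaf] F(1) G(1)]]) (simp add: B F G enc_bool_def)
qed

text \<open>Values are compared by comparing their trees, hence the injective encoding.\<close>

lemma eff_eq [eff_intros]:
  assumes "effective e e1 f" "effective e e1 g" "inj e1"
  shows "effective e enc_bool (\<lambda>x. f x = g x)"
proof -
  obtain F where F: "computable F" "\<forall>x. F (e x) = e1 (f x)" using assms(1) by (rule effE)
  obtain G where G: "computable G" "\<forall>x. G (e x) = e1 (g x)" using assms(2) by (rule effE)
  show ?thesis
    by (rule effI[OF computable.if_eq[OF F(1) G(1) computable.const[of Leaf] computable.const[of "Node Leaf Leaf"]]])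
      (use assms(3) in \<open>auto simp: F G enc_bool_def inj_eq\<close>)
qed

lemma eff_not [eff_intros]:
  assumes "effective e enc_bool b" shows "effective e enc_bool (\<lambda>x. \<not> b x)"
proof -
  have "effective e enc_bool (\<lambda>x. if b x then False else True)" by (rule eff_if[OF assms eff_const eff_const])
  moreover have "(\<lambda>x. if b x then False else True) = (\<lambda>x. \<not> b x)" by auto
  ultimately show ?thesis by simp
qed

lemma eff_conj [eff_intros]:
  assumes "effective e enc_bool b" "effective e enc_bool c" shows "effective e enc_bool (\<lambda>x. b x \<and> c x)"
proof -
  have "effective e enc_bool (\<lambda>x. if b x then c x else False)" by (rule eff_if[OF assms eff_const])
  moreover have "(\<lambda>x. if b x then c x else False) = (\<lambda>x. b x \<and> c x)" by auto
  ultimately show ?thesis by simp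
qed

lemma eff_disj [eff_intros]: "effective e enc_bool b \<Longrightarrow> effective e enc_bool c \<Longrightarrow> effective e enc_bool (\<lambda>x. b x \<or> c x)"
  using eff_not[OF eff_conj[OF eff_not eff_not], of e b c] by simp

section \<open>Lists and numbers\<close>

lemma eff_Nil [eff_intros]: "effective e (enc_list e1) (\<lambda>x. [])"
  by (rule eff_const)

lemma eff_Cons [eff_intros]: "effective e e1 f \<Longrightarrow> effective e (enc_list e1) l \<Longrightarrow> effective e (enc_list e1) (\<lambda>x. f x # l x)"
  by (rule eff_node[of e e1 f "enc_list e1" l]) auto

text \<open>A list is a comb of pairs, so recursion on trees specialises to recursion on lists: the
  value at the right subtree is the recursive one, and the value at the left subtree is
  ignored.\<close>

lemma eff_rec_list:
  assumes l: "effective e (enc_list e1) l" and b: "effective e ey b"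
    and s: "effective (enc_pair e (enc_pair e1 (enc_pair (enc_list e1) ey))) ey
      (\<lambda>p. s (fst p) (fst (snd p)) (fst (snd (snd p))) (snd (snd (snd p))))"
  shows "effective e ey (\<lambda>x. rec_list (b x) (s x) (l x))"
proof -
  obtain L where L: "computable L" "\<forall>x. L (e x) = enc_list e1 (l x)" using l by (rule effE)
  obtain B where B: "computable B" "\<forall>x. B (e x) = ey (b x)" using b by (rule effE)
  obtain S where S: "computable S" "\<forall>p. S (enc_pair e (enc_pair e1 (enc_pair (enc_list e1) ey)) p) =
      ey (s (fst p) (fst (snd p)) (fst (snd (snd p))) (snd (snd (snd p))))" using s by (rule effE)
  \<comment> \<open>In the argument \<open>t\<close>, \<open>left (left t)\<close> is the parameter,
    \<open>right (left t)\<close> the current list and \<open>right (right t)\<close> the value at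
    its tail.\<close>
  let ?H = "\<lambda>t. S (Node (left (left t)) (Node (left (right (left t))) (Node (right (right (left t))) (right (right t)))))"
  have H: "computable ?H" by (rule computable.comp[OF S(1)]) (intro computable_intros)
  have rec: "tree_rec B (\<lambda>_. Leaf) ?H (e x) (enc_list e1 as) = ey (rec_list (b x) (s x) as)" for x as
  proof (induction as)
    case (Cons a as)
    then show ?case using S(2)[THEN spec, of "(x, a, as, rec_list (b x) (s x) as)"] by (simp add: enc_pair_def)
  qed (simp add: B)
  have "computable (\<lambda>t. (\<lambda>u. tree_rec B (\<lambda>_. Leaf) ?H (left u) (right u)) (Node t (L t)))"
    by (rule computable.comp[OF computable.prim_rec[OF B(1) computable.const H]]) (intro computable_intros L)
  then show ?thesis by (rule effI) (simp add: L rec)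
qed

lemma eff_foldr [eff_intros]:
  assumes "effective e (enc_list e1) l" "effective e ey b" "effective (enc_pair e (enc_pair e1 ey)) ey (\<lambda>p. s (fst p) (fst (snd p)) (snd (snd p)))"
  shows "effective e ey (\<lambda>x. foldr (s x) (l x) (b x))"
proof -
  have eq: "foldr (s x) as c = rec_list c (\<lambda>a as r. s x a r) as" for x as c
    by (induction as) auto
  show ?thesis unfolding eq
    by (rule eff_rec_list[OF assms(1,2)], rule eff_app3[OF assms(3)]) (rule eff_intros)+
qed

lemma eff_map [eff_intros]:
  assumes "effective e (enc_list e1) l" "effective (enc_pair e e1) e2 (\<lambda>p. g (fst p) (snd p))"
  shows "effective e (enc_list e2) (\<lambda>x. map (g x) (l x))"
proof -
  have eq: "map (g x) as = foldr (\<lambda>a r. g x a # r) as []" for x as by (induction as) auto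
  show ?thesis unfolding eq
    by (rule eff_foldr[OF assms(1) eff_Nil]) (rule eff_intros eff_app2[OF assms(2)])+
qed

lemma eff_filter [eff_intros]:
  assumes "effective e (enc_list e1) l" "effective (enc_pair e e1) enc_bool (\<lambda>p. P (fst p) (snd p))"
  shows "effective e (enc_list e1) (\<lambda>x. filter (P x) (l x))"
proof -
  have eq: "filter (P x) as = foldr (\<lambda>a r. if P x a then a # r else r) as []" for x as by (induction as) auto
  show ?thesis unfolding eq
    by (rule eff_foldr[OF assms(1) eff_Nil]) (rule eff_intros eff_app2[OF assms(2)])+
qed

lemma foldr_Cons: "foldr (#) as bs = as @ bs"
  by (induction as) auto

lemma eff_append [eff_intros]:
  assumes "effective e (enc_list e1) l" "effective e (enc_list e1) m"
  shows "effective e (enc_list e1) (\<lambda>x. l x @ m x)"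
  unfolding foldr_Cons[symmetric] by (rule eff_foldr[OF assms]) (rule eff_intros)+

lemma eff_concat [eff_intros]:
  assumes "effective e (enc_list (enc_list e1)) l"
  shows "effective e (enc_list e1) (\<lambda>x. concat (l x))"
  unfolding concat_conv_foldr by (rule eff_foldr[OF assms eff_Nil]) (rule eff_intros)+

lemma foldr_rev: "foldr (\<lambda>a r. r @ [a]) as [] = rev as"
  by (induction as) auto

lemma eff_rev [eff_intros]:
  assumes "effective e (enc_list e1) l" shows "effective e (enc_list e1) (\<lambda>x. rev (l x))"
  unfolding foldr_rev[symmetric] by (rule eff_foldr[OF assms eff_Nil]) (rule eff_intros)+

text \<open>Starting from the fixed value \<open>hd []\<close> covers the empty list as
  well.\<close>

lemma foldr_hd: "foldr (\<lambda>a r. a) as (hd []) = hd as"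
  by (cases as) auto

lemma eff_hd [eff_intros]:
  assumes "effective e (enc_list e1) l" shows "effective e e1 (\<lambda>x. hd (l x))"
  using eff_foldr[OF assms eff_const[of e e1 "hd []"], of "\<lambda>_ a r. a"]
  unfolding foldr_hd by (simp add: eff_fst[OF eff_snd[OF eff_id]])

lemma foldr_mem: "foldr (\<lambda>c r. b = c \<or> r) as False \<longleftrightarrow> b \<in> set as"
  by (induction as) auto

lemma eff_mem [eff_intros]:
  assumes "effective e e1 a" "effective e (enc_list e1) l" "inj e1"
  shows "effective e enc_bool (\<lambda>x. a x \<in> set (l x))"
  unfolding foldr_mem[symmetric]
  by (rule eff_foldr[OF assms(2) eff_const], rule eff_disj, rule eff_eq[OF _ _ assms(3)])
    (rule eff_intros eff_comp[OF assms(1)])+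

lemma eff_0 [eff_intros]: "effective e enc_nat (\<lambda>x. 0)"
  by (rule eff_const)

lemma eff_1 [eff_intros]: "effective e enc_nat (\<lambda>x. 1)"
  by (rule eff_const)

lemma eff_numeral [eff_intros]: "effective e enc_nat (\<lambda>x. numeral k)"
  by (rule eff_const)

lemma eff_Suc [eff_intros]: "effective e enc_nat f \<Longrightarrow> effective e enc_nat (\<lambda>x. Suc (f x))"
  by (rule eff_node[OF eff_const[of e "\<lambda>_. Leaf" "()"], of enc_nat f]) auto

text \<open>Numbers are encoded like lists of units, which reduces recursion on numbers to recursion
  on lists.\<close>

lemma enc_list_replicate: "enc_list (\<lambda>_. Leaf) (replicate n ()) = enc_nat n"
  by (induction n) auto

lemma eff_replicate: "effective e enc_nat n \<Longrightarrow> effective e (enc_list (\<lambda>_. Leaf)) (\<lambda>x. replicate (n x) ())"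
  by (simp add: effective_def enc_list_replicate)

lemma foldr_Suc: "foldr (\<lambda>_. Suc) as 0 = length as"
  by (induction as) auto

lemma eff_length [eff_intros]:
  assumes "effective e (enc_list e1) l" shows "effective e enc_nat (\<lambda>x. length (l x))"
  unfolding foldr_Suc[symmetric] by (rule eff_foldr[OF assms eff_0]) (rule eff_intros)+

lemma rec_list_replicate: "rec_list c (\<lambda>_ as r. f (length as) r) (replicate m a) = rec_nat c f m"
  by (induction m) auto

lemma eff_rec_nat [eff_intros]:
  assumes n: "effective e enc_nat n" and b: "effective e ey b"
    and s: "effective (enc_pair e (enc_pair enc_nat ey)) ey (\<lambda>p. s (fst p) (fst (snd p)) (snd (snd p)))"
  shows "effective e ey (\<lambda>x. rec_nat (b x) (s x) (n x))"
  unfolding rec_list_replicate[where a = "()", symmetric]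
  by (rule eff_rec_list[OF eff_replicate[OF n] b], rule eff_app3[OF s]) (rule eff_intros)+

lemma eff_plus [eff_intros]:
  assumes "effective e enc_nat f" "effective e enc_nat g" shows "effective e enc_nat (\<lambda>x. f x + g x)"
proof -
  have eq: "m + k = rec_nat k (\<lambda>_. Suc) m" for m k :: nat by (induction m) auto
  show ?thesis unfolding eq by (rule eff_rec_nat[OF assms]) (rule eff_intros)+
qed

lemma eff_times [eff_intros]:
  assumes "effective e enc_nat f" "effective e enc_nat g" shows "effective e enc_nat (\<lambda>x. f x * g x)"
proof -
  have eq: "m * k = rec_nat 0 (\<lambda>_ r. k + r) m" for m k :: nat by (induction m) auto
  show ?thesis unfolding eq
    by (rule eff_rec_nat[OF assms(1) eff_0]) (rule eff_intros eff_comp[OF assms(2)])+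
qed

lemma eff_minus [eff_intros]:
  assumes "effective e enc_nat f" "effective e enc_nat g" shows "effective e enc_nat (\<lambda>x. f x - g x)"
proof -
  \<comment> \<open>The inner recursor is the predecessor function, iterated \<open>k\<close>
    times.\<close>
  have eq: "m - k = rec_nat m (\<lambda>_ r. rec_nat 0 (\<lambda>i _. i) r) k" for m k :: nat
  proof (induction k)
    case (Suc k)
    have "m - Suc k = rec_nat 0 (\<lambda>i _. i) (m - k)" by (cases "m - k") auto
    then show ?case using Suc by simp
  qed simp
  show ?thesis unfolding eq by (rule eff_rec_nat[OF assms(2,1)]) (rule eff_intros)+
qed

lemma eff_upt [eff_intros]:
  assumes "effective e enc_nat f" shows "effective e enc_nats (\<lambda>x. [0..<f x])"
proof -
  have eq: "[0..<m] = rec_nat [] (\<lambda>i r. r @ [i]) m" for m by (induction m) auto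
  show ?thesis unfolding eq by (rule eff_rec_nat[OF assms eff_Nil]) (rule eff_intros)+
qed

lemma eff_sum_list [eff_intros]:
  assumes "effective e enc_nats l" shows "effective e enc_nat (\<lambda>x. sum_list (l x))"
  unfolding sum_list.eq_foldr by (rule eff_foldr[OF assms eff_0]) (rule eff_intros)+

lemma inj_enc_nat [eff_intros]: "inj enc_nat"
  by (simp add: inj_def)

text \<open>Finitely many exceptions are recognised by equality tests and answered by constants,
  however \<open>f\<close> is defined.\<close>

lemma eff_finite_support:
  assumes "finite W" "\<And>w. w \<notin> W \<Longrightarrow> f w = c"
  shows "effective enc_nat e' f"
  using assms
proof (induction W arbitrary: f rule: finite_induct)
  case empty
  then have "f = (\<lambda>_. c)" by auto
  then show ?case by (simp add: eff_const)
next
  case (insert w W)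
  have "effective enc_nat e' (f(w := c))" using insert.prems by (intro insert.IH) auto
  then have "effective enc_nat e' (\<lambda>x. if x = w then f w else (f(w := c)) x)"
    by (rule eff_if[OF eff_eq[OF eff_id eff_const inj_enc_nat] eff_const])
  moreover have "(\<lambda>x. if x = w then f w else (f(w := c)) x) = f" by auto
  ultimately show ?case by (simp only:)
qed

lemma inj_Atom_Inr [eff_intros]: "inj (\<lambda>s. Atom (Inr s))"
  by (simp add: inj_def)

lemma inj_enc_pair [eff_intros]: "inj e1 \<Longrightarrow> inj e2 \<Longrightarrow> inj (enc_pair e1 e2)"
  by (auto simp: inj_def enc_pair_def)

lemma inj_enc_list [eff_intros]: "inj e1 \<Longrightarrow> inj (enc_list e1)"
  using enc_list_inject_iff[of e1] by (auto simp: inj_def)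

section \<open>Recursion on encoded data types\<close>

text \<open>
  Course-of-values recursion: every node is annotated with its value and the annotated subtrees, so
  that values at the components of a tagged tuple, which are not immediate subtrees, are available.
\<close>

primrec crec :: "('c tree \<Rightarrow> 'c tree) \<Rightarrow> 'c tree \<Rightarrow> 'c tree \<Rightarrow> 'c tree" where
  "crec h p Leaf = Node (h (Node p (Node Leaf Leaf))) Leaf"
| "crec h p (Atom c) = Node (h (Node p (Node (Atom c) Leaf))) Leaf"
| "crec h p (Node a b) = Node (h (Node p (Node (Node a b) (Node (crec h p a) (crec h p b)))))
     (Node (crec h p a) (crec h p b))"

lemma computable_crec:
  assumes h: "computable h"
  obtains G where "computable G" "\<And>p t. G (Node p t) = crec h p t"
proof -
  let ?f = "\<lambda>p. Node (h (Node p (Node Leaf Leaf))) Leaf"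
  let ?g = "\<lambda>u. Node (h (Node (left u) (Node (right u) Leaf))) Leaf"
  let ?k = "\<lambda>u. Node (h (Node (left (left u)) (Node (right (left u)) (right u)))) (right u)"
  have "computable ?f" "computable ?g" "computable ?k"
    by (intro computable_intros computable.comp[OF h])+
  then have "computable (\<lambda>u. tree_rec ?f ?g ?k (left u) (right u))" by (rule computable.prim_rec)
  moreover have "tree_rec ?f ?g ?k p t = crec h p t" for p t by (induction t) auto
  ultimately show thesis using that by auto
qed

lemma left_crec: "left (crec h p (Node a b)) = h (Node p (Node (Node a b) (Node (crec h p a) (crec h p b))))"
  and right_crec: "right (crec h p (Node a b)) = Node (crec h p a) (crec h p b)"
  by simp_all

text \<open>
  For the step function at a tagged tuple \<open>u\<close>: \<open>comp_arg k u\<close> and \<open>comp_val k u\<close> are the \<open>k\<close>-th component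
  and the recursive value at it.
\<close>

definition comp_tag :: "'c tree \<Rightarrow> 'c tree" where
  "comp_tag u = left (left (right u))"

definition comp_arg :: "nat \<Rightarrow> 'c tree \<Rightarrow> 'c tree" where
  "comp_arg k u = left ((right ^^ k) (right (left (right u))))"

definition comp_val :: "nat \<Rightarrow> 'c tree \<Rightarrow> 'c tree" where
  "comp_val k u = left (left (right (((\<lambda>r. right (right r)) ^^ k) (right (right (right u))))))"

lemma computable_funpow: "computable f \<Longrightarrow> computable (f ^^ k)"
  by (induction k) (auto intro: computable.comp computable.ident simp: o_def id_def)

lemma computable_comp_tag: "computable comp_tag"
  unfolding comp_tag_def by (intro computable_intros)

lemma computable_comp_arg: "computable (comp_arg k)"
  unfolding comp_arg_def
  by (intro computable_left computable.comp[OF computable_funpow[OF computable.right]] computable_intros)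

lemma computable_comp_val: "computable (comp_val k)"
  unfolding comp_val_def
  by (intro computable_left computable_right computable.comp[OF computable_funpow] computable_intros)

lemmas comp_simps = comp_tag_def comp_arg_def comp_val_def left_crec right_crec eval_nat_numeral

text \<open>The step on trees dispatches on the tag and reads the components and the values at them
  from the annotated subtrees; \<open>Leaf\<close> is a dummy for other tags.\<close>

lemma eff_rec_trm:
  fixes N :: "('s, 'v) trm \<Rightarrow> 'y" and ey :: "'y \<Rightarrow> ('s + 'v) tree"
  assumes eqs: "\<And>a1 a2. N (TElem a1 a2) = f0 a1 a2"
    "\<And>a1 a2. N (TWt a1 a2) = f1 a1 a2"
    "\<And>a1 a2. N (TAdd a1 a2) = f2 (N a1) (N a2)"
    "\<And>a1 a2. N (TSub a1 a2) = f3 (N a1) (N a2)"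
    "\<And>a1 a2. N (TMul a1 a2) = f4 (N a1) (N a2)"
    and effs: "effective (enc_pair enc_type enc_elem) ey (\<lambda>p. f0 (fst p) (snd p))"
    "effective (enc_pair enc_nat enc_nats) ey (\<lambda>p. f1 (fst p) (snd p))"
    "effective (enc_pair ey ey) ey (\<lambda>p. f2 (fst p) (snd p))"
    "effective (enc_pair ey ey) ey (\<lambda>p. f3 (fst p) (snd p))"
    "effective (enc_pair ey ey) ey (\<lambda>p. f4 (fst p) (snd p))"
  shows "effective enc_trm ey N"
proof -
  obtain F0 where F0: "computable F0" "\<forall>p. F0 ((enc_pair enc_type enc_elem) p) = ey (f0 (fst p) (snd p))"
    using effs(1) by (rule effE)
  obtain F1 where F1: "computable F1" "\<forall>p. F1 ((enc_pair enc_nat enc_nats) p) = ey (f1 (fst p) (snd p))"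
    using effs(2) by (rule effE)
  obtain F2 where F2: "computable F2" "\<forall>p. F2 ((enc_pair ey ey) p) = ey (f2 (fst p) (snd p))"
    using effs(3) by (rule effE)
  obtain F3 where F3: "computable F3" "\<forall>p. F3 ((enc_pair ey ey) p) = ey (f3 (fst p) (snd p))"
    using effs(4) by (rule effE)
  obtain F4 where F4: "computable F4" "\<forall>p. F4 ((enc_pair ey ey) p) = ey (f4 (fst p) (snd p))"
    using effs(5) by (rule effE)
  define H where "H = (\<lambda>u. if comp_tag u = enc_nat 0 then F0 (Node (comp_arg 0 u) (comp_arg 1 u)) else
    if comp_tag u = enc_nat 1 then F1 (Node (comp_arg 0 u) (comp_arg 1 u)) else
    if comp_tag u = enc_nat 2 then F2 (Node (comp_val 0 u) (comp_val 1 u)) else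
    if comp_tag u = enc_nat 3 then F3 (Node (comp_val 0 u) (comp_val 1 u)) else
    if comp_tag u = enc_nat 4 then F4 (Node (comp_val 0 u) (comp_val 1 u)) else
    Leaf)"
  have "computable H" unfolding H_def
    by (intro computable.if_eq computable_comp_tag computable.const computable.node computable_comp_arg computable_comp_val
        computable_left computable.ident computable.comp[OF F0(1)] computable.comp[OF F1(1)] computable.comp[OF F2(1)] computable.comp[OF F3(1)] computable.comp[OF F4(1)])
  then obtain G where G: "computable G" "\<And>p t. G (Node p t) = crec H p t" by (rule computable_crec) blast
  have "left (crec H Leaf (enc_trm d)) = ey (N d)" for d
  proof (induction d)
    case (TElem a1 a2)
    then show ?case using F0(2)[THEN spec, of "(a1, a2)"]
      by (simp add: comp_simps H_def enc_pair_def eqs del: crec.simps)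
  next
    case (TWt a1 a2)
    then show ?case using F1(2)[THEN spec, of "(a1, a2)"]
      by (simp add: comp_simps H_def enc_pair_def eqs del: crec.simps)
  next
    case (TAdd a1 a2)
    then show ?case using F2(2)[THEN spec, of "(N a1, N a2)"]
      by (simp add: comp_simps H_def enc_pair_def eqs del: crec.simps)
  next
    case (TSub a1 a2)
    then show ?case using F3(2)[THEN spec, of "(N a1, N a2)"]
      by (simp add: comp_simps H_def enc_pair_def eqs del: crec.simps)
  next
    case (TMul a1 a2)
    then show ?case using F4(2)[THEN spec, of "(N a1, N a2)"]
      by (simp add: comp_simps H_def enc_pair_def eqs del: crec.simps)
  qed
  then show ?thesis
    by (intro effI[OF computable_left[OF computable.comp[OF G(1) computable.node[OF computable.const[of Leaf] computable.ident]]]])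
      (simp add: G(2))
qed

text \<open>The steps for quantifiers also receive the original subformula, from which the normal
  form computes the list of free variables.\<close>

lemma eff_rec_fm:
  fixes N :: "('s, 'v) fm \<Rightarrow> 'y" and ey :: "'y \<Rightarrow> ('s + 'v) tree"
  assumes eqs: "\<And>a1 a2. N (Eq a1 a2) = f0 a1 a2"
    "\<And>a1 a2. N (Rel a1 a2) = f1 a1 a2"
    "\<And>a1 a2 a3. N (WEq a1 a2 a3) = f2 a1 a2 a3"
    "\<And>a1. N (Neg a1) = f3 (N a1)"
    "\<And>a1 a2. N (Or a1 a2) = f4 (N a1) (N a2)"
    "\<And>a1 a2. N (Ex a1 a2) = f5 a1 a2 (N a2)"
    "\<And>a1 a2 a3 a4. N (WSum a1 a2 a3 a4) = f6 a1 a2 a3 a4 (N a4)"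
    "\<And>a1 a2. N (Pred a1 a2) = f7 a1 a2"
    and effs: "effective (enc_pair enc_nat enc_nat) ey (\<lambda>p. f0 (fst p) (snd p))"
    "effective (enc_pair enc_nat enc_nats) ey (\<lambda>p. f1 (fst p) (snd p))"
    "effective (enc_pair enc_elem (enc_pair enc_nat enc_nats)) ey (\<lambda>p. f2 (fst p) (fst (snd p)) (snd (snd p)))"
    "effective (ey) ey (\<lambda>p. f3 p)"
    "effective (enc_pair ey ey) ey (\<lambda>p. f4 (fst p) (snd p))"
    "effective (enc_pair enc_nat (enc_pair enc_fm ey)) ey (\<lambda>p. f5 (fst p) (fst (snd p)) (snd (snd p)))"
    "effective (enc_pair enc_elem (enc_pair enc_nat (enc_pair enc_nats (enc_pair enc_fm ey)))) ey (\<lambda>p. f6 (fst p) (fst (snd p)) (fst (snd (snd p))) (fst (snd (snd (snd p)))) (snd (snd (snd (snd p)))))"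
    "effective (enc_pair enc_nat (enc_list enc_trm)) ey (\<lambda>p. f7 (fst p) (snd p))"
  shows "effective enc_fm ey N"
proof -
  obtain F0 where F0: "computable F0" "\<forall>p. F0 ((enc_pair enc_nat enc_nat) p) = ey (f0 (fst p) (snd p))"
    using effs(1) by (rule effE)
  obtain F1 where F1: "computable F1" "\<forall>p. F1 ((enc_pair enc_nat enc_nats) p) = ey (f1 (fst p) (snd p))"
    using effs(2) by (rule effE)
  obtain F2 where F2: "computable F2" "\<forall>p. F2 ((enc_pair enc_elem (enc_pair enc_nat enc_nats)) p) = ey (f2 (fst p) (fst (snd p)) (snd (snd p)))"
    using effs(3) by (rule effE)
  obtain F3 where F3: "computable F3" "\<forall>p. F3 (ey p) = ey (f3 p)"
    using effs(4) by (rule effE)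
  obtain F4 where F4: "computable F4" "\<forall>p. F4 ((enc_pair ey ey) p) = ey (f4 (fst p) (snd p))"
    using effs(5) by (rule effE)
  obtain F5 where F5: "computable F5" "\<forall>p. F5 ((enc_pair enc_nat (enc_pair enc_fm ey)) p) = ey (f5 (fst p) (fst (snd p)) (snd (snd p)))"
    using effs(6) by (rule effE)
  obtain F6 where F6: "computable F6" "\<forall>p. F6 ((enc_pair enc_elem (enc_pair enc_nat (enc_pair enc_nats (enc_pair enc_fm ey)))) p) = ey (f6 (fst p) (fst (snd p)) (fst (snd (snd p))) (fst (snd (snd (snd p)))) (snd (snd (snd (snd p)))))"
    using effs(7) by (rule effE)
  obtain F7 where F7: "computable F7" "\<forall>p. F7 ((enc_pair enc_nat (enc_list enc_trm)) p) = ey (f7 (fst p) (snd p))"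
    using effs(8) by (rule effE)
  define H where "H = (\<lambda>u. if comp_tag u = enc_nat 0 then F0 (Node (comp_arg 0 u) (comp_arg 1 u)) else
    if comp_tag u = enc_nat 1 then F1 (Node (comp_arg 0 u) (comp_arg 1 u)) else
    if comp_tag u = enc_nat 2 then F2 (Node (comp_arg 0 u) (Node (comp_arg 1 u) (comp_arg 2 u))) else
    if comp_tag u = enc_nat 3 then F3 (comp_val 0 u) else
    if comp_tag u = enc_nat 4 then F4 (Node (comp_val 0 u) (comp_val 1 u)) else
    if comp_tag u = enc_nat 5 then F5 (Node (comp_arg 0 u) (Node (comp_arg 1 u) (comp_val 1 u))) else
    if comp_tag u = enc_nat 6 then F6 (Node (comp_arg 0 u) (Node (comp_arg 1 u) (Node (comp_arg 2 u) (Node (comp_arg 3 u) (comp_val 3 u))))) else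
    if comp_tag u = enc_nat 7 then F7 (Node (comp_arg 0 u) (comp_arg 1 u)) else
    Leaf)"
  have "computable H" unfolding H_def
    by (intro computable.if_eq computable_comp_tag computable.const computable.node computable_comp_arg computable_comp_val
        computable_left computable.ident computable.comp[OF F0(1)] computable.comp[OF F1(1)] computable.comp[OF F2(1)] computable.comp[OF F3(1)] computable.comp[OF F4(1)] computable.comp[OF F5(1)] computable.comp[OF F6(1)] computable.comp[OF F7(1)])
  then obtain G where G: "computable G" "\<And>p t. G (Node p t) = crec H p t" by (rule computable_crec) blast
  have "left (crec H Leaf (enc_fm d)) = ey (N d)" for d
  proof (induction d)
    case (Eq a1 a2)
    then show ?case using F0(2)[THEN spec, of "(a1, a2)"]
      by (simp add: comp_simps H_def enc_pair_def eqs del: crec.simps)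
  next
    case (Rel a1 a2)
    then show ?case using F1(2)[THEN spec, of "(a1, a2)"]
      by (simp add: comp_simps H_def enc_pair_def eqs del: crec.simps)
  next
    case (WEq a1 a2 a3)
    then show ?case using F2(2)[THEN spec, of "(a1, a2, a3)"]
      by (simp add: comp_simps H_def enc_pair_def eqs del: crec.simps)
  next
    case (Neg a1)
    then show ?case using F3(2)[THEN spec, of "N a1"]
      by (simp add: comp_simps H_def enc_pair_def eqs del: crec.simps)
  next
    case (Or a1 a2)
    then show ?case using F4(2)[THEN spec, of "(N a1, N a2)"]
      by (simp add: comp_simps H_def enc_pair_def eqs del: crec.simps)
  next
    case (Ex a1 a2)
    then show ?case using F5(2)[THEN spec, of "(a1, a2, N a2)"]
      by (simp add: comp_simps H_def enc_pair_def eqs del: crec.simps)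
  next
    case (WSum a1 a2 a3 a4)
    then show ?case using F6(2)[THEN spec, of "(a1, a2, a3, a4, N a4)"]
      by (simp add: comp_simps H_def enc_pair_def eqs del: crec.simps)
  next
    case (Pred a1 a2)
    then show ?case using F7(2)[THEN spec, of "(a1, a2)"]
      by (simp add: comp_simps H_def enc_pair_def eqs del: crec.simps)
  qed
  then show ?thesis
    by (intro effI[OF computable_left[OF computable.comp[OF G(1) computable.node[OF computable.const[of Leaf] computable.ident]]]])
      (simp add: G(2))
qed

text \<open>The parameter \<open>x\<close> is needed for \<open>cases_bc\<close>, whose treatment of
  leaves depends on variables and distances from the context.\<close>

lemma eff_rec_bc:
  fixes N :: "'x \<Rightarrow> ('s, 'v) bc \<Rightarrow> 'y" and ey :: "'y \<Rightarrow> ('s + 'v) tree" and ex :: "'x \<Rightarrow> ('s + 'v) tree"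
  assumes eqs: "\<And>x a1. N x (Local a1) = f0 x a1"
    "\<And>x a1. N x (Agg a1) = f1 x a1"
    "\<And>x a1. N x (Ge1 a1) = f2 x a1"
    "\<And>x a1. N x (BNeg a1) = f3 x (N x a1)"
    "\<And>x a1 a2. N x (BOr a1 a2) = f4 x (N x a1) (N x a2)"
    and effs: "effective (enc_pair ex enc_fm) ey (\<lambda>p. f0 (fst p) (snd p))"
    "effective (enc_pair ex enc_fm) ey (\<lambda>p. f1 (fst p) (snd p))"
    "effective (enc_pair ex enc_cl) ey (\<lambda>p. f2 (fst p) (snd p))"
    "effective (enc_pair ex ey) ey (\<lambda>p. f3 (fst p) (snd p))"
    "effective (enc_pair ex (enc_pair ey ey)) ey (\<lambda>p. f4 (fst p) (fst (snd p)) (snd (snd p)))"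
  shows "effective (enc_pair ex enc_bc) ey (\<lambda>p. N (fst p) (snd p))"
proof -
  obtain F0 where F0: "computable F0" "\<forall>p. F0 ((enc_pair ex enc_fm) p) = ey (f0 (fst p) (snd p))"
    using effs(1) by (rule effE)
  obtain F1 where F1: "computable F1" "\<forall>p. F1 ((enc_pair ex enc_fm) p) = ey (f1 (fst p) (snd p))"
    using effs(2) by (rule effE)
  obtain F2 where F2: "computable F2" "\<forall>p. F2 ((enc_pair ex enc_cl) p) = ey (f2 (fst p) (snd p))"
    using effs(3) by (rule effE)
  obtain F3 where F3: "computable F3" "\<forall>p. F3 ((enc_pair ex ey) p) = ey (f3 (fst p) (snd p))"
    using effs(4) by (rule effE)
  obtain F4 where F4: "computable F4" "\<forall>p. F4 ((enc_pair ex (enc_pair ey ey)) p) = ey (f4 (fst p) (fst (snd p)) (snd (snd p)))"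
    using effs(5) by (rule effE)
  define H where "H = (\<lambda>u. if comp_tag u = enc_nat 0 then F0 (Node (left u) (comp_arg 0 u)) else
    if comp_tag u = enc_nat 1 then F1 (Node (left u) (comp_arg 0 u)) else
    if comp_tag u = enc_nat 2 then F2 (Node (left u) (comp_arg 0 u)) else
    if comp_tag u = enc_nat 3 then F3 (Node (left u) (comp_val 0 u)) else
    if comp_tag u = enc_nat 4 then F4 (Node (left u) (Node (comp_val 0 u) (comp_val 1 u))) else
    Leaf)"
  have "computable H" unfolding H_def
    by (intro computable.if_eq computable_comp_tag computable.const computable.node computable_comp_arg computable_comp_val
        computable_left computable.ident computable.comp[OF F0(1)] computable.comp[OF F1(1)] computable.comp[OF F2(1)] computable.comp[OF F3(1)] computable.comp[OF F4(1)])
  then obtain G where G: "computable G" "\<And>p t. G (Node p t) = crec H p t" by (rule computable_crec) blast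
  have "left (crec H (ex x) (enc_bc d)) = ey (N x d)" for x d
  proof (induction d)
    case (Local a1)
    then show ?case using F0(2)[THEN spec, of "(x, a1)"]
      by (simp add: comp_simps H_def enc_pair_def eqs del: crec.simps)
  next
    case (Agg a1)
    then show ?case using F1(2)[THEN spec, of "(x, a1)"]
      by (simp add: comp_simps H_def enc_pair_def eqs del: crec.simps)
  next
    case (Ge1 a1)
    then show ?case using F2(2)[THEN spec, of "(x, a1)"]
      by (simp add: comp_simps H_def enc_pair_def eqs del: crec.simps)
  next
    case (BNeg a1)
    then show ?case using F3(2)[THEN spec, of "(x, N x a1)"]
      by (simp add: comp_simps H_def enc_pair_def eqs del: crec.simps)
  next
    case (BOr a1 a2)
    then show ?case using F4(2)[THEN spec, of "(x, N x a1, N x a2)"]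
      by (simp add: comp_simps H_def enc_pair_def eqs del: crec.simps)
  qed
  then show ?thesis
    by (intro effI[OF computable_left[OF G(1)]]) (simp add: G(2) enc_pair_def)
qed

section \<open>Computability of the constructors\<close>

lemma eff_tag1:
  assumes "effective e e1 a" "\<And>x. e' (h x) = tag k [e1 (a x)]"
  shows "effective e e' h"
  by (rule eff_node[OF eff_const[of e enc_nat k] eff_Cons[OF assms(1) eff_Nil]]) (simp add: assms(2))

lemma eff_tag2:
  assumes "effective e e1 a" "effective e e2 b" "\<And>x. e' (h x) = tag k [e1 (a x), e2 (b x)]"
  shows "effective e e' h"
proof -
  have "effective e (\<lambda>p. Node (e1 (fst p)) (Node (e2 (snd p)) Leaf)) (\<lambda>x. (a x, b x))"
    by (rule eff_node[OF assms(1) eff_Cons[OF assms(2) eff_Nil]]) simp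
  then show ?thesis by (rule eff_node[OF eff_const[of e enc_nat k]]) (simp add: assms(3))
qed

lemma eff_tag3:
  assumes "effective e e1 a" "effective e e2 b" "effective e e3 c" "\<And>x. e' (h x) = tag k [e1 (a x), e2 (b x), e3 (c x)]"
  shows "effective e e' h"
proof -
  have "effective e (\<lambda>p. Node (e2 (fst p)) (Node (e3 (snd p)) Leaf)) (\<lambda>x. (b x, c x))"
    by (rule eff_node[OF assms(2) eff_Cons[OF assms(3) eff_Nil]]) simp
  then have "effective e (\<lambda>p. Node (e1 (fst p)) (Node (e2 (fst (snd p))) (Node (e3 (snd (snd p))) Leaf))) (\<lambda>x. (a x, b x, c x))"
    by (rule eff_node[OF assms(1)]) simp
  then show ?thesis by (rule eff_node[OF eff_const[of e enc_nat k]]) (simp add: assms(4))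
qed

lemma eff_tag4:
  assumes "effective e e1 a" "effective e e2 b" "effective e e3 c" "effective e e4 d"
    "\<And>x. e' (h x) = tag k [e1 (a x), e2 (b x), e3 (c x), e4 (d x)]"
  shows "effective e e' h"
proof -
  have "effective e (\<lambda>p. Node (e3 (fst p)) (Node (e4 (snd p)) Leaf)) (\<lambda>x. (c x, d x))"
    by (rule eff_node[OF assms(3) eff_Cons[OF assms(4) eff_Nil]]) simp
  then have "effective e (\<lambda>p. Node (e2 (fst p)) (Node (e3 (fst (snd p))) (Node (e4 (snd (snd p))) Leaf))) (\<lambda>x. (b x, c x, d x))"
    by (rule eff_node[OF assms(2)]) simp
  then have "effective e (\<lambda>p. Node (e1 (fst p)) (Node (e2 (fst (snd p))) (Node (e3 (fst (snd (snd p)))) (Node (e4 (snd (snd (snd p)))) Leaf))))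
      (\<lambda>x. (a x, b x, c x, d x))"
    by (rule eff_node[OF assms(1)]) simp
  then show ?thesis by (rule eff_node[OF eff_const[of e enc_nat k]]) (simp add: assms(5))
qed

lemma eff_Eq [eff_intros]:
  "effective e enc_nat a \<Longrightarrow> effective e enc_nat b \<Longrightarrow> effective e enc_fm (\<lambda>x. Eq (a x) (b x))"
  by (erule eff_tag2, assumption+, rule enc_fm.simps)

lemma eff_Rel [eff_intros]:
  "effective e enc_nat a \<Longrightarrow> effective e enc_nats b \<Longrightarrow> effective e enc_fm (\<lambda>x. Rel (a x) (b x))"
  by (erule eff_tag2, assumption+, rule enc_fm.simps)

lemma eff_WEq [eff_intros]:
  "effective e enc_elem a \<Longrightarrow> effective e enc_nat b \<Longrightarrow> effective e enc_nats c \<Longrightarrow> effective e enc_fm (\<lambda>x. WEq (a x) (b x) (c x))"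
  by (erule eff_tag3, assumption+, rule enc_fm.simps)

lemma eff_Neg [eff_intros]:
  "effective e enc_fm a \<Longrightarrow> effective e enc_fm (\<lambda>x. Neg (a x))"
  by (erule eff_tag1, rule enc_fm.simps)

lemma eff_Or [eff_intros]:
  "effective e enc_fm a \<Longrightarrow> effective e enc_fm b \<Longrightarrow> effective e enc_fm (\<lambda>x. Or (a x) (b x))"
  by (erule eff_tag2, assumption+, rule enc_fm.simps)

lemma eff_Ex [eff_intros]:
  "effective e enc_nat a \<Longrightarrow> effective e enc_fm b \<Longrightarrow> effective e enc_fm (\<lambda>x. Ex (a x) (b x))"
  by (erule eff_tag2, assumption+, rule enc_fm.simps)

lemma eff_WSum [eff_intros]:
  "effective e enc_elem a \<Longrightarrow> effective e enc_nat b \<Longrightarrow> effective e enc_nats c \<Longrightarrow> effective e enc_fm d \<Longrightarrow> effective e enc_fm (\<lambda>x. WSum (a x) (b x) (c x) (d x))"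
  by (erule eff_tag4, assumption+, rule enc_fm.simps)

lemma eff_Pred [eff_intros]:
  "effective e enc_nat a \<Longrightarrow> effective e (enc_list enc_trm) b \<Longrightarrow> effective e enc_fm (\<lambda>x. Pred (a x) (b x))"
  by (erule eff_tag2, assumption+, rule enc_fm.simps)

lemma eff_Local [eff_intros]:
  "effective e enc_fm a \<Longrightarrow> effective e enc_bc (\<lambda>x. Local (a x))"
  by (erule eff_tag1, rule enc_bc.simps)

lemma eff_Agg [eff_intros]:
  "effective e enc_fm a \<Longrightarrow> effective e enc_bc (\<lambda>x. Agg (a x))"
  by (erule eff_tag1, rule enc_bc.simps)

lemma eff_Ge1 [eff_intros]:
  "effective e enc_cl a \<Longrightarrow> effective e enc_bc (\<lambda>x. Ge1 (a x))"
  by (erule eff_tag1, rule enc_bc.simps)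

lemma eff_BNeg [eff_intros]:
  "effective e enc_bc a \<Longrightarrow> effective e enc_bc (\<lambda>x. BNeg (a x))"
  by (erule eff_tag1, rule enc_bc.simps)

lemma eff_BOr [eff_intros]:
  "effective e enc_bc a \<Longrightarrow> effective e enc_bc b \<Longrightarrow> effective e enc_bc (\<lambda>x. BOr (a x) (b x))"
  by (erule eff_tag2, assumption+, rule enc_bc.simps)

lemma eff_FWt [eff_intros]:
  "effective e enc_nat a \<Longrightarrow> effective e enc_nats b \<Longrightarrow> effective e enc_factor (\<lambda>x. FWt (a x) (b x))"
  by (erule eff_tag2, assumption+, rule enc_factor.simps)

lemma eff_CSum [eff_intros]:
  "effective e enc_type a \<Longrightarrow> effective e (enc_list enc_factor) b \<Longrightarrow> effective e enc_fm c \<Longrightarrow> effective e enc_cl (\<lambda>x. CSum (a x) (b x) (c x))"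
  by (erule eff_tag3, assumption+, rule enc_cl.simps)

lemma eff_CAdd [eff_intros]:
  "effective e enc_cl a \<Longrightarrow> effective e enc_cl b \<Longrightarrow> effective e enc_cl (\<lambda>x. CAdd (a x) (b x))"
  by (erule eff_tag2, assumption+, rule enc_cl.simps)

lemma eff_CSub [eff_intros]:
  "effective e enc_cl a \<Longrightarrow> effective e enc_cl b \<Longrightarrow> effective e enc_cl (\<lambda>x. CSub (a x) (b x))"
  by (erule eff_tag2, assumption+, rule enc_cl.simps)

lemma eff_CMul [eff_intros]:
  "effective e enc_cl a \<Longrightarrow> effective e enc_cl b \<Longrightarrow> effective e enc_cl (\<lambda>x. CMul (a x) (b x))"
  by (erule eff_tag2, assumption+, rule enc_cl.simps)

section \<open>Computability of the normal form\<close>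

lemma eff_tvl: "effective enc_trm enc_nats tvl"
  by (rule eff_rec_trm[of tvl "\<lambda>_ _. []" "\<lambda>_ xs. xs" "\<lambda>a b. a @ b" "\<lambda>a b. a @ b" "\<lambda>a b. a @ b"])
    (simp | rule eff_intros)+

lemmas [eff_intros] = eff_comp[OF eff_tvl]

lemma eff_fvl: "effective enc_fm enc_nats fvl"
  by (rule eff_rec_fm[of fvl "\<lambda>x y. [x, y]" "\<lambda>_ xs. xs" "\<lambda>_ _ xs. xs" "\<lambda>a. a" "\<lambda>a b. a @ b"
        "\<lambda>y _ a. filter (\<lambda>z. z \<noteq> y) a" "\<lambda>_ _ ys _ a. filter (\<lambda>z. z \<notin> set ys) a" "\<lambda>_ ts. concat (map tvl ts)"])
    (simp only: fvl.simps | rule eff_intros)+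

lemmas [eff_intros] = eff_comp[OF eff_fvl]

lemma eff_Top [eff_intros]: "effective e enc_fm (\<lambda>x. Top)"
  by (rule eff_const)

lemma eff_And [eff_intros]: "effective e enc_fm a \<Longrightarrow> effective e enc_fm b \<Longrightarrow> effective e enc_fm (\<lambda>x. And (a x) (b x))"
  unfolding And_def by (rule eff_intros | assumption)+

lemma eff_Conj [eff_intros]: "effective e (enc_list enc_fm) l \<Longrightarrow> effective e enc_fm (\<lambda>x. Conj (l x))"
  unfolding Conj_def by (rule eff_intros | assumption)+

lemma eff_Disj [eff_intros]: "effective e (enc_list enc_fm) l \<Longrightarrow> effective e enc_fm (\<lambda>x. Disj (l x))"
  unfolding Disj_def by (rule eff_intros | assumption)+

lemma eff_BAnd [eff_intros]: "effective e enc_bc a \<Longrightarrow> effective e enc_bc b \<Longrightarrow> effective e enc_bc (\<lambda>x. BAnd (a x) (b x))"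
  unfolding BAnd_def by (rule eff_intros | assumption)+

lemma eff_inst [eff_intros]:
  "effective e enc_nat y \<Longrightarrow> effective e enc_fm t \<Longrightarrow> effective e enc_nat z \<Longrightarrow> effective e enc_fm (\<lambda>x. inst (y x) (t x) (z x))"
  unfolding inst_def by (rule eff_intros | assumption)+

lemma eff_cases_bc:
  assumes f: "effective (enc_pair e enc_fm) (enc_list (enc_pair enc_bc enc_fm)) (\<lambda>p. f (fst p) (snd p))" and \<Phi>: "effective e enc_bc \<Phi>"
  shows "effective e (enc_list (enc_pair enc_bc enc_fm)) (\<lambda>x. cases_bc (f x) (\<Phi> x))"
proof -
  have "effective (enc_pair e enc_bc) (enc_list (enc_pair enc_bc enc_fm)) (\<lambda>p. cases_bc (f (fst p)) (snd p))"
    by (rule eff_rec_bc[of "\<lambda>x. cases_bc (f x)" f "\<lambda>_ \<chi>. [(Agg \<chi>, Top), (BNeg (Agg \<chi>), Neg Top)]"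
          "\<lambda>_ g. [(Ge1 g, Top), (BNeg (Ge1 g), Neg Top)]" "\<lambda>_ a. map (\<lambda>p. (fst p, Neg (snd p))) a"
          "\<lambda>_ a b. concat (map (\<lambda>p. map (\<lambda>q. (BAnd (fst p) (fst q), Or (snd p) (snd q))) b) a)"])
      (simp only: cases_bc.simps | rule eff_intros f)+
  then show ?thesis by (rule eff_app2[OF _ eff_id \<Phi>])
qed

lemma eff_cl_leaves: "effective enc_bc (enc_list enc_cl) cl_leaves"
proof -
  have "effective (enc_pair (\<lambda>_. Leaf) enc_bc) (enc_list enc_cl) (\<lambda>p. (\<lambda>_::unit. cl_leaves) (fst p) (snd p))"
    by (rule eff_rec_bc[of "\<lambda>_. cl_leaves" "\<lambda>_ _. []" "\<lambda>_ _. []" "\<lambda>_ g. [g]" "\<lambda>_ a. a" "\<lambda>_ a b. a @ b"])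
      (simp only: cl_leaves.simps | rule eff_intros)+
  then show ?thesis by (rule eff_app2[OF _ eff_const eff_id])
qed

text \<open>Indexing is replaced by recursion on the reversed list, where the tail at
  \<open>y\<close> holds the entries before \<open>y\<close>. Reversing the tail restores the order,
  since the formulas must agree syntactically.\<close>

lemma rec_list_complete_delta:
  "complete_delta V r ys = Conj (rec_list [] (\<lambda>y xs a. a @ map (\<lambda>x. dist_le_fm V r x y) (rev xs)) (rev ys))"
proof -
  have "concat (map (\<lambda>j. map (\<lambda>i. dist_le_fm V r (ys ! i) (ys ! j)) [0..<j]) [0..<length ys])
      = rec_list [] (\<lambda>y xs a. a @ map (\<lambda>x. dist_le_fm V r x y) (rev xs)) (rev ys)"
  proof (induction ys rule: rev_induct)
    case (snoc y ys)
    have 1: "map (\<lambda>j. map (\<lambda>i. dist_le_fm V r ((ys @ [y]) ! i) ((ys @ [y]) ! j)) [0..<j]) [0..<length ys]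
        = map (\<lambda>j. map (\<lambda>i. dist_le_fm V r (ys ! i) (ys ! j)) [0..<j]) [0..<length ys]"
      by (auto simp: nth_append)
    have 2: "map (\<lambda>i. dist_le_fm V r ((ys @ [y]) ! i) y) [0..<length ys] = map (\<lambda>x. dist_le_fm V r x y) ys"
      by (rule nth_equalityI) (auto simp: nth_append)
    show ?case using snoc by (simp add: 1 2 del: map_eq_conv)
  qed simp
  then show ?thesis by (simp add: complete_delta_def)
qed

context weighted
begin

lemma eff_BTop [eff_intros]: "effective e enc_bc (\<lambda>x. BTop)"
  by (rule eff_const)

lemma eff_BDisj [eff_intros]: "effective e (enc_list enc_bc) l \<Longrightarrow> effective e enc_bc (\<lambda>x. BDisj (l x))"
  unfolding BDisj_def by (rule eff_intros | assumption)+

lemma eff_BConj [eff_intros]: "effective e (enc_list enc_bc) l \<Longrightarrow> effective e enc_bc (\<lambda>x. BConj (l x))"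
  unfolding BConj_def by (rule eff_intros | assumption)+

lemma eff_cooccur_in:
  assumes "effective e enc_nat x" "effective e enc_nat y" "effective e enc_nat R" "effective e enc_nats zs"
  shows "effective e enc_fm (\<lambda>u. cooccur_in V (x u) (y u) (R u) (zs u))"
  unfolding cooccur_in_def by (rule eff_intros assms assms[THEN eff_comp])+

text \<open>The finite list of relation symbols with arities is a constant, and the bound variables
  are rewritten as a shifted interval to fit \<open>eff_upt\<close>.\<close>

lemma eff_cooccur_fm:
  assumes "effective e enc_nat x" "effective e enc_nat y"
  shows "effective e enc_fm (\<lambda>u. cooccur_fm V (x u) (y u))"
proof -
  let ?l = "map (\<lambda>R. (R, rel_ar V R)) (sorted_list_of_set (rel_syms V))"
  have eq: "cooccur_fm V i j = Disj (map (\<lambda>q. cooccur_in V i j (fst q) (map (\<lambda>k. k + Suc (i + j)) [0..<snd q])) ?l)" for i j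
  proof -
    have "[Suc (i + j)..<Suc (i + j) + n] = map (\<lambda>k. k + Suc (i + j)) [0..<n]" for n
      unfolding map_add_upt by (simp only: add.commute)
    then show ?thesis unfolding cooccur_fm_eq by (simp only: map_map o_def fst_conv snd_conv)
  qed
  show ?thesis unfolding eq
    by (rule eff_Disj, rule eff_map[OF eff_const[of e "enc_list (enc_pair enc_nat enc_nat)" ?l]])
      (rule eff_cooccur_in eff_intros assms assms[THEN eff_comp])+
qed

text \<open>
  The recursion of \<^const>\<open>dist_le_fm\<close> changes its last argument; the \<open>k\<close>-th one is \<open>y + k (x + 1)\<close>.
\<close>

lemma dl_rec:
  "j \<le> r \<Longrightarrow> rec_nat (Eq x (y + r * Suc x)) (\<lambda>j E. Ex (y + (r - j) * Suc x) (And E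
      (Or (Eq (y + (r - j) * Suc x) (y + (r - Suc j) * Suc x))
        (cooccur_fm V (y + (r - j) * Suc x) (y + (r - Suc j) * Suc x))))) j
    = dl j x (y + (r - j) * Suc x)"
proof (induction j)
  case (Suc j)
  have "Suc (x + (y + (r - Suc j) * Suc x)) = y + (r - j) * Suc x"
  proof -
    obtain k where "r - j = Suc k" "r - Suc j = k" using Suc.prems by (metis Suc_diff_Suc Suc_le_lessD)
    then show ?thesis by simp
  qed
  then show ?case using Suc by (simp add: dist_le_fm.simps Let_def)
qed (simp add: dist_le_fm.simps)

lemma eff_dl [eff_intros]:
  assumes "effective e enc_nat r" "effective e enc_nat x" "effective e enc_nat y"
  shows "effective e enc_fm (\<lambda>u. dl (r u) (x u) (y u))"
proof -
  have eq: "dl n i j = rec_nat (Eq i (j + n * Suc i)) (\<lambda>k E. Ex (j + (n - k) * Suc i) (And E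
      (Or (Eq (j + (n - k) * Suc i) (j + (n - Suc k) * Suc i))
        (cooccur_fm V (j + (n - k) * Suc i) (j + (n - Suc k) * Suc i))))) n" for n i j
    using dl_rec[of n n i j] by simp
  show ?thesis unfolding eq by (rule eff_cooccur_fm eff_intros assms assms[THEN eff_comp])+
qed

lemma eff_clique_fm [eff_intros]: "effective e enc_nats ys \<Longrightarrow> effective e enc_fm (\<lambda>u. clique_fm (ys u))"
  subgoal premises assms unfolding clique_fm_def by (rule eff_intros assms assms[THEN eff_comp])+
  done

lemma eff_near_fm [eff_intros]:
  assumes "effective e enc_nat d" "effective e enc_nat x" "effective e enc_nats ys"
  shows "effective e enc_fm (\<lambda>u. near_fm (d u) (x u) (ys u))"
  unfolding near_fm_def by (rule eff_intros assms assms[THEN eff_comp])+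

text \<open>The quantifier is a function that may depend on the input, so its computability is
  assumed on pairs of an input and a formula.\<close>

lemma eff_near_q:
  assumes "effective (enc_pair e enc_fm) enc_fm (\<lambda>p. Q (fst p) (snd p))"
    and "effective e enc_nat D" "effective e enc_nat d" "effective e enc_nat x" "effective e enc_nats ys" "effective e enc_fm f"
  shows "effective e enc_fm (\<lambda>u. near_q (Q u) (D u) (d u) (x u) (ys u) (f u))"
  unfolding near_q_def
  by (rule eff_intros assms(2-) assms(2-)[THEN eff_comp] eff_app2[OF assms(1)])+

lemma eff_outer_vars [eff_intros]:
  assumes "effective e enc_nats ys" "effective e enc_fm f"
  shows "effective e enc_nats (\<lambda>u. outer_vars (ys u) (f u))"
  unfolding outer_vars_def by (rule eff_intros assms assms[THEN eff_comp])+

lemma eff_near_leaf [eff_intros]: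
  assumes "effective e enc_nat D" "effective e enc_nat x" "effective e enc_nats ys" "effective e enc_fm f"
  shows "effective e (enc_list (enc_pair enc_bc enc_fm)) (\<lambda>u. near_leaf (D u) (x u) (ys u) (f u))"
  unfolding near_leaf_def by (rule eff_intros assms assms[THEN eff_comp])+

lemma eff_far_leaf [eff_intros]:
  assumes "effective e enc_nats ys" "effective e enc_fm f"
  shows "effective e (enc_list (enc_pair enc_bc enc_fm)) (\<lambda>u. far_leaf (ys u) (f u))"
  unfolding far_leaf_def by (rule eff_intros assms assms[THEN eff_comp])+

lemma eff_near_bc:
  assumes Q: "effective (enc_pair e enc_fm) enc_fm (\<lambda>p. Q (fst p) (snd p))"
    and a: "effective e enc_nat \<rho>" "effective e enc_nat d" "effective e enc_nat x" "effective e enc_nats ys" "effective e enc_bc \<Phi>"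
  shows "effective e enc_bc (\<lambda>u. near_bc (Q u) (\<rho> u) (d u) (x u) (ys u) (\<Phi> u))"
  unfolding near_bc_def
  by (rule eff_intros eff_cases_bc eff_near_q eff_app2[OF Q] a a[THEN eff_comp])+

lemma eff_complete_delta [eff_intros]:
  assumes "effective e enc_nat r" "effective e enc_nats ys"
  shows "effective e enc_fm (\<lambda>u. complete_delta V (r u) (ys u))"
  unfolding rec_list_complete_delta by (rule eff_intros eff_rec_list assms assms[THEN eff_comp])+

abbreviation "enc_cluster \<equiv> enc_pair enc_nats enc_fm"

lemma eff_clus [eff_intros]:
  assumes "effective e enc_nat r" "effective e enc_cluster C"
  shows "effective e enc_cl (\<lambda>u. clus (r u) (C u))"
  unfolding clus_def
  by (rule eff_const[of _ enc_nat w1] eff_const[of _ enc_type Z] eff_intros assms assms[THEN eff_comp])+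

lemma eff_prodcl [eff_intros]:
  assumes "effective e enc_nat r" "effective e (enc_list enc_cluster) cs"
  shows "effective e enc_cl (\<lambda>u. prodcl (r u) (cs u))"
  unfolding prodcl_def
  by (rule eff_const[of _ enc_cl "CElem Z (\<iota> 1)"] eff_intros assms assms[THEN eff_comp])+

lemma eff_polycl [eff_intros]:
  assumes "effective e enc_nat r" "effective e (enc_list (enc_pair enc_bool (enc_list enc_cluster))) ts"
  shows "effective e enc_cl (\<lambda>u. polycl (r u) (ts u))"
  unfolding polycl_def
  by (rule eff_const[of _ enc_cl "CElem Z (\<iota> 0)"] eff_intros assms assms[THEN eff_comp])+

lemma eff_join [eff_intros]:
  assumes "effective e enc_nat R" "effective e enc_nat z" "effective e enc_cluster C" "effective e enc_cluster m"
  shows "effective e enc_cluster (\<lambda>u. join (R u) (z u) (C u) (m u))"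
  unfolding join_def by (rule eff_intros assms assms[THEN eff_comp])+

lemma rec_list_subs: "subs R z \<eta> cs = rec_list [(True, [], ([z], \<eta>))]
    (\<lambda>C _ r. concat (map (\<lambda>t. [(fst t, C # fst (snd t), snd (snd t)), (\<not> fst t, fst (snd t), join R z C (snd (snd t)))]) r)) cs"
  by (induction cs) auto

lemma eff_True [eff_intros]: "effective e enc_bool (\<lambda>x. True)"
  by (rule eff_const)

lemma inj_enc_bool [eff_intros]: "inj enc_bool"
  by (auto simp: inj_def enc_bool_def)

lemma eff_subs [eff_intros]:
  assumes "effective e enc_nat R" "effective e enc_nat z" "effective e enc_fm \<eta>" "effective e (enc_list enc_cluster) cs"
  shows "effective e (enc_list (enc_pair enc_bool (enc_pair (enc_list enc_cluster) enc_cluster))) (\<lambda>u. subs (R u) (z u) (\<eta> u) (cs u))"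
  unfolding rec_list_subs by (rule eff_intros eff_rec_list assms assms[THEN eff_comp])+

lemma rec_list_expand: "expand R y \<theta> zs = rec_list [(True, [])]
    (\<lambda>z _ r. concat (map (\<lambda>t. map (\<lambda>u. (fst u = fst t, snd (snd u) # fst (snd u))) (subs R z (inst y \<theta> z) (snd t))) r)) zs"
  by (induction zs) auto

lemma eff_expand [eff_intros]:
  assumes "effective e enc_nat R" "effective e enc_nat y" "effective e enc_fm \<theta>" "effective e enc_nats zs"
  shows "effective e (enc_list (enc_pair enc_bool (enc_list enc_cluster))) (\<lambda>u. expand (R u) (y u) (\<theta> u) (zs u))"
  unfolding rec_list_expand by (rule eff_intros eff_rec_list assms assms[THEN eff_comp])+

lemma eff_scat_bc [eff_intros]:
  assumes "effective e enc_nat \<rho>" "effective e enc_nat R" "effective e enc_nat y" "effective e enc_fm \<theta>" "effective e enc_nats zs"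
  shows "effective e enc_bc (\<lambda>u. scat_bc (\<rho> u) (R u) (y u) (\<theta> u) (zs u))"
  unfolding scat_bc_def by (rule eff_intros assms assms[THEN eff_comp])+

abbreviation "enc_nf \<equiv> enc_pair enc_bc enc_nat"

lemma eff_exq [eff_intros]:
  assumes "effective e enc_nats X" "effective e enc_nat d" "effective e enc_nat z" "effective e enc_nf p"
  shows "effective e enc_nf (\<lambda>u. exq (X u) (d u) (z u) (p u))"
  unfolding exq_def by (rule eff_near_bc eff_intros assms assms[THEN eff_comp])+

lemma rec_list_scat_at: "scat_at R y \<theta> zs = rec_list BTop (\<lambda>z zs r. BAnd (Local (inst y \<theta> z))
     (BAnd (BConj (map (\<lambda>z'. BNeg (Local (dl R z z'))) zs)) r)) zs"
  by (induction zs) auto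

lemma eff_scat_at [eff_intros]:
  assumes "effective e enc_nat R" "effective e enc_nat y" "effective e enc_fm \<theta>" "effective e enc_nats zs"
  shows "effective e enc_bc (\<lambda>u. scat_at (R u) (y u) (\<theta> u) (zs u))"
  unfolding rec_list_scat_at by (rule eff_intros eff_rec_list assms assms[THEN eff_comp])+

lemma eff_scat_near [eff_intros]:
  assumes "effective e enc_nats X" "effective e enc_nat d" "effective e enc_nat \<rho>" "effective e enc_nat R" "effective e enc_nat y"
    "effective e enc_fm \<theta>" "effective e enc_nats zs"
  shows "effective e enc_nf (\<lambda>u. scat_near (X u) (d u) (\<rho> u) (R u) (y u) (\<theta> u) (zs u))"
  unfolding scat_near_def by (rule eff_intros assms assms[THEN eff_comp])+

lemma eff_fresh_vars [eff_intros]: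
  assumes "effective e enc_nats X" "effective e enc_nat y" "effective e enc_nat n"
  shows "effective e enc_nats (\<lambda>u. fresh_vars (X u) (y u) (n u))"
  unfolding fresh_vars_def by (rule eff_intros assms assms[THEN eff_comp])+

lemma eff_far_scat [eff_intros]:
  assumes "effective e enc_nats X" "effective e enc_nat y" "effective e enc_nat d" "effective e enc_nat \<rho>" "effective e enc_fm \<theta>" "effective e enc_nat n"
  shows "effective e enc_nf (\<lambda>u. far_scat (X u) (y u) (d u) (\<rho> u) (\<theta> u) (n u))"
  unfolding far_scat_def by (rule eff_intros assms assms[THEN eff_comp])+

lemma eff_far_mid [eff_intros]:
  assumes "effective e enc_nats X" "effective e enc_nat y" "effective e enc_nat d" "effective e enc_nat \<rho>" "effective e enc_fm \<theta>"
  shows "effective e enc_nf (\<lambda>u. far_mid (X u) (y u) (d u) (\<rho> u) (\<theta> u))"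
  unfolding far_mid_def by (rule eff_intros assms assms[THEN eff_comp])+

lemma eff_BDisjs [eff_intros]:
  assumes "effective e (enc_list enc_nf) ps"
  shows "effective e enc_nf (\<lambda>u. BDisjs (ps u))"
  unfolding BDisjs_def by (rule eff_intros assms assms[THEN eff_comp])+

lemma eff_far_ex [eff_intros]:
  assumes "effective e enc_nats X" "effective e enc_nat y" "effective e enc_nat d" "effective e enc_nat \<rho>" "effective e enc_fm \<theta>"
  shows "effective e enc_nf (\<lambda>u. far_ex (X u) (y u) (d u) (\<rho> u) (\<theta> u))"
  unfolding far_ex_def by (rule eff_intros assms assms[THEN eff_comp])+

lemma eff_norm_ex [eff_intros]:
  assumes "effective e enc_nats X" "effective e enc_nat y" "effective e enc_nf q"
  shows "effective e enc_nf (\<lambda>u. norm_ex (X u) (y u) (q u))"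
  unfolding norm_ex_def by (rule eff_cases_bc eff_intros assms assms[THEN eff_comp])+

abbreviation "enc_tab \<equiv> enc_list (enc_pair enc_elem (enc_pair enc_elem enc_elem))"

lemma rec_list_sum_near: "sum_near tb w \<rho> d ys \<Phi> X =
   rec_list (map (\<lambda>t. (BTop, fst t)) (filter (\<lambda>t. fst (snd t) = fst t \<and> snd (snd t) = fst t) tb))
     (\<lambda>x X r. concat (map (\<lambda>t. map (\<lambda>p.
       (BAnd (near_bc (WSum (fst t) w ys) \<rho> d x ys
          (BAnd \<Phi> (BConj (map (\<lambda>x'. BNeg (Local (dl d x' (hd ys)))) X)))) (fst p), snd (snd t)))
     (filter (\<lambda>p. snd p = fst (snd t)) r)) tb)) X"
  by (induction X) auto

lemma eff_sum_near [eff_intros]: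
  assumes "effective e enc_tab tb" "effective e enc_nat w" "effective e enc_nat \<rho>" "effective e enc_nat d" "effective e enc_nats ys"
    "effective e enc_bc \<Phi>" "effective e enc_nats X"
  shows "effective e (enc_list (enc_pair enc_bc enc_elem)) (\<lambda>u. sum_near (tb u) (w u) (\<rho> u) (d u) (ys u) (\<Phi> u) (X u))"
  unfolding rec_list_sum_near
  by (rule eff_near_bc eff_intros eff_rec_list assms assms[THEN eff_comp])+

lemma eff_norm_sum [eff_intros]:
  assumes "effective e enc_tab tb" "effective e enc_nats X" "effective e enc_elem s" "effective e enc_nat w" "effective e enc_nats ys" "effective e enc_nf q"
  shows "effective e enc_nf (\<lambda>u. norm_sum (tb u) (X u) (s u) (w u) (ys u) (q u))"
  unfolding norm_sum_def by (rule eff_cases_bc eff_intros assms assms[THEN eff_comp])+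

lemma eff_norm_atom [eff_intros]:
  assumes "effective e enc_fm f"
  shows "effective e enc_nf (\<lambda>u. norm_atom (f u))"
  unfolding norm_atom_def by (rule eff_intros assms assms[THEN eff_comp])+

lemma finite_wt_syms: "finite (wt_syms V)"
  using voc by (simp add: vocabulary_def)

lemma eff_tab: "effective enc_nat enc_tab tab"
  by (rule eff_finite_support[OF finite_wt_syms, of _ "[]"]) (simp add: tab_def)

lemma eff_zeros: "effective enc_nat (enc_list enc_elem) zeros"
  by (rule eff_finite_support[OF finite_wt_syms, of _ "[]"]) (simp add: zeros_def)

lemma eff_nform: "effective enc_fm enc_nf nform"
  by (rule eff_rec_fm[of nform "\<lambda>x y. (Local (Eq x y), 1)" "\<lambda>R xs. norm_atom (Rel R xs)"
        "\<lambda>s w xs. (if zeros w = [s] then BNeg (Local (Neg (WEq s w xs))) else Local (WEq s w xs), 1)"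
        "\<lambda>a. (BNeg (fst a), snd a)" "\<lambda>a b. (BOr (fst a) (fst b), snd a + snd b)"
        "\<lambda>y f a. norm_ex (fvl (Ex y f)) y a" "\<lambda>s w ys f a. norm_sum (tab w) (fvl (WSum s w ys f)) s w ys a"
        "\<lambda>P ts. norm_atom (Pred P ts)"])
    (simp only: nform.simps | rule eff_intros eff_comp[OF eff_tab] eff_comp[OF eff_zeros])+

text \<open>The transformation is total on formulas, well-formed or not, so the algorithm has no
  well-formedness to check.\<close>

lemma computable_nform:
  "\<exists>F. computable F \<and> (\<forall>\<phi>. F (enc_fm \<phi>) =
     enc_output (fst (nform \<phi>)) (map (\<lambda>_. snd (nform \<phi>)) (cl_leaves (fst (nform \<phi>)))) (snd (nform \<phi>)))"
proof -
  have "effective enc_fm (\<lambda>p. enc_output (fst p) (fst (snd p)) (snd (snd p)))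
      (\<lambda>\<phi>. (fst (nform \<phi>), map (\<lambda>_. snd (nform \<phi>)) (cl_leaves (fst (nform \<phi>))), snd (nform \<phi>)))"
  proof (rule eff_tag3[where k = 0])
    show "effective enc_fm enc_bc (\<lambda>\<phi>. fst (nform \<phi>))"
      by (rule eff_intros eff_nform)+
    show "effective enc_fm enc_nats (\<lambda>\<phi>. map (\<lambda>_. snd (nform \<phi>)) (cl_leaves (fst (nform \<phi>))))"
      by (rule eff_map eff_comp[OF eff_cl_leaves] eff_intros eff_nform eff_comp[OF eff_nform])+
    show "effective enc_fm enc_nat (\<lambda>\<phi>. snd (nform \<phi>))"
      by (rule eff_intros eff_nform)+
  qed (simp add: enc_output_def)
  then show ?thesis unfolding effective_def by simp
qed

end

theorem theorem4p13:
  fixes V :: "('s, 'v) vocab" and Z :: 's and \<iota> :: "int \<Rightarrow> 'v" and w1 :: nat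
    and K :: "('a::infinite, 'v) wstruct set"
  assumes "vocabulary V"
    and "is_ring V Z" and "\<iota> \<in> ring_iso \<Z> (alg V Z)"
    and "w1 \<in> wt_syms V" and "wt_ar V w1 = 1" and "wt_type V w1 = Z"
    and "K = structures_with_one V \<iota> w1"
  shows "(\<forall>\<phi>. fow1 V \<phi> \<longrightarrow>
            (\<exists>\<Phi>. normal_form V K Z (free \<phi>) \<Phi> \<and> equivalent_on V K Z \<iota> \<phi> \<Phi>)) \<and>
         (\<exists>F. computable F \<and>
            (\<forall>\<phi>. fow1 V \<phi> \<longrightarrow>
               (\<exists>\<Phi> rs r. F (enc_fm \<phi>) = enc_output \<Phi> rs r \<and>
                  normal_form V K Z (free \<phi>) \<Phi> \<and> equivalent_on V K Z \<iota> \<phi> \<Phi> \<and>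
                  list_all2 (\<lambda>g r'. cl_term V K r' g Z) (cl_leaves \<Phi>) rs \<and>
                  (\<forall>\<psi>\<in>local_leaves \<Phi>. local_around V K r \<psi> (free \<psi>)) \<and>
                  (\<forall>\<chi>\<in>agg_leaves \<Phi>. local_agg_sentence V K r \<chi>))))"
proof -
  interpret weighted V Z \<iota> w1 K
    using assms by unfold_locales
  obtain F where F: "computable F" "\<forall>\<phi>. F (enc_fm \<phi>) =
     enc_output (fst (nform \<phi>)) (map (\<lambda>_. snd (nform \<phi>)) (cl_leaves (fst (nform \<phi>)))) (snd (nform \<phi>))"
    using computable_nform by blast
  show ?thesis
  proof (intro conjI exI[of _ F] F(1) allI impI)
    fix \<phi> assume \<phi>: "fow1 V \<phi>"
    note P = nform_properties[OF \<phi>]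
    show "\<exists>\<Phi>. normal_form V K Z (free \<phi>) \<Phi> \<and> equivalent_on V K Z \<iota> \<phi> \<Phi>"
      using P(1,2) by blast
    show "\<exists>\<Phi> rs r. F (enc_fm \<phi>) = enc_output \<Phi> rs r \<and>
        normal_form V K Z (free \<phi>) \<Phi> \<and> equivalent_on V K Z \<iota> \<phi> \<Phi> \<and>
        list_all2 (\<lambda>g r'. cl_term V K r' g Z) (cl_leaves \<Phi>) rs \<and>
        (\<forall>\<psi>\<in>local_leaves \<Phi>. local_around V K r \<psi> (free \<psi>)) \<and>
        (\<forall>\<chi>\<in>agg_leaves \<Phi>. local_agg_sentence V K r \<chi>)"
      by (intro exI conjI, rule F(2)[rule_format]) (fact P)+
  qed
qed

end
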